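(* Let $d\ge1$ and $a\in\mathbb{C}$. In the Poisson algebra $Z_c$ (center of the rational Cherednik algebra at $t=0$ of the dihedral group of order $2d$ with constant parameter $a$) we have $$\{q,Q\}=\boldsymbol{eu},\qquad \{\boldsymbol{eu},q\}=-2q,\qquad \{\boldsymbol{eu},Q\}=2Q.$$ Moreover, if $0\le j\le d$, then $$\{q,\boldsymbol{a}_j\}=j\,\boldsymbol{a}_{j-1},\qquad \{\boldsymbol{eu},\boldsymbol{a}_j\}=(2j-d)\,\boldsymbol{a}_j,\qquad \{Q,\boldsymbol{a}_j\}=(j-d)\,\boldsymbol{a}_{j+1},$$ with the convention that $\boldsymbol{a}_{-1}=\boldsymbol{a}_{d+1}=0$.
   Context: Let $\zeta\in\mathbb{C}$ be a primitive $d$-th root of unity, $V=\mathbb{C}^2$ with canonical basis $(x,y)$, and $(X,Y)$ the dual basis of $V^*$. For $i\in\mathbb{Z}/d\mathbb{Z}$ let $s_i=\begin{pmatrix}0&\zeta^i\\ \zeta^{-i}&0\end{pmatrix}\in \mathrm{GL}_2(\mathbb{C})$ and $W=\langle s_0,s_1\rangle$, the dihedral group of order $2d$, whose reflections are the $s_i$. It acts by $s_i(x)=\zeta^{-i}y$, $s_i(y)=\zeta^i x$, $s_i(X)=\zeta^iY$, $s_i(Y)=\zeta^{-i}X$. For $\hbar$ an indeterminate, let $H_{\hbar,c}$ be the $\mathbb{C}[\hbar]$-algebra quotient of $\mathbb{C}[\hbar]\otimes(T(V\oplus V^* )\rtimes W)$ by the relations $[x,y]=[X,Y]=0$, $[x,X]=[y,Y]=\hbar-a\sum_i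 s_i$, $[x,Y]=a\sum_i\zeta^{-i}s_i$, $[y,X]=a\sum_i\zeta^i s_i$ (sums over $i\in\mathbb{Z}/d\mathbb{Z}$), and let $H_c=H_{\hbar,c}/\hbar H_{\hbar,c}$ (rational Cherednik algebra at $t=0$). $Z_c$ is the center of $H_c$, with Poisson bracket $\{z,z'\}=\big(\hbar^{-1}[\hat z,\hat z']\big)\bmod \hbar$ for any lifts $\hat z,\hat z'\in H_{\hbar,c}$ of $z,z'\in Z_c$. Multiplication gives a vector space isomorphism $\mathbb{C}[x,y]\otimes\mathbb{C}[X,Y]\otimes\mathbb{C}W\simeq H_c$; identify $\mathbb{C}[x,y]\otimes\mathbb{C}[X,Y]$ with $\mathbb{C}[V\times V^*]$. Let $\mathrm{Trunc}_c:H_c\to\mathbb{C}[V\times V^*]$ be the linear map with $\mathrm{Trunc}_c(fw)=f$ if $w=1$ and $0$ if $w\in W\setminus\{1\}$, for $f\in\mathbb{C}[V\times V^*]$. It is known that $\mathrm{Trunc}_c$ restricts to a linear isomorphism $Z_c\to\mathbb{C}[V\times V^*]^W$, linear over $\mathbb{C}[V]^W\otimes\mathbb{C}[V^*]^W\subset Z_c$. Set $q=xy$, $Q=XY$ (central in $H_c$). The elements $\boldsymbol{eu},\boldsymbol{a}_0,\dots,\boldsymbol{a}_d\in Z_c$ are the unique elements of $Z_c$ with $\mathrm{Trunc}_c(\boldsymbol{eu})=xX+yY$ and $\mathrm{Trunc}_c(\boldsymbol{a}_j)=x^{d-j}Y^j+y^{d-j}X^j$ for $0\le j\le d$. (Explicitly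 $\boldsymbol{eu}=xX+yY+a\sum_i s_i$.) *)

theory Defs
  imports
    "HOL-Analysis.Analysis"
    "HOL-Library.Poly_Mapping"
    "HOL-Computational_Algebra.Polynomial"
    "HOL-Algebra.QuotRing"
    "HOL-Algebra.Generated_Groups"
begin

section \<open>The dihedral group inside \<open>GL\<^sub>2(\<complex>)\<close>\<close>

type_synonym mat2 = "complex ^ 2 ^ 2"

definition primitive_root_of_unity :: "nat \<Rightarrow> complex \<Rightarrow> bool" where
  "primitive_root_of_unity d \<zeta> \<longleftrightarrow> \<zeta> ^ d = 1 \<and> (\<forall>k. 0 < k \<and> k < d \<longrightarrow> \<zeta> ^ k \<noteq> 1)"

definition GL2 :: "mat2 monoid" where
  "GL2 = units_of \<lparr>carrier = UNIV, mult = (**), one = mat 1\<rparr>"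

definition reflection :: "complex \<Rightarrow> nat \<Rightarrow> mat2" where
  "reflection \<zeta> i = vector [vector [0, \<zeta> ^ i], vector [inverse (\<zeta> ^ i), 0]]"

definition dihedral :: "complex \<Rightarrow> mat2 set" where
  "dihedral \<zeta> = generate GL2 {reflection \<zeta> 0, reflection \<zeta> 1}"

section \<open>The tensor algebra of \<open>V \<oplus> V\<^sup>*\<close> over \<open>\<complex>[\<hbar>]\<close>\<close>

text \<open>\<open>Vec 1\<close>, \<open>Vec 2\<close> are the canonical basis vectors \<open>x\<close>, \<open>y\<close> of \<open>V = \<complex>\<^sup>2\<close>, and
  \<open>Covec 1\<close>, \<open>Covec 2\<close> are the dual basis vectors \<open>X\<close>, \<open>Y\<close> of \<open>V\<^sup>*\<close>.\<close>

datatype gen = Vec 2 | Covec 2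

text \<open>Words form the free monoid, written additively because the product of \<open>poly_mapping\<close>
  is the convolution product with respect to \<open>+\<close> on the keys. Hence \<open>gen word \<Rightarrow>\<^sub>0 complex poly\<close> is
  the free algebra on \<open>gen\<close> over \<open>\<complex>[\<hbar>]\<close>, i.e. \<open>\<complex>[\<hbar>] \<otimes> T(V \<oplus> V\<^sup>*)\<close>.\<close>

datatype 'a word = Word (letters: "'a list")

instantiation word :: (type) monoid_add
begin

definition zero_word :: "'a word" where
  "zero_word = Word []"

definition plus_word :: "'a word \<Rightarrow> 'a word \<Rightarrow> 'a word" where
  "plus_word u v = Word (letters u @ letters v)"

instance
  by standard (simp_all add: zero_word_def plus_word_def)

end

type_synonym tensor = "gen word \<Rightarrow>\<^sub>0 complex poly"

definition letter :: "gen \<Rightarrow> tensor" where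
  "letter g = Poly_Mapping.single (Word [g]) 1"

definition coeff_emb :: "complex poly \<Rightarrow> tensor" where
  "coeff_emb p = Poly_Mapping.single 0 p"

text \<open>The natural action of a matrix on \<open>V\<close> and the contragredient action on \<open>V\<^sup>*\<close>:
  a linear form \<open>\<xi>\<close> is sent to \<open>\<xi> \<circ> w\<^sup>-\<^sup>1\<close>.\<close>

fun act_gen :: "mat2 \<Rightarrow> gen \<Rightarrow> tensor" where
  "act_gen w (Vec k) = (\<Sum>j\<in>UNIV. coeff_emb [:w $ j $ k:] * letter (Vec j))"
| "act_gen w (Covec k) = (\<Sum>j\<in>UNIV. coeff_emb [:matrix_inv w $ k $ j:] * letter (Covec j))"

definition act :: "mat2 \<Rightarrow> tensor \<Rightarrow> tensor" where
  "act w t = (\<Sum>u\<in>Poly_Mapping.keys t.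
     coeff_emb (Poly_Mapping.lookup t u) * prod_list (map (act_gen w) (letters u)))"

section \<open>The semidirect product \<open>\<complex>[\<hbar>] \<otimes> (T(V \<oplus> V\<^sup>*) \<rtimes> W)\<close>\<close>

text \<open>The element \<open>Poly_Mapping.single w t\<close> stands for \<open>t \<cdot> w\<close>;
  the product is \<open>(t \<cdot> w) (t' \<cdot> w') = t w(t') \<cdot> w w'\<close>.\<close>

type_synonym smash = "mat2 \<Rightarrow>\<^sub>0 tensor"

definition smash_mult :: "smash \<Rightarrow> smash \<Rightarrow> smash" where
  "smash_mult F G = (\<Sum>w\<in>Poly_Mapping.keys F. \<Sum>w'\<in>Poly_Mapping.keys G.
     Poly_Mapping.single (w ** w') (Poly_Mapping.lookup F w * act w (Poly_Mapping.lookup G w')))"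

definition tensor_emb :: "tensor \<Rightarrow> smash" where
  "tensor_emb t = Poly_Mapping.single (mat 1) t"

definition group_emb :: "mat2 \<Rightarrow> smash" where
  "group_emb w = Poly_Mapping.single w 1"

definition smash_ring :: "complex \<Rightarrow> smash ring" where
  "smash_ring \<zeta> =
     \<lparr>carrier = {F. Poly_Mapping.keys F \<subseteq> dihedral \<zeta>}, mult = smash_mult,
      one = tensor_emb 1, zero = 0, add = (+)\<rparr>"

section \<open>The rational Cherednik algebras\<close>

abbreviation gx :: tensor where "gx \<equiv> letter (Vec 1)"
abbreviation gy :: tensor where "gy \<equiv> letter (Vec 2)"
abbreviation gX :: tensor where "gX \<equiv> letter (Covec 1)"
abbreviation gY :: tensor where "gY \<equiv> letter (Covec 2)"
abbreviation ghbar :: tensor where "ghbar \<equiv> coeff_emb [:0, 1:]"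

definition tcomm :: "tensor \<Rightarrow> tensor \<Rightarrow> smash" where
  "tcomm t t' = tensor_emb (t * t' - t' * t)"

definition scaled_group :: "complex \<Rightarrow> mat2 \<Rightarrow> smash" where
  "scaled_group c w = Poly_Mapping.single w (coeff_emb [:c:])"

definition cherednik_relators :: "nat \<Rightarrow> complex \<Rightarrow> complex \<Rightarrow> smash set" where
  "cherednik_relators d \<zeta> a =
     {tcomm gx gy,
      tcomm gX gY,
      tcomm gx gX - (tensor_emb ghbar - (\<Sum>i<d. scaled_group a (reflection \<zeta> i))),
      tcomm gy gY - (tensor_emb ghbar - (\<Sum>i<d. scaled_group a (reflection \<zeta> i))),
      tcomm gx gY - (\<Sum>i<d. scaled_group (a * inverse (\<zeta> ^ i)) (reflection \<zeta> i)),
      tcomm gy gX - (\<Sum>i<d. scaled_group (a * \<zeta> ^ i) (reflection \<zeta> i))}"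

definition cherednik_ideal :: "nat \<Rightarrow> complex \<Rightarrow> complex \<Rightarrow> smash set" where
  "cherednik_ideal d \<zeta> a = genideal (smash_ring \<zeta>) (cherednik_relators d \<zeta> a)"

definition H_hbar :: "nat \<Rightarrow> complex \<Rightarrow> complex \<Rightarrow> smash set ring" where
  "H_hbar d \<zeta> a = smash_ring \<zeta> Quot cherednik_ideal d \<zeta> a"

definition to_H_hbar :: "nat \<Rightarrow> complex \<Rightarrow> complex \<Rightarrow> smash \<Rightarrow> smash set" where
  "to_H_hbar d \<zeta> a F = cherednik_ideal d \<zeta> a +>\<^bsub>smash_ring \<zeta>\<^esub> F"

definition hbar :: "nat \<Rightarrow> complex \<Rightarrow> complex \<Rightarrow> smash set" where
  "hbar d \<zeta> a = to_H_hbar d \<zeta> a (tensor_emb ghbar)"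

definition hbar_ideal :: "nat \<Rightarrow> complex \<Rightarrow> complex \<Rightarrow> smash set set" where
  "hbar_ideal d \<zeta> a = {hbar d \<zeta> a \<otimes>\<^bsub>H_hbar d \<zeta> a\<^esub> h | h. h \<in> carrier (H_hbar d \<zeta> a)}"

definition H_c :: "nat \<Rightarrow> complex \<Rightarrow> complex \<Rightarrow> smash set set ring" where
  "H_c d \<zeta> a = H_hbar d \<zeta> a Quot hbar_ideal d \<zeta> a"

definition mod_hbar :: "nat \<Rightarrow> complex \<Rightarrow> complex \<Rightarrow> smash set \<Rightarrow> smash set set" where
  "mod_hbar d \<zeta> a h = hbar_ideal d \<zeta> a +>\<^bsub>H_hbar d \<zeta> a\<^esub> h"

definition to_H_c :: "nat \<Rightarrow> complex \<Rightarrow> complex \<Rightarrow> smash \<Rightarrow> smash set set" where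
  "to_H_c d \<zeta> a F = mod_hbar d \<zeta> a (to_H_hbar d \<zeta> a F)"

definition scale_c :: "nat \<Rightarrow> complex \<Rightarrow> complex \<Rightarrow> complex \<Rightarrow> smash set set \<Rightarrow> smash set set" where
  "scale_c d \<zeta> a c h = to_H_c d \<zeta> a (tensor_emb (coeff_emb [:c:])) \<otimes>\<^bsub>H_c d \<zeta> a\<^esub> h"

section \<open>The center and its Poisson bracket\<close>

definition Z_c :: "nat \<Rightarrow> complex \<Rightarrow> complex \<Rightarrow> smash set set set" where
  "Z_c d \<zeta> a = {z \<in> carrier (H_c d \<zeta> a).
     \<forall>h\<in>carrier (H_c d \<zeta> a). z \<otimes>\<^bsub>H_c d \<zeta> a\<^esub> h = h \<otimes>\<^bsub>H_c d \<zeta> a\<^esub> z}"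

text \<open>Here \<open>u\<close> is \<open>\<hbar>\<^sup>-\<^sup>1[l, l']\<close>: the bracket is the value \<open>u mod \<hbar>\<close>, the same for all lifts
  \<open>l\<close>, \<open>l'\<close> of \<open>z\<close>, \<open>z'\<close>.\<close>

definition poisson ::
  "nat \<Rightarrow> complex \<Rightarrow> complex \<Rightarrow> smash set set \<Rightarrow> smash set set \<Rightarrow> smash set set" where
  "poisson d \<zeta> a z z' = (THE p. \<exists>l l' u.
     l \<in> carrier (H_hbar d \<zeta> a) \<and> l' \<in> carrier (H_hbar d \<zeta> a) \<and> u \<in> carrier (H_hbar d \<zeta> a) \<and>
     mod_hbar d \<zeta> a l = z \<and> mod_hbar d \<zeta> a l' = z' \<and>
     l \<otimes>\<^bsub>H_hbar d \<zeta> a\<^esub> l' \<ominus>\<^bsub>H_hbar d \<zeta> a\<^esub> l' \<otimes>\<^bsub>H_hbar d \<zeta> a\<^esub> l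
       = hbar d \<zeta> a \<otimes>\<^bsub>H_hbar d \<zeta> a\<^esub> u \<and>
     p = mod_hbar d \<zeta> a u)"

section \<open>The map \<open>Trunc\<^sub>c\<close>\<close>

text \<open>\<open>\<complex>[V \<times> V\<^sup>*] = \<complex>[x,y] \<otimes> \<complex>[X,Y]\<close>, with the elements of \<open>gen\<close> as variables.\<close>

type_synonym cpoly = "(gen \<Rightarrow>\<^sub>0 nat) \<Rightarrow>\<^sub>0 complex"

definition var :: "gen \<Rightarrow> cpoly" where
  "var g = Poly_Mapping.single (Poly_Mapping.single g 1) 1"

abbreviation vx :: cpoly where "vx \<equiv> var (Vec 1)"
abbreviation vy :: cpoly where "vy \<equiv> var (Vec 2)"
abbreviation vX :: cpoly where "vX \<equiv> var (Covec 1)"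
abbreviation vY :: cpoly where "vY \<equiv> var (Covec 2)"

definition ordered_monomial :: "(gen \<Rightarrow>\<^sub>0 nat) \<Rightarrow> tensor" where
  "ordered_monomial m =
     gx ^ Poly_Mapping.lookup m (Vec 1) * gy ^ Poly_Mapping.lookup m (Vec 2) *
     gX ^ Poly_Mapping.lookup m (Covec 1) * gY ^ Poly_Mapping.lookup m (Covec 2)"

definition ordered :: "cpoly \<Rightarrow> tensor" where
  "ordered f = (\<Sum>m\<in>Poly_Mapping.keys f.
     coeff_emb [:Poly_Mapping.lookup f m:] * ordered_monomial m)"

text \<open>The multiplication map \<open>\<complex>[x,y] \<otimes> \<complex>[X,Y] \<otimes> \<complex>W \<rightarrow> H\<^sub>c\<close>; an element
  \<open>\<Sum>\<^sub>w f\<^sub>w \<otimes> w\<close> of the source is the finitely supported function \<open>w \<mapsto> f\<^sub>w\<close>.\<close>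

definition pbw :: "nat \<Rightarrow> complex \<Rightarrow> complex \<Rightarrow> (mat2 \<Rightarrow>\<^sub>0 cpoly) \<Rightarrow> smash set set" where
  "pbw d \<zeta> a F = to_H_c d \<zeta> a (\<Sum>w\<in>Poly_Mapping.keys F.
     Poly_Mapping.single w (ordered (Poly_Mapping.lookup F w)))"

definition Trunc :: "nat \<Rightarrow> complex \<Rightarrow> complex \<Rightarrow> smash set set \<Rightarrow> cpoly" where
  "Trunc d \<zeta> a h = Poly_Mapping.lookup
     (THE F. Poly_Mapping.keys F \<subseteq> dihedral \<zeta> \<and> pbw d \<zeta> a F = h) (mat 1)"

section \<open>The distinguished central elements\<close>

definition qc :: "nat \<Rightarrow> complex \<Rightarrow> complex \<Rightarrow> smash set set" where
  "qc d \<zeta> a = to_H_c d \<zeta> a (tensor_emb (gx * gy))"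

definition Qc :: "nat \<Rightarrow> complex \<Rightarrow> complex \<Rightarrow> smash set set" where
  "Qc d \<zeta> a = to_H_c d \<zeta> a (tensor_emb (gX * gY))"

definition central_lift :: "nat \<Rightarrow> complex \<Rightarrow> complex \<Rightarrow> cpoly \<Rightarrow> smash set set" where
  "central_lift d \<zeta> a f = (THE z. z \<in> Z_c d \<zeta> a \<and> Trunc d \<zeta> a z = f)"

definition eu :: "nat \<Rightarrow> complex \<Rightarrow> complex \<Rightarrow> smash set set" where
  "eu d \<zeta> a = central_lift d \<zeta> a (vx * vX + vy * vY)"

text \<open>The index is an integer so that the convention \<open>a\<^sub>-\<^sub>1 = a\<^sub>d\<^sub>+\<^sub>1 = 0\<close> can be built in.\<close>

definition aa :: "nat \<Rightarrow> complex \<Rightarrow> complex \<Rightarrow> int \<Rightarrow> smash set set" where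
  "aa d \<zeta> a j =
     (if 0 \<le> j \<and> j \<le> int d
      then central_lift d \<zeta> a (vx ^ (d - nat j) * vY ^ nat j + vy ^ (d - nat j) * vX ^ nat j)
      else \<zero>\<^bsub>H_c d \<zeta> a\<^esub>)"

end

theory Submission
  imports Defs
begin

text \<open>
  The free module on the ordered monomials \<open>x\<^sup>a y\<^sup>b X\<^sup>c Y\<^sup>e g\<close> over \<open>\<complex>[\<hbar>]\<close> carries
  operators \<open>x\<close>, \<open>y\<close>, \<open>g\<close> and, by recursion on \<open>a\<close> and \<open>b\<close>, operators \<open>X\<close>, \<open>Y\<close> with the prescribed
  commutators. They satisfy the defining relations, and reordering words modulo the relations
  follows the same recursion, so the algebra is faithfully represented and the ordered monomials
  are a basis (PBW). In particular the algebra has no \<open>\<hbar>\<close>-torsion, the bracket is well defined, and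
  brackets of central elements are central by the Jacobi identity.

  The derivation \<open>{Q, _}\<close> sends \<open>x\<close> to \<open>-Y\<close>, \<open>y\<close> to \<open>-X\<close> and kills \<open>X\<close>, \<open>Y\<close>. Hence it sends the sum
  \<open>P\<^sub>j\<close> of all words with \<open>d - j\<close> letters \<open>x\<close> and \<open>j\<close> letters \<open>Y\<close> to \<open>-(j + 1) P\<^sub>j\<^sub>+\<^sub>1\<close>, and similarly for
  \<open>q\<close> and \<open>eu\<close>. Starting from the central element \<open>x\<^sup>d + y\<^sup>d\<close> all \<open>P\<^sub>j + P'\<^sub>j\<close>, with \<open>P'\<^sub>j\<close> the
  same sum in \<open>y\<close> and \<open>X\<close>, are central. It remains to see that their truncation is
  \<open>d choose j\<close> times \<open>x\<^sup>d\<^sup>-\<^sup>j Y\<^sup>j + y\<^sup>d\<^sup>-\<^sup>j X\<^sup>j\<close>: the leading term is right, and lower terms are excluded by the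
  symmetry \<open>x \<mapsto> t x\<close>, \<open>Y \<mapsto> t Y\<close>, \<open>y \<mapsto> t\<^sup>-\<^sup>1 y\<close>, \<open>X \<mapsto> t\<^sup>-\<^sup>1 X\<close>, \<open>s\<^sub>i \<mapsto> s\<^sub>i\<^sub>+\<^sub>1\<close> with \<open>t\<close> a square root of
  \<open>\<zeta>\<close> of order \<open>2d\<close>. A central element is determined by its truncation since its part of top degree
  commutes with \<open>x\<close>.
\<close>

section \<open>Finitely supported functions\<close>

text \<open>The algebra is given by generators and relations, so even the absence of \<hbar>-torsion
  is invisible at first. All computations therefore take place in the ring \<open>R\<close> of
  operators, which the representation identifies with the algebra; \<open>kap\<close> carries the
  results to H_c.

  Why a square root t of \<zeta>: let x, Y have weight 1 and y, X weight -1. Rotations in W see the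
  weight only modulo d, so invariance under them cannot separate the word sums, of weight d or -d,
  from lower terms of weight 0 such as 1 or xy. Since t has order 2d, t^w differs from t^d and
  t^(-d), both equal to -1, whenever |w| < d. The shift of reflections that comes with t is a
  symmetry because all reflections carry the same parameter a.

  Under the bracket q, eu, Q form an sl_2-triple, and for fixed d the elements a_j behave like the
  weight vectors of its (d + 1)-dimensional representation. The word sums are the basis on which Q
  acts by counting, the a_j the basis with leading coefficient 1; the binomial coefficients
  translate between the two.\<close>

definition pm_sum :: "('k \<Rightarrow> 'b::zero \<Rightarrow> 'c::comm_monoid_add) \<Rightarrow> ('k \<Rightarrow>\<^sub>0 'b) \<Rightarrow> 'c" where
  "pm_sum f p = (\<Sum>k\<in>Poly_Mapping.keys p. f k (Poly_Mapping.lookup p k))"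

lemma pm_sum_superset:
  assumes "finite A" "Poly_Mapping.keys p \<subseteq> A" "\<And>k. f k 0 = 0"
  shows "pm_sum f p = (\<Sum>k\<in>A. f k (Poly_Mapping.lookup p k))"
  unfolding pm_sum_def using assms
  by (intro sum.mono_neutral_left) (auto simp: in_keys_iff)

lemma pm_sum_0 [simp]: "pm_sum f 0 = 0"
  by (simp add: pm_sum_def)

lemma pm_sum_single: "f k 0 = 0 \<Longrightarrow> pm_sum f (Poly_Mapping.single k b) = f k b"
  by (simp add: pm_sum_def)

text \<open>Both supports are enlarged to their union, where the sum is termwise additive. The sums
  in \<open>act\<close>, \<open>smash_mult\<close>, \<open>ordered\<close> and \<open>pbw\<close>
  all have the form \<open>pm_sum\<close>, so this gives additivity for each of them.\<close>

lemma pm_sum_add: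
  fixes f :: "'k \<Rightarrow> 'b::comm_monoid_add \<Rightarrow> 'c::comm_monoid_add"
  assumes "\<And>k. f k 0 = 0" "\<And>k a b. f k (a + b) = f k a + f k b"
  shows "pm_sum f (p + q) = pm_sum f p + pm_sum f q"
proof -
  let ?A = "Poly_Mapping.keys p \<union> Poly_Mapping.keys q"
  have "pm_sum f (p + q) = (\<Sum>k\<in>?A. f k (Poly_Mapping.lookup (p + q) k))"
    by (rule pm_sum_superset) (simp_all add: assms keys_add)
  also have "\<dots> = (\<Sum>k\<in>?A. f k (Poly_Mapping.lookup p k)) + (\<Sum>k\<in>?A. f k (Poly_Mapping.lookup q k))"
    by (simp add: lookup_add assms sum.distrib)
  also have "\<dots> = pm_sum f p + pm_sum f q"
    by (subst (1 2) pm_sum_superset[where A = ?A]) (use assms in auto)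
  finally show ?thesis .
qed

lemma pm_eq_sum: "p = (\<Sum>k\<in>Poly_Mapping.keys p. Poly_Mapping.single k (Poly_Mapping.lookup p k))"
  for p :: "'k \<Rightarrow>\<^sub>0 'b::comm_monoid_add"
  by (rule poly_mapping_eqI)
     (auto simp: lookup_sum lookup_single when_def in_keys_iff intro!: sum.neutral)

lemma pm_induct [consumes 1, case_names zero single add]:
  fixes p :: "'k \<Rightarrow>\<^sub>0 'b::comm_monoid_add"
  assumes "Poly_Mapping.keys p \<subseteq> A" and "P 0"
    and "\<And>k b. k \<in> A \<Longrightarrow> P (Poly_Mapping.single k b)"
    and "\<And>p q. P p \<Longrightarrow> P q \<Longrightarrow> P (p + q)"
  shows "P p"
proof -
  have "P (\<Sum>k\<in>B. Poly_Mapping.single k (Poly_Mapping.lookup p k))" if "finite B" "B \<subseteq> A" for B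
    using that by (induction B) (auto intro: assms)
  from this[of "Poly_Mapping.keys p"] show ?thesis
    using assms(1) pm_eq_sum[of p] by simp
qed

lemmas pm_induct_UNIV = pm_induct[OF subset_UNIV, case_names zero single add]

lemma pm_additive_eqI:
  fixes p :: "'k \<Rightarrow>\<^sub>0 'b::comm_monoid_add" and f g :: "('k \<Rightarrow>\<^sub>0 'b) \<Rightarrow> 'c::comm_monoid_add"
  assumes "\<And>p q. f (p + q) = f p + f q" "\<And>p q. g (p + q) = g p + g q"
    and "f 0 = 0" "g 0 = 0"
    and "\<And>k b. k \<in> Poly_Mapping.keys p \<Longrightarrow> f (Poly_Mapping.single k b) = g (Poly_Mapping.single k b)"
  shows "f p = g p"
  by (rule pm_induct[where P = "\<lambda>p. f p = g p", of p "Poly_Mapping.keys p"]) (auto simp: assms)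

section \<open>The universal property of the free algebra\<close>

definition tev :: "(complex poly \<Rightarrow> 'a::ring_1) \<Rightarrow> (gen \<Rightarrow> 'a) \<Rightarrow> tensor \<Rightarrow> 'a" where
  "tev \<phi> g = pm_sum (\<lambda>u c. \<phi> c * prod_list (map g (letters u)))"

lemma act_eq_tev: "act w = tev coeff_emb (act_gen w)"
  by (simp add: fun_eq_iff act_def tev_def pm_sum_def)

lemma coeff_emb_simps [simp]:
  "coeff_emb 0 = 0" "coeff_emb 1 = 1"
  by (simp_all add: coeff_emb_def)

lemma coeff_emb_add: "coeff_emb (p + q) = coeff_emb p + coeff_emb q"
  by (simp add: coeff_emb_def single_add)

lemma coeff_emb_mult: "coeff_emb (p * q) = coeff_emb p * coeff_emb q"
  by (simp add: coeff_emb_def mult_single)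

lemma coeff_emb_times_single: "coeff_emb p * Poly_Mapping.single u c = Poly_Mapping.single u (p * c)"
  by (simp add: coeff_emb_def mult_single)

lemma coeff_emb_commute: "t * coeff_emb p = coeff_emb p * t"
proof (induction t rule: pm_induct_UNIV)
  case (single u c)
  then show ?case
    by (simp add: coeff_emb_def mult_single mult.commute)
qed (auto simp: distrib_left distrib_right)

lemma prod_list_letter:
  "prod_list (map letter us) = (Poly_Mapping.single (Word us) 1 :: tensor)"
  by (induction us)
     (auto simp: letter_def mult_single plus_word_def zero_word_def simp flip: single_one)

lemma tensor_induct [case_names zero monomial add]:
  assumes "P 0"
    and "\<And>c us. P (coeff_emb c * prod_list (map letter us))"
    and "\<And>s t. P s \<Longrightarrow> P t \<Longrightarrow> P (s + t)"
  shows "P t"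
proof (induction t rule: pm_induct_UNIV)
  case (single u c)
  have "Poly_Mapping.single u c = coeff_emb c * prod_list (map letter (letters u))"
    by (simp add: prod_list_letter coeff_emb_times_single)
  then show ?case using assms(2) by metis
qed (auto intro: assms)

text \<open>Instantiated twice: with \<open>coeff_emb\<close>, for the action of a matrix on
  tensors, and with \<open>scal\<close>, for the representation by operators.\<close>

locale tensor_target =
  fixes \<phi> :: "complex poly \<Rightarrow> 'a::ring_1" and g :: "gen \<Rightarrow> 'a"
  assumes \<phi>_add: "\<phi> (p + q) = \<phi> p + \<phi> q"
    and \<phi>_mult: "\<phi> (p * q) = \<phi> p * \<phi> q"
    and \<phi>_one: "\<phi> 1 = 1"
    and \<phi>_central: "\<phi> p * z = z * \<phi> p"
begin

lemma \<phi>_zero: "\<phi> 0 = 0"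
  using \<phi>_add[of 0 0] by simp

lemma tev_add: "tev \<phi> g (s + t) = tev \<phi> g s + tev \<phi> g t"
  unfolding tev_def by (rule pm_sum_add) (auto simp: \<phi>_zero \<phi>_add distrib_right)

lemma tev_zero [simp]: "tev \<phi> g 0 = 0"
  by (simp add: tev_def)

lemma tev_single: "tev \<phi> g (Poly_Mapping.single u c) = \<phi> c * prod_list (map g (letters u))"
  unfolding tev_def by (rule pm_sum_single) (simp add: \<phi>_zero)

lemma tev_mult: "tev \<phi> g (s * t) = tev \<phi> g s * tev \<phi> g t"
proof (induction s rule: pm_induct_UNIV)
  case (single u c)
  show ?case
  proof (induction t rule: pm_induct_UNIV)
    case (single v b)
    have "\<phi> c * \<phi> b * (pu * pv) = \<phi> c * pu * (\<phi> b * pv)" for pu pv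
      by (metis \<phi>_central mult.assoc)
    then show ?case
      by (simp add: mult_single tev_single plus_word_def \<phi>_mult)
  qed (auto simp: distrib_left tev_add)
qed (auto simp: distrib_right tev_add)

lemma tev_coeff_emb: "tev \<phi> g (coeff_emb c) = \<phi> c"
  by (simp add: coeff_emb_def tev_single zero_word_def)

lemma tev_one: "tev \<phi> g 1 = 1"
  using tev_coeff_emb[of 1] by (simp add: \<phi>_one)

lemma tev_letter: "tev \<phi> g (letter h) = g h"
  by (simp add: letter_def tev_single \<phi>_one)

lemma tev_diff: "tev \<phi> g (s - t) = tev \<phi> g s - tev \<phi> g t"
  by (metis add_diff_cancel_right' diff_add_cancel tev_add)

lemma tev_power: "tev \<phi> g (s ^ n) = tev \<phi> g s ^ n"
  by (induction n) (auto simp: tev_one tev_mult)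

lemma tev_unique:
  assumes "\<And>s t. h (s + t) = h s + h t" "\<And>s t. h (s * t) = h s * h t"
    and "\<And>c. h (coeff_emb c) = \<phi> c" "\<And>x. h (letter x) = g x"
  shows "h t = tev \<phi> g t"
proof -
  have h0: "h 0 = 0" using assms(3)[of 0] by (simp add: \<phi>_zero)
  have h1: "h 1 = 1" using assms(3)[of 1] by (simp add: \<phi>_one)
  have "h (prod_list (map letter us)) = prod_list (map g us)" for us
    by (induction us) (auto simp: assms h1)
  moreover have "tev \<phi> g (prod_list (map letter us)) = prod_list (map g us)" for us
    by (induction us) (auto simp: tev_mult tev_letter tev_one)
  ultimately show ?thesis
    by (induction t rule: tensor_induct) (auto simp: assms h0 tev_add tev_mult tev_coeff_emb)
qed

end

interpretation act: tensor_target coeff_emb "act_gen w" for w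
  by standard (rule coeff_emb_add coeff_emb_mult coeff_emb_simps coeff_emb_commute[symmetric])+

lemmas act_add = act.tev_add[folded act_eq_tev]
lemmas act_zero [simp] = act.tev_zero[folded act_eq_tev]
lemmas act_mult = act.tev_mult[folded act_eq_tev]
lemmas act_one [simp] = act.tev_one[folded act_eq_tev]
lemmas act_coeff_emb [simp] = act.tev_coeff_emb[folded act_eq_tev]
lemmas act_letter = act.tev_letter[folded act_eq_tev]
lemmas act_unique = act.tev_unique[folded act_eq_tev]

lemma UNIV_bin: "(UNIV :: 2 set) = {1, 2}"
  using UNIV_2 by simp

lemma matrix_inv_unique:
  fixes A B :: "'a::semiring_1 ^ 'n ^ 'n"
  assumes "A ** B = mat 1" "B ** A = mat 1"
  shows "matrix_inv A = B"
proof -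
  have "A ** matrix_inv A = mat 1 \<and> matrix_inv A ** A = mat 1"
    unfolding matrix_inv_def by (rule someI[of _ B]) (use assms in simp)
  then show ?thesis
    by (metis assms(2) matrix_mul_assoc matrix_mul_lid matrix_mul_rid)
qed

lemma act_mat_1 [simp]: "act (mat 1) t = t"
proof -
  have inv: "matrix_inv (mat 1 :: mat2) = mat 1"
    by (rule matrix_inv_unique) simp_all
  have "act_gen (mat 1) x = letter x" for x
  proof (cases x)
    case (Vec k)
    show ?thesis using exhaust_2[of k] by (auto simp: Vec mat_def UNIV_bin simp flip: one_pCons)
  next
    case (Covec k)
    have "mat 1 $ k $ j = (if k = j then 1 else 0 :: complex)" for j :: 2
      by (simp add: mat_def)
    then show ?thesis using exhaust_2[of k] by (auto simp: Covec inv UNIV_bin simp flip: one_pCons)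
  qed
  then have "t = act (mat 1) t"
    by (intro act_unique[of "\<lambda>t. t"]) auto
  then show ?thesis by simp
qed

section \<open>Endomorphisms of free modules over polynomials\<close>

definition scl :: "complex poly \<Rightarrow> ('b \<Rightarrow>\<^sub>0 complex poly) \<Rightarrow> ('b \<Rightarrow>\<^sub>0 complex poly)" where
  "scl c = Poly_Mapping.map ((*) c)"

lemma lookup_scl [simp]: "Poly_Mapping.lookup (scl c m) k = c * Poly_Mapping.lookup m k"
  by (simp add: scl_def Poly_Mapping.map.rep_eq when_def)

lemma scl_add: "scl c (m + n) = scl c m + scl c n"
  by (rule poly_mapping_eqI) (simp add: lookup_add distrib_left)

lemma scl_add_left: "scl (c + d) m = scl c m + scl d m"
  by (rule poly_mapping_eqI) (simp add: lookup_add distrib_right)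

lemma scl_diff: "scl c (m - n) = scl c m - scl c n"
  by (rule poly_mapping_eqI) (simp add: lookup_minus right_diff_distrib)

lemma scl_minus: "scl c (- m) = - scl c m"
  by (rule poly_mapping_eqI) simp

lemma scl_scl: "scl c (scl d m) = scl (c * d) m"
  by (rule poly_mapping_eqI) (simp add: mult.assoc)

lemma scl_1 [simp]: "scl 1 m = m" and scl_0 [simp]: "scl 0 m = 0" and scl_zero [simp]: "scl c 0 = 0"
  by (rule poly_mapping_eqI; simp)+

lemma scl_single: "scl c (Poly_Mapping.single b p) = Poly_Mapping.single b (c * p)"
  by (rule poly_mapping_eqI) (simp add: lookup_single when_def)

lemma keys_scl: "Poly_Mapping.keys (scl c m) \<subseteq> Poly_Mapping.keys m"
  by (auto simp: in_keys_iff)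

text \<open>A type of its own, so that the linear maps over polynomials in \<hbar> are an instance
  of \<open>ring_1\<close> and identities between operators can be expanded with
  \<open>algebra_simps\<close>.\<close>

typedef 'b endo = "{f :: ('b \<Rightarrow>\<^sub>0 complex poly) \<Rightarrow> ('b \<Rightarrow>\<^sub>0 complex poly).
    (\<forall>m n. f (m + n) = f m + f n) \<and> (\<forall>c m. f (scl c m) = scl c (f m))}"
  morphisms ap Endo
  by (rule exI[of _ "\<lambda>m. m"]) simp

setup_lifting type_definition_endo

lemma ap_add: "ap f (m + n) = ap f m + ap f n" and ap_scl: "ap f (scl c m) = scl c (ap f m)"
  using ap[of f] by auto

lemma ap_zero [simp]: "ap f 0 = 0"
  using ap_add[of f 0 0] by simp

lemma ap_minus: "ap f (- m) = - ap f m"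
  by (metis add.right_inverse add_eq_0_iff ap_add ap_zero)

lemma ap_diff: "ap f (m - n) = ap f m - ap f n"
  by (metis ap_add ap_minus uminus_add_conv_diff add.commute)

instantiation endo :: (type) ring_1
begin

lift_definition zero_endo :: "'a endo" is "\<lambda>m. 0" by simp
lift_definition one_endo :: "'a endo" is "\<lambda>m. m" by simp
lift_definition plus_endo :: "'a endo \<Rightarrow> 'a endo \<Rightarrow> 'a endo" is "\<lambda>f g m. f m + g m"
  by (auto simp: scl_add algebra_simps)
lift_definition minus_endo :: "'a endo \<Rightarrow> 'a endo \<Rightarrow> 'a endo" is "\<lambda>f g m. f m - g m"
  by (auto simp: scl_diff algebra_simps)
lift_definition uminus_endo :: "'a endo \<Rightarrow> 'a endo" is "\<lambda>f m. - f m"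
  by (auto simp: scl_minus)
lift_definition times_endo :: "'a endo \<Rightarrow> 'a endo \<Rightarrow> 'a endo" is "\<lambda>f g m. f (g m)"
  by auto

instance
proof
  show "(0::'a endo) \<noteq> 1"
  proof (transfer, rule notI)
    assume "(\<lambda>m :: 'a \<Rightarrow>\<^sub>0 complex poly. 0) = (\<lambda>m. m)"
    from fun_cong[OF this, of "Poly_Mapping.single undefined 1"] show False
      by (metis lookup_single_eq lookup_zero zero_neq_one)
  qed
qed (transfer; force simp: algebra_simps)+

end

lemma ap_simps [simp]:
  "ap 0 m = 0" "ap 1 m = m" "ap (f + g) m = ap f m + ap g m" "ap (f - g) m = ap f m - ap g m"
  "ap (- f) m = - ap f m" "ap (f * g) m = ap f (ap g m)"
  by (transfer; simp)+

lemma ap_sum_left: "ap (\<Sum>i\<in>A. f i) m = (\<Sum>i\<in>A. ap (f i) m)"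
  by (induction A rule: infinite_finite_induct) auto

lift_definition scal :: "complex poly \<Rightarrow> 'b endo" is scl
  by (auto simp: scl_add scl_scl mult.commute)

lemma ap_scal [simp]: "ap (scal c) m = scl c m"
  by transfer simp

lemma endo_eqI: "(\<And>m. ap f m = ap g m) \<Longrightarrow> f = g"
  by transfer auto

lemma scal_commute: "scal c * f = f * scal c"
  by (rule endo_eqI) (simp add: ap_scl)

lemma scal_left_commute: "f * (scal c * g) = scal c * (f * g)"
  by (metis mult.assoc scal_commute)

lemma scal_add: "scal (p + q) = scal p + scal q" and scal_mult: "scal (p * q) = scal p * scal q"
  and scal_1 [simp]: "scal 1 = 1" and scal_0 [simp]: "scal 0 = 0"
  by (rule endo_eqI; simp add: scl_add_left scl_scl; fail)+

abbreviation bas :: "'b \<Rightarrow> ('b \<Rightarrow>\<^sub>0 complex poly)" where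
  "bas b \<equiv> Poly_Mapping.single b 1"

lemma single_eq_scl_bas: "Poly_Mapping.single b c = scl c (bas b)"
  by (simp add: scl_single)

lemma ap_eqI_bas:
  assumes "\<And>b. b \<in> Poly_Mapping.keys m \<Longrightarrow> ap f (bas b) = ap g (bas b)"
  shows "ap f m = ap g m"
proof (rule pm_additive_eqI[where p = m])
  show "ap f (Poly_Mapping.single k c) = ap g (Poly_Mapping.single k c)" if "k \<in> Poly_Mapping.keys m" for k c
    using assms[OF that] by (simp add: single_eq_scl_bas[of k c] ap_scl)
qed (auto simp: ap_add)

lemma endo_eqI_bas:
  assumes "\<And>b. ap f (bas b) = ap g (bas b)"
  shows "f = g"
  by (rule endo_eqI, rule ap_eqI_bas, rule assms)

lift_definition lin :: "('b \<Rightarrow> ('b \<Rightarrow>\<^sub>0 complex poly)) \<Rightarrow> 'b endo"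
  is "\<lambda>f. pm_sum (\<lambda>b c. scl c (f b))"
proof (intro CollectI conjI allI)
  fix f :: "'b \<Rightarrow> ('b \<Rightarrow>\<^sub>0 complex poly)" and m n c
  show add: "pm_sum (\<lambda>b c. scl c (f b)) (m + n) = pm_sum (\<lambda>b c. scl c (f b)) m + pm_sum (\<lambda>b c. scl c (f b)) n" for m n
    by (rule pm_sum_add) (auto simp: scl_add_left)
  show "pm_sum (\<lambda>b c. scl c (f b)) (scl c m) = scl c (pm_sum (\<lambda>b c. scl c (f b)) m)"
  proof (rule pm_additive_eqI[where f = "\<lambda>m. pm_sum _ (scl c m)"])
    show "pm_sum (\<lambda>b c. scl c (f b)) (scl c (Poly_Mapping.single k b)) =
        scl c (pm_sum (\<lambda>b c. scl c (f b)) (Poly_Mapping.single k b))" for k b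
      by (simp add: scl_single pm_sum_single scl_scl)
  qed (auto simp: scl_add add)
qed

lemma ap_lin_bas [simp]: "ap (lin f) (bas b) = f b"
  by transfer (simp add: pm_sum_single)

section \<open>The dihedral group and the smash product ring\<close>

text \<open>\<open>Rot u\<close> is \<open>diag(u, u\<^sup>-\<^sup>1)\<close> and \<open>Ref u\<close> is the reflection with entries \<open>u\<close>, \<open>u\<^sup>-\<^sup>1\<close>
  off the diagonal; \<open>reflection \<zeta> i\<close> is \<open>Ref (\<zeta> ^ i)\<close>.\<close>

datatype dih = Rot complex | Ref complex

instantiation dih :: monoid_mult
begin

definition one_dih :: dih where "one_dih = Rot 1"

fun times_dih :: "dih \<Rightarrow> dih \<Rightarrow> dih" where
  "Rot u * Rot v = Rot (u * v)"
| "Rot u * Ref v = Ref (u * v)"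
| "Ref u * Rot v = Ref (u / v)"
| "Ref u * Ref v = Rot (u / v)"

instance
proof
  fix g h k :: dih
  show "g * h * k = g * (h * k)" by (cases g; cases h; cases k) (auto simp: divide_simps)
  show "1 * g = g" "g * 1 = g" by (cases g; simp add: one_dih_def)+
qed

end

fun par :: "dih \<Rightarrow> complex" where
  "par (Rot u) = u"
| "par (Ref u) = u"

fun matof :: "dih \<Rightarrow> mat2" where
  "matof (Rot u) = vector [vector [u, 0], vector [0, inverse u]]"
| "matof (Ref u) = vector [vector [0, u], vector [inverse u, 0]]"

lemma matof_nth [simp]:
  "matof (Rot u) $ 1 $ 1 = u" "matof (Rot u) $ 1 $ 2 = 0" "matof (Rot u) $ 2 $ 1 = 0"
  "matof (Rot u) $ 2 $ 2 = inverse u"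
  "matof (Ref u) $ 1 $ 1 = 0" "matof (Ref u) $ 1 $ 2 = u" "matof (Ref u) $ 2 $ 1 = inverse u"
  "matof (Ref u) $ 2 $ 2 = 0"
  by simp_all

declare matof.simps [simp del]

lemma reflection_eq: "reflection \<zeta> i = matof (Ref (\<zeta> ^ i))"
  by (simp add: reflection_def matof.simps)

lemma matof_mult: "matof (g * h) = matof g ** matof h"
  by (cases g; cases h)
     (auto simp: vec_eq_iff forall_2 matrix_matrix_mult_def UNIV_bin divide_simps)

lemma matof_one: "matof 1 = mat 1"
  by (simp add: one_dih_def vec_eq_iff forall_2 mat_def)

lemma matof_inject: "par g \<noteq> 0 \<Longrightarrow> par h \<noteq> 0 \<Longrightarrow> matof g = matof h \<longleftrightarrow> g = h"
  by (cases g; cases h) (auto simp: vec_eq_iff forall_2)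

fun dinv :: "dih \<Rightarrow> dih" where
  "dinv (Rot u) = Rot (inverse u)"
| "dinv (Ref u) = Ref u"

lemma dinv_mult: "par g \<noteq> 0 \<Longrightarrow> g * dinv g = 1" "par g \<noteq> 0 \<Longrightarrow> dinv g * g = 1"
  by (cases g; simp add: one_dih_def)+

lemma matrix_inv_matof: "par g \<noteq> 0 \<Longrightarrow> matrix_inv (matof g) = matof (dinv g)"
  by (rule matrix_inv_unique) (simp_all add: matof_one dinv_mult flip: matof_mult)

text \<open>Dihedral matrices act on the four letters by monomial matrices: \<open>dgen\<close> is
  the permutation and \<open>dsc\<close> the scalar factor.\<close>

fun dgen :: "dih \<Rightarrow> gen \<Rightarrow> gen" where
  "dgen (Rot u) v = v"
| "dgen (Ref u) (Vec k) = Vec (if k = 1 then 2 else 1)"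
| "dgen (Ref u) (Covec k) = Covec (if k = 1 then 2 else 1)"

fun dsc :: "dih \<Rightarrow> gen \<Rightarrow> complex" where
  "dsc (Rot u) (Vec k) = (if k = 1 then u else inverse u)"
| "dsc (Ref u) (Vec k) = (if k = 1 then inverse u else u)"
| "dsc (Rot u) (Covec k) = (if k = 1 then inverse u else u)"
| "dsc (Ref u) (Covec k) = (if k = 1 then u else inverse u)"

lemma act_gen_matof:
  assumes "par g \<noteq> 0"
  shows "act_gen (matof g) v = coeff_emb [:dsc g v:] * letter (dgen g v)"
proof (cases v)
  case (Vec k)
  then show ?thesis using exhaust_2[of k] by (cases g) (auto simp: UNIV_bin)
next
  case (Covec k)
  then show ?thesis using exhaust_2[of k] assms by (cases g) (auto simp: UNIV_bin matrix_inv_matof)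
qed

declare act_gen.simps [simp del]

lemma coeff_emb_assoc: "coeff_emb p * (coeff_emb q * t) = coeff_emb (p * q) * t"
  by (simp add: coeff_emb_mult mult.assoc)

text \<open>Both sides are algebra maps fixing scalars, so it is enough to compare them on
  letters.\<close>

lemma act_matof_mult:
  assumes "par g \<noteq> 0" "par h \<noteq> 0"
  shows "act (matof g ** matof h) t = act (matof g) (act (matof h) t)"
proof (rule sym, rule act_unique)
  have gh: "par (g * h) \<noteq> 0" using assms by (cases g; cases h) auto
  show "act (matof g) (act (matof h) (letter v)) = act_gen (matof g ** matof h) v" for v
  proof (cases v)
    case (Vec k)
    then show ?thesis using exhaust_2[of k] assms gh
      by (cases g; cases h)
         (auto simp: act_letter act_gen_matof act_mult coeff_emb_assoc divide_inverse mult.commute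
           simp flip: matof_mult)
  next
    case (Covec k)
    then show ?thesis using exhaust_2[of k] assms gh
      by (cases g; cases h)
         (auto simp: act_letter act_gen_matof act_mult coeff_emb_assoc divide_inverse mult.commute
           simp flip: matof_mult)
  qed
qed (auto simp: act_add act_mult)

section \<open>The finite dihedral group and sums over roots of unity\<close>

definition dihW :: "nat \<Rightarrow> dih set" where
  "dihW d = {g. par g ^ d = 1}"

lemma dihW_mult: "g \<in> dihW d \<Longrightarrow> h \<in> dihW d \<Longrightarrow> g * h \<in> dihW d"
  by (cases g; cases h) (auto simp: dihW_def power_mult_distrib power_divide)

lemma dihW_one [simp]: "1 \<in> dihW d"
  by (simp add: dihW_def one_dih_def)

text \<open>Primitivity makes the first d powers of \<zeta> distinct, and there are exactly d roots
  of unity of order dividing d.\<close>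

lemma roots_of_unity_eq:
  assumes "d \<ge> 1" "primitive_root_of_unity d \<zeta>"
  shows "{u. u ^ d = 1} = (\<lambda>i. \<zeta> ^ i) ` {..<d}" "inj_on (\<lambda>i. \<zeta> ^ i) {..<d}"
proof -
  have \<zeta>d: "\<zeta> ^ d = 1" and prim: "\<And>k. 0 < k \<Longrightarrow> k < d \<Longrightarrow> \<zeta> ^ k \<noteq> 1"
    using assms by (auto simp: primitive_root_of_unity_def)
  have \<zeta>0: "\<zeta> \<noteq> 0" using \<zeta>d assms(1) by (metis not_one_le_zero power_0_left zero_neq_one)
  have *: False if "\<zeta> ^ i = \<zeta> ^ j" "i < j" "j < d" for i j
  proof -
    have "\<zeta> ^ i * \<zeta> ^ (j - i) = \<zeta> ^ j" using that(2) by (simp flip: power_add)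
    then have "\<zeta> ^ i * \<zeta> ^ (j - i) = \<zeta> ^ i * 1" by (simp add: that(1))
    then have "\<zeta> ^ (j - i) = 1" using \<zeta>0 by simp
    then show False using prim[of "j - i"] that by auto
  qed
  show inj: "inj_on (\<lambda>i. \<zeta> ^ i) {..<d}"
    by (rule inj_onI) (metis * lessThan_iff linorder_neqE_nat)
  show "{u. u ^ d = 1} = (\<lambda>i. \<zeta> ^ i) ` {..<d}"
  proof (rule card_subset_eq[symmetric])
    show "finite {u::complex. u ^ d = 1}" using assms(1) by (simp add: finite_roots_unity)
    show "(\<lambda>i. \<zeta> ^ i) ` {..<d} \<subseteq> {u. u ^ d = 1}"
      by (auto simp: \<zeta>d simp flip: power_mult) (metis \<zeta>d mult.commute power_mult power_one)
    show "card ((\<lambda>i. \<zeta> ^ i) ` {..<d}) = card {u::complex. u ^ d = 1}"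
      using assms(1) inj by (simp add: card_image card_roots_unity_eq)
  qed
qed

locale cherednik =
  fixes d :: nat and \<zeta> a :: complex
  assumes d_pos: "d \<ge> 1" and prim: "primitive_root_of_unity d \<zeta>"
begin

text \<open>Reflections are indexed by this group instead of the exponents i < d: a cyclic shift of
  the index becomes a multiplication, and sums are reindexed by \<open>sum_U_mult\<close> and
  \<open>sum_U_inverse\<close>.\<close>

definition "U = {u :: complex. u ^ d = 1}"

lemma U_eq: "U = (\<lambda>i. \<zeta> ^ i) ` {..<d}" and inj_zeta: "inj_on (\<lambda>i. \<zeta> ^ i) {..<d}"
  using roots_of_unity_eq[OF d_pos prim] by (auto simp: U_def)

lemma U_nonzero: "u \<in> U \<Longrightarrow> u \<noteq> 0"
  using d_pos by (auto simp: U_def zero_power)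

lemma U_mult: "u \<in> U \<Longrightarrow> v \<in> U \<Longrightarrow> u * v \<in> U" and U_inverse: "u \<in> U \<Longrightarrow> inverse u \<in> U"
  and U_one: "1 \<in> U"
  by (auto simp: U_def power_mult_distrib power_inverse)

lemma zeta_U: "\<zeta> \<in> U"
  using prim by (simp add: U_def primitive_root_of_unity_def)

lemma zeta_pow_d: "\<zeta> ^ d = 1"
  using zeta_U by (simp add: U_def)

lemma zeta_pow_U: "\<zeta> ^ k \<in> U"
  by (simp add: U_def zeta_pow_d mult.commute[of k] power_mult flip: power_mult)
     (simp add: power_mult zeta_pow_d)

lemma sum_zeta: "(\<Sum>i<d. f (\<zeta> ^ i)) = (\<Sum>u\<in>U. f u)"
  unfolding U_eq using inj_zeta by (simp add: sum.reindex)

lemma sum_U_mult: "v \<in> U \<Longrightarrow> (\<Sum>u\<in>U. f (v * u)) = (\<Sum>u\<in>U. f u)"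
  by (rule sum.reindex_bij_witness[of _ "\<lambda>u. inverse v * u" "\<lambda>u. v * u"])
     (auto intro: U_mult U_inverse simp: U_nonzero)

lemma sum_U_inverse: "(\<Sum>u\<in>U. f (inverse u)) = (\<Sum>u\<in>U. f u)"
  by (rule sum.reindex_bij_witness[of _ inverse inverse]) (auto intro: U_inverse)

lemma dihW_par: "g \<in> dihW d \<Longrightarrow> par g \<noteq> 0"
  using U_nonzero by (auto simp: dihW_def U_def)

lemma dihW_iff: "g \<in> dihW d \<longleftrightarrow> par g \<in> U"
  by (simp add: dihW_def U_def)

lemma inj_matof: "inj_on matof (dihW d)"
  by (auto simp: inj_on_def matof_inject dihW_par)

text \<open>One inclusion is closure of \<open>dihW\<close> under products and the fact that the
  generators are involutions. For the other, Ref \<zeta> times Ref 1 is Rot \<zeta>; its powers and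
  their products with Ref 1 exhaust \<open>dihW\<close>.\<close>

lemma dihedral_eq: "dihedral \<zeta> = matof ` dihW d"
proof -
  let ?M = "\<lparr>carrier = UNIV, mult = (**), one = mat 1\<rparr> :: mat2 monoid"
  have mon: "monoid ?M" by (rule monoidI) (auto simp: matrix_mul_assoc)
  have grp: "group GL2" unfolding GL2_def by (rule monoid.units_group[OF mon])
  have carr: "matof g \<in> carrier GL2" if "par g \<noteq> 0" for g
    unfolding GL2_def units_of_carrier Units_def
    using dinv_mult[OF that] by (auto intro!: exI[of _ "matof (dinv g)"] simp: matof_one simp flip: matof_mult)
  have mult: "x \<otimes>\<^bsub>GL2\<^esub> y = x ** y" and GL2_one: "\<one>\<^bsub>GL2\<^esub> = mat 1" for x y
    by (auto simp: GL2_def units_of_def)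
  have inv_ref: "inv\<^bsub>GL2\<^esub> (matof (Ref u)) = matof (Ref u)" if "u \<noteq> 0" for u
    by (rule group.inv_equality[OF grp])
       (use that in \<open>auto intro!: carr simp: mult GL2_one simp flip: matof_mult matof_one one_dih_def\<close>)
  have gens: "{reflection \<zeta> 0, reflection \<zeta> 1} = {matof (Ref 1), matof (Ref \<zeta>)}"
    by (simp add: reflection_eq)
  have \<zeta>0: "\<zeta> \<noteq> 0" using U_nonzero zeta_U by blast
  have "x \<in> matof ` dihW d" if "x \<in> dihedral \<zeta>" for x
    using that unfolding dihedral_def gens
  proof (induction rule: generate.induct)
    case one
    show ?case unfolding GL2_one using matof_one dihW_one by (metis imageI)
  next
    case (incl h)
    then show ?case using zeta_U U_one by (auto simp: dihW_iff intro!: imageI)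
  next
    case (inv h)
    then have "inv\<^bsub>GL2\<^esub> h = h" using inv_ref \<zeta>0 by auto
    then show ?case using inv zeta_U U_one by (auto simp: dihW_iff intro!: imageI)
  next
    case (eng h1 h2)
    then show ?case by (auto simp: mult dihW_mult simp flip: matof_mult)
  qed
  moreover have "matof g \<in> dihedral \<zeta>" if g: "g \<in> dihW d" for g
  proof -
    let ?D = "dihedral \<zeta>"
    have R: "matof (Ref 1) \<in> ?D" "matof (Ref \<zeta>) \<in> ?D"
      unfolding dihedral_def gens by (auto intro: generate.incl)
    have m: "matof (g * h) \<in> ?D" if "matof g \<in> ?D" "matof h \<in> ?D" for g h
      using that unfolding matof_mult dihedral_def by (metis generate.eng mult)
    have "matof (Rot (\<zeta> ^ k)) \<in> ?D" for k
    proof (induction k)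
      case 0
      then show ?case unfolding dihedral_def
        using generate.one[of GL2] by (simp add: GL2_one flip: matof_one one_dih_def)
    next
      case (Suc k)
      have "matof (Rot \<zeta>) \<in> ?D" using m[OF R(2) R(1)] by simp
      from m[OF this Suc] show ?case by simp
    qed
    note rot = this
    have ref: "matof (Ref (\<zeta> ^ k)) \<in> ?D" for k
      using m[OF rot[of k] R(1)] by simp
    obtain k where "par g = \<zeta> ^ k" using g by (auto simp: dihW_iff U_eq)
    then show ?thesis using rot[of k] ref[of k] by (cases g) auto
  qed
  ultimately show ?thesis by auto
qed

abbreviation "W \<equiv> dihedral \<zeta>"

lemma W_mult: "w \<in> W \<Longrightarrow> w' \<in> W \<Longrightarrow> w ** w' \<in> W"
  by (auto simp: dihedral_eq dihW_mult simp flip: matof_mult)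

lemma W_one: "mat 1 \<in> W"
  by (auto simp: dihedral_eq simp flip: matof_one)

lemma act_W_mult: "w \<in> W \<Longrightarrow> w' \<in> W \<Longrightarrow> act (w ** w') t = act w (act w' t)"
  by (auto simp: dihedral_eq act_matof_mult dihW_par)

abbreviation "C \<equiv> carrier (smash_ring \<zeta>)"

lemma C_def: "C = {F. Poly_Mapping.keys F \<subseteq> W}"
  by (simp add: smash_ring_def)

end

section \<open>The smash product as a ring\<close>

abbreviation smul :: "smash \<Rightarrow> smash \<Rightarrow> smash" (infixl "\<star>" 70) where
  "F \<star> G \<equiv> smash_mult F G"

lemma smash_mult_eq:
  "F \<star> G = pm_sum (\<lambda>w s. pm_sum (\<lambda>w' t. Poly_Mapping.single (w ** w') (s * act w t)) G) F"
  by (simp add: smash_mult_def pm_sum_def)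

lemma smash_mult_single:
  "Poly_Mapping.single w s \<star> Poly_Mapping.single w' t = Poly_Mapping.single (w ** w') (s * act w t)"
  by (simp add: smash_mult_eq pm_sum_single)

lemma smash_distrib_right: "(F + F') \<star> G = F \<star> G + F' \<star> G"
  unfolding smash_mult_eq
proof (rule pm_sum_add)
  fix w :: mat2 and s s' :: tensor
  show "pm_sum (\<lambda>w' t. Poly_Mapping.single (w ** w') ((s + s') * act w t)) G =
      pm_sum (\<lambda>w' t. Poly_Mapping.single (w ** w') (s * act w t)) G +
      pm_sum (\<lambda>w' t. Poly_Mapping.single (w ** w') (s' * act w t)) G"
    by (simp add: pm_sum_def distrib_right single_add sum.distrib)
qed (simp add: pm_sum_def)

lemma smash_distrib_left: "F \<star> (G + G') = F \<star> G + F \<star> G'"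
proof -
  have "pm_sum (\<lambda>w' t. Poly_Mapping.single (w ** w') (s * act w t)) (G + G') =
      pm_sum (\<lambda>w' t. Poly_Mapping.single (w ** w') (s * act w t)) G +
      pm_sum (\<lambda>w' t. Poly_Mapping.single (w ** w') (s * act w t)) G'" for w s
    by (rule pm_sum_add) (auto simp: act_add distrib_left single_add)
  then show ?thesis
    unfolding smash_mult_eq by (simp add: pm_sum_def sum.distrib)
qed

lemma smash_zero [simp]: "0 \<star> G = 0" "F \<star> 0 = 0"
  by (simp_all add: smash_mult_eq pm_sum_def)

context cherednik
begin

lemma single_C: "w \<in> W \<Longrightarrow> Poly_Mapping.single w t \<in> C"
  by (auto simp: C_def)

lemma zero_C: "0 \<in> C"
  by (simp add: C_def)

lemma add_C: "F \<in> C \<Longrightarrow> G \<in> C \<Longrightarrow> F + G \<in> C"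
  using keys_add[of F G] by (auto simp: C_def)

lemma uminus_C: "F \<in> C \<Longrightarrow> - F \<in> C"
  by (auto simp: C_def in_keys_iff)

lemma C_induct [consumes 1, case_names zero single add]:
  assumes "F \<in> C" "P 0" "\<And>w t. w \<in> W \<Longrightarrow> P (Poly_Mapping.single w t)"
    "\<And>F G. F \<in> C \<Longrightarrow> G \<in> C \<Longrightarrow> P F \<Longrightarrow> P G \<Longrightarrow> P (F + G)"
  shows "P F"
proof -
  have "P F \<and> F \<in> C"
    by (rule pm_induct[where A = W]) (use assms zero_C single_C add_C in \<open>auto simp: C_def\<close>)
  then show ?thesis ..
qed

lemma mult_C:
  assumes "F \<in> C" "G \<in> C"
  shows "F \<star> G \<in> C"
  using assms(1)
proof (induction F rule: C_induct)
  case (single w t)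
  show ?case using assms(2)
    by (induction G rule: C_induct)
       (auto simp: smash_mult_single smash_distrib_left zero_C single.hyps intro!: single_C W_mult add_C)
qed (auto simp: smash_distrib_right zero_C intro: add_C)

text \<open>Supports in \<open>W\<close> enter through \<open>act_W_mult\<close>: the action on
  covectors involves inverse matrices, which compose correctly for invertible matrices.\<close>

lemma smash_assoc:
  assumes "F \<in> C" "G \<in> C" "H \<in> C"
  shows "F \<star> G \<star> H = F \<star> (G \<star> H)"
  using assms(1)
proof (induction F rule: C_induct)
  case (single w t)
  show ?case using assms(2)
  proof (induction G rule: C_induct)
    case (single w' t')
    show ?case using assms(3)
    proof (induction H rule: C_induct)
      case (single w'' t'')
      then show ?case
        using \<open>w \<in> W\<close> \<open>w' \<in> W\<close>
        by (simp add: smash_mult_single matrix_mul_assoc act_W_mult act_mult mult.assoc)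
    qed (simp_all add: smash_distrib_left)
  qed (simp_all add: smash_distrib_left smash_distrib_right)
qed (simp_all add: smash_distrib_right)

lemma smash_one_left: "F \<in> C \<Longrightarrow> tensor_emb 1 \<star> F = F"
  by (induction F rule: C_induct) (simp_all add: tensor_emb_def smash_mult_single smash_distrib_left)

lemma smash_one_right: "F \<in> C \<Longrightarrow> F \<star> tensor_emb 1 = F"
  by (induction F rule: C_induct) (simp_all add: tensor_emb_def smash_mult_single smash_distrib_right)

lemma smash_ring_ring: "ring (smash_ring \<zeta>)"
proof (rule ringI)
  show "abelian_group (smash_ring \<zeta>)"
  proof (rule abelian_groupI)
    fix F assume "F \<in> C"
    then show "\<exists>G\<in>C. G \<oplus>\<^bsub>smash_ring \<zeta>\<^esub> F = \<zero>\<^bsub>smash_ring \<zeta>\<^esub>"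
      by (intro bexI[of _ "- F"] uminus_C) (auto simp: smash_ring_def)
  qed (use add_C zero_C in \<open>auto simp: smash_ring_def add_ac\<close>)
  show "monoid (smash_ring \<zeta>)"
    by (rule monoidI)
       (use mult_C smash_assoc smash_one_left smash_one_right W_one in
         \<open>auto simp: smash_ring_def tensor_emb_def\<close>)
qed (auto simp: smash_ring_def smash_distrib_left smash_distrib_right)

end

section \<open>The left regular representation on the ordered monomials\<close>

text \<open>\<open>(a, b, c, e, g)\<close> stands for the ordered monomial \<open>x\<^sup>a y\<^sup>b X\<^sup>c Y\<^sup>e g\<close>.\<close>

type_synonym idx = "nat \<times> nat \<times> nat \<times> nat \<times> dih"

definition mx :: "idx endo" where "mx = lin (\<lambda>(a, b, n). bas (Suc a, b, n))"
definition my :: "idx endo" where "my = lin (\<lambda>(a, b, n). bas (a, Suc b, n))"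

definition hb :: "idx endo" where "hb = scal [:0, 1:]"

text \<open>Weight under diag(u, 1/u), which scales x and Y by u and y and X by 1/u. It can be
  negative, hence \<open>powi\<close> below.\<close>

fun wgt :: "idx \<Rightarrow> int" where
  "wgt (a, b, c, e, g) = int a + int e - int b - int c"

text \<open>The result of moving a group element from the left through an ordered monomial. A
  reflection exchanges x with y and X with Y, so the exponents are swapped and the weight changes
  sign.\<close>

fun mgb :: "dih \<Rightarrow> idx \<Rightarrow> (idx \<Rightarrow>\<^sub>0 complex poly)" where
  "mgb (Rot u) (a, b, c, e, h) = scl [:u powi wgt (a, b, c, e, h):] (bas (a, b, c, e, Rot u * h))"
| "mgb (Ref u) (a, b, c, e, h) = scl [:u powi (- wgt (a, b, c, e, h)):] (bas (b, a, e, c, Ref u * h))"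

definition mg :: "dih \<Rightarrow> idx endo" where
  "mg g = lin (mgb g)"

lemma ap_mx [simp]: "ap mx (bas (a, b, n)) = bas (Suc a, b, n)"
  and ap_my [simp]: "ap my (bas (a, b, n)) = bas (a, Suc b, n)"
  by (simp_all add: mx_def my_def)

lemma ap_mg: "ap (mg g) (bas k) = mgb g k"
  by (simp add: mg_def)

lemma mx_my: "mx * my = my * mx"
  by (rule endo_eqI_bas) (auto simp: split_paired_all)

lemma hb_commute: "hb * f = f * hb"
  unfolding hb_def by (rule scal_commute)

lemma scal_move:
  assumes "g * m = scal k * (m' * g)"
  shows "scal c * g * m = m' * (scal (c * k) * g)"
proof -
  have "scal c * g * m = scal c * (scal k * (m' * g))" by (simp add: mult.assoc assms)
  also have "\<dots> = m' * (scal (c * k) * g)"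
    by (simp only: scal_mult mult.assoc scal_left_commute[of m'])
  finally show ?thesis .
qed

lemma hb_left_commute: "f * (hb * g) = hb * (f * g)"
  unfolding hb_def by (rule scal_left_commute)

lemma assoc_ext: "f * g = h \<Longrightarrow> f * (g * k) = h * (k :: 'a::semigroup_mult)"
  by (metis mult.assoc)

lemma scal_assoc: "scal c * (scal k * f) = scal (c * k) * f"
  by (simp add: scal_mult mult.assoc)

lemma mg_one: "mg 1 = 1"
proof (rule endo_eqI_bas)
  fix k :: idx
  obtain a b c e f where k: "k = (a, b, c, e, f)" by (metis prod_cases5)
  show "ap (mg 1) (bas k) = ap 1 (bas k)"
    unfolding k one_dih_def by (cases f) (simp_all add: ap_mg flip: one_pCons)
qed

lemma mg_mult:
  assumes "par g \<noteq> 0" "par h \<noteq> 0"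
  shows "mg (g * h) = mg g * mg h"
proof (rule endo_eqI_bas)
  fix k :: idx
  obtain a b c e f where k: "k = (a, b, c, e, f)" by (metis prod_cases5)
  show "ap (mg (g * h)) (bas k) = ap (mg g * mg h) (bas k)"
    using assms unfolding k
    by (cases g; cases h; cases f)
       (simp_all add: ap_mg ap_scl scl_scl power_int_mult_distrib
          power_int_divide_distrib mult_ac power_int_minus divide_inverse power_int_diff
          power_int_add power_int_inverse)
qed

lemma mg_Rot_mx: "u \<noteq> 0 \<Longrightarrow> mg (Rot u) * mx = scal [:u:] * (mx * mg (Rot u))"
  and mg_Rot_my: "u \<noteq> 0 \<Longrightarrow> mg (Rot u) * my = scal [:inverse u:] * (my * mg (Rot u))"
  and mg_Ref_mx: "u \<noteq> 0 \<Longrightarrow> mg (Ref u) * mx = scal [:inverse u:] * (my * mg (Ref u))"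
  and mg_Ref_my: "u \<noteq> 0 \<Longrightarrow> mg (Ref u) * my = scal [:u:] * (mx * mg (Ref u))"
  by (rule endo_eqI_bas, simp add: split_paired_all ap_mg ap_scl scl_scl power_int_add power_int_diff
        power_int_minus field_simps; fail)+

text \<open>An operator is determined by its commutation with \<open>x\<close> and \<open>y\<close> and by its values on the
  monomials free of \<open>x\<close> and \<open>y\<close>; all relations between \<open>X\<close>, \<open>Y\<close> and \<open>W\<close> are checked this way.\<close>

lemma endo_eq_0I:
  assumes "T * mx = L * T" "T * my = L' * T" "\<And>n. ap T (bas (0, 0, n)) = 0"
  shows "T = 0"
proof (rule endo_eqI_bas)
  fix k :: idx
  obtain a b n where k: "k = (a, b, n)" by (metis prod_cases3)
  have "ap T (bas (a, b, n)) = 0"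
  proof (induction a)
    case 0
    show ?case
    proof (induction b)
      case (Suc b)
      have "ap T (bas (0, Suc b, n)) = ap (T * my) (bas (0, b, n))" by simp
      then show ?case unfolding assms(2) using Suc by simp
    qed (simp add: assms(3))
  next
    case (Suc a)
    have "ap T (bas (Suc a, b, n)) = ap (T * mx) (bas (a, b, n))" by simp
    then show ?case unfolding assms(1) using Suc by simp
  qed
  then show "ap T (bas k) = ap 0 (bas k)" by (simp add: k)
qed

text \<open>An operator \<open>K\<close> with prescribed commutators \<open>[x, K] = cx\<close> and \<open>[y, K] = cy\<close>.\<close>

fun kop :: "idx endo \<Rightarrow> idx endo \<Rightarrow> (nat \<times> nat \<times> dih \<Rightarrow> nat \<times> nat \<times> dih) \<Rightarrow>
    nat \<Rightarrow> nat \<Rightarrow> nat \<times> nat \<times> dih \<Rightarrow> (idx \<Rightarrow>\<^sub>0 complex poly)" where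
  "kop cx cy s 0 0 n = bas (0, 0, s n)"
| "kop cx cy s 0 (Suc b) n = ap my (kop cx cy s 0 b n) - ap cy (bas (0, b, n))"
| "kop cx cy s (Suc a) b n = ap mx (kop cx cy s a b n) - ap cx (bas (a, b, n))"

definition kend :: "idx endo \<Rightarrow> idx endo \<Rightarrow> (nat \<times> nat \<times> dih \<Rightarrow> nat \<times> nat \<times> dih) \<Rightarrow> idx endo" where
  "kend cx cy s = lin (\<lambda>(a, b, n). kop cx cy s a b n)"

lemma ap_kend: "ap (kend cx cy s) (bas (a, b, n)) = kop cx cy s a b n"
  by (simp add: kend_def)

lemma kend_mx: "kend cx cy s * mx = mx * kend cx cy s - cx"
  by (rule endo_eqI_bas) (simp add: split_paired_all ap_kend)

text \<open>\<open>kop\<close> strips letters x before letters y, so the commutator with x holds by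
  definition, while the one with y needs an induction on the exponent of x. The assumption is the
  compatibility [x, [y, K]] = [y, [x, K]] that makes this induction close.\<close>

lemma kend_my:
  assumes "mx * cy - cy * mx = my * cx - cx * my"
  shows "kend cx cy s * my = my * kend cx cy s - cy"
proof (rule endo_eqI_bas)
  fix k :: idx
  obtain a b n where k: "k = (a, b, n)" by (metis prod_cases3)
  have "ap (kend cx cy s * my) (bas (a, b, n)) = ap (my * kend cx cy s - cy) (bas (a, b, n))"
  proof (induction a)
    case 0
    then show ?case by (simp add: ap_kend)
  next
    case (Suc a)
    have "ap mx (ap cy v) - ap cy (ap mx v) = ap my (ap cx v) - ap cx (ap my v)" for v
      using arg_cong[OF assms, of "\<lambda>f. ap f v"] by simp
    from this[of "bas (a, b, n)"] have
      "ap mx (ap cy (bas (a, b, n))) - ap cy (bas (Suc a, b, n)) =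
       ap my (ap cx (bas (a, b, n))) - ap cx (bas (a, Suc b, n))" by simp
    moreover have "ap mx (ap my v) = ap my (ap mx v)" for v
      using arg_cong[OF mx_my, of "\<lambda>f. ap f v"] by simp
    moreover have "kop cx cy s a (Suc b) n = ap my (kop cx cy s a b n) - ap cy (bas (a, b, n))"
      using Suc by (simp add: ap_kend)
    note IH = this
    ultimately show ?case by (simp add: ap_kend IH ap_diff) (simp add: algebra_simps)
  qed
  then show "ap (kend cx cy s * my) (bas k) = ap (my * kend cx cy s - cy) (bas k)" by (simp add: k)
qed

section \<open>Sums of reflections, and the operators X and Y\<close>

context cherednik
begin

text \<open>With an arbitrary coefficient function, passing a letter through the sum only multiplies
  f by u or its inverse. The instances \<open>As\<close>, \<open>Ap\<close>, \<open>Am\<close> below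
  are \<hbar> - [x, X], [y, X] and [x, Y].\<close>

definition S :: "(complex \<Rightarrow> complex) \<Rightarrow> idx endo" where
  "S f = (\<Sum>u\<in>U. scal [:f u:] * mg (Ref u))"

definition "As = S (\<lambda>u. a)"
definition "Ap = S (\<lambda>u. a * u)"
definition "Am = S (\<lambda>u. a * inverse u)"

lemmas A_defs = As_def Ap_def Am_def

lemma S_mx: "S f * mx = my * S (\<lambda>u. f u * inverse u)"
  unfolding S_def sum_distrib_left sum_distrib_right
  by (rule sum.cong[OF refl], subst scal_move[OF mg_Ref_mx]) (simp_all add: U_nonzero mult.commute)

lemma S_my: "S f * my = mx * S (\<lambda>u. f u * u)"
  unfolding S_def sum_distrib_left sum_distrib_right
  by (rule sum.cong[OF refl], subst scal_move[OF mg_Ref_my]) (simp_all add: U_nonzero mult.commute)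

lemma S_cong: "(\<And>u. u \<in> U \<Longrightarrow> f u = g u) \<Longrightarrow> S f = S g"
  unfolding S_def by (rule sum.cong) auto

text \<open>These four identities are what the compatibility assumption of \<open>kend_my\<close>
  amounts to for X and for Y.\<close>

lemma A_mx_my: "As * mx = my * Am" "As * my = mx * Ap" "Ap * mx = my * As" "Am * my = mx * As"
  unfolding A_defs
proof -
  have 1: "S (\<lambda>u. a * u * inverse u) = S (\<lambda>u. a)" "S (\<lambda>u. a * inverse u * u) = S (\<lambda>u. a)"
    by (rule S_cong; simp add: U_nonzero)+
  note S_mx[of "\<lambda>u. a"] S_my[of "\<lambda>u. a"] S_mx[of "\<lambda>u. a * u"] S_my[of "\<lambda>u. a * inverse u"]
  then show "S (\<lambda>u. a) * mx = my * S (\<lambda>u. a * inverse u)" "S (\<lambda>u. a) * my = mx * S (\<lambda>u. a * u)" "S (\<lambda>u. a * u) * mx = my * S (\<lambda>u. a)" "S (\<lambda>u. a * inverse u) * my = mx * S (\<lambda>u. a)"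
    unfolding 1 by blast+
qed

definition mX :: "idx endo" where
  "mX = kend (hb - As) Ap (\<lambda>(c, e, g). (Suc c, e, g))"

definition mY :: "idx endo" where
  "mY = kend Am (hb - As) (\<lambda>(c, e, g). (c, Suc e, g))"

text \<open>Moves scalars to the left; stated for each operator because the general rule loops.\<close>

lemmas scal_left =
  scal_commute[symmetric, where f = mx] scal_left_commute[where f = mx]
  scal_commute[symmetric, where f = my] scal_left_commute[where f = my]
  scal_commute[symmetric, where f = mX] scal_left_commute[where f = mX]
  scal_commute[symmetric, where f = mY] scal_left_commute[where f = mY]
  scal_commute[symmetric, where f = hb] scal_left_commute[where f = hb]
  scal_commute[symmetric, where f = "mg g"] scal_left_commute[where f = "mg g"]
  scal_commute[symmetric, where f = "S f"] scal_left_commute[where f = "S f"]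
  scal_commute[symmetric, where f = As] scal_left_commute[where f = As]
  scal_commute[symmetric, where f = Ap] scal_left_commute[where f = Ap]
  scal_commute[symmetric, where f = Am] scal_left_commute[where f = Am]
  for g f

lemmas hb_left =
  hb_commute[symmetric, where f = mx] hb_left_commute[where f = mx]
  hb_commute[symmetric, where f = my] hb_left_commute[where f = my]
  hb_commute[symmetric, where f = mX] hb_left_commute[where f = mX]
  hb_commute[symmetric, where f = mY] hb_left_commute[where f = mY]
  hb_commute[symmetric, where f = "mg g"] hb_left_commute[where f = "mg g"]
  hb_commute[symmetric, where f = "S f"] hb_left_commute[where f = "S f"]
  hb_commute[symmetric, where f = As] hb_left_commute[where f = As]
  hb_commute[symmetric, where f = Ap] hb_left_commute[where f = Ap]
  hb_commute[symmetric, where f = Am] hb_left_commute[where f = Am]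
  for g f

lemma mX_mx: "mX * mx = mx * mX - (hb - As)" and mY_mx: "mY * mx = mx * mY - Am"
  by (simp_all only: mX_def mY_def kend_mx)

lemma mX_my: "mX * my = my * mX - Ap"
  unfolding mX_def by (rule kend_my) (simp add: algebra_simps A_mx_my hb_commute)

lemma mY_my: "mY * my = my * mY - (hb - As)"
  unfolding mY_def by (rule kend_my) (simp add: algebra_simps A_mx_my hb_commute)

lemma ap_mX_0 [simp]: "ap mX (bas (0, 0, c, e, g)) = bas (0, 0, Suc c, e, g)"
  and ap_mY_0 [simp]: "ap mY (bas (0, 0, c, e, g)) = bas (0, 0, c, Suc e, g)"
  by (simp_all add: mX_def mY_def ap_kend)

text \<open>Both products are brought to the same shape, a sum over rotations, so that they can be
  compared coefficient by coefficient.\<close>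

lemma Ref_S:
  assumes "v \<in> U"
  shows "mg (Ref v) * S f = (\<Sum>u\<in>U. scal [:f (v * inverse u):] * mg (Rot u))"
    and "S f * mg (Ref v) = (\<Sum>u\<in>U. scal [:f (v * u):] * mg (Rot u))"
proof -
  have v: "v \<noteq> 0" using assms U_nonzero by blast
  have "mg (Ref v) * S f = (\<Sum>u\<in>U. scal [:f u:] * mg (Rot (v / u)))"
    unfolding S_def sum_distrib_left
    by (rule sum.cong) (use v in \<open>simp_all add: scal_left_commute U_nonzero flip: mg_mult\<close>)
  also have "\<dots> = (\<Sum>u\<in>U. scal [:f (inverse u):] * mg (Rot (v * u)))"
    by (subst sum_U_inverse[symmetric]) (simp add: divide_inverse)
  also have "\<dots> = (\<Sum>u\<in>U. scal [:f (v * inverse u):] * mg (Rot u))"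
    by (subst sum_U_mult[OF assms, symmetric]) (use v in \<open>simp add: field_simps\<close>)
  finally show "mg (Ref v) * S f = (\<Sum>u\<in>U. scal [:f (v * inverse u):] * mg (Rot u))" .
  have "S f * mg (Ref v) = (\<Sum>u\<in>U. scal [:f u:] * mg (Rot (u / v)))"
    unfolding S_def sum_distrib_right
    by (rule sum.cong) (use v in \<open>simp_all add: mult.assoc U_nonzero flip: mg_mult\<close>)
  also have "\<dots> = (\<Sum>u\<in>U. scal [:f (v * u):] * mg (Rot u))"
    by (subst sum_U_mult[OF assms, symmetric]) (use v in \<open>simp add: field_simps\<close>)
  finally show "S f * mg (Ref v) = (\<Sum>u\<in>U. scal [:f (v * u):] * mg (Rot u))" .
qed

lemma Ref_As: "v \<in> U \<Longrightarrow> mg (Ref v) * As = As * mg (Ref v)"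
  by (simp add: Ref_S As_def)

lemma Ref_Ap: 
  assumes "v \<in> U" 
  shows "mg (Ref v) * Ap = scal [:v * v:] * (Am * mg (Ref v))"
proof -
  have 1: "a * (inverse v * inverse u) * (v * v) = a * (v * inverse u)" for u
    using U_nonzero[OF assms] by (simp add: divide_simps)
  then show ?thesis
    unfolding A_defs Ref_S[OF assms] sum_distrib_left
    by (intro sum.cong) (simp_all add: scal_assoc 1)
qed

text \<open>The difference T of the two sides satisfies T x = (1/v) y T and T y = v x T and vanishes
  on the monomials free of x and y, so \<open>endo_eq_0I\<close> applies.\<close>

lemma mg_Ref_mX:
  assumes v: "v \<in> U"
  shows "mg (Ref v) * mX = scal [:v:] * (mY * mg (Ref v))"
proof -
  let ?r = "mg (Ref v)"
  let ?T = "?r * mX - scal [:v:] * (mY * ?r)"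
  have v0: "v \<noteq> 0" using v U_nonzero by blast
  note rels = mX_mx mX_my mY_mx mY_my mg_Ref_mx[OF v0] mg_Ref_my[OF v0] Ref_As[OF v] Ref_Ap[OF v] mx_my
  note rels' = rels rels[THEN assoc_ext]
  have 1: "?T * mx = scal [:inverse v:] * my * ?T"
    using v0 by (simp add: rels' algebra_simps scal_left scal_assoc hb_left flip: one_pCons)
  have 2: "?T * my = scal [:v:] * mx * ?T"
    using v0 by (simp add: rels' algebra_simps scal_left scal_assoc hb_left flip: one_pCons)
  have "?T = 0"
    by (rule endo_eq_0I[OF 1 2])
       (use v0 in \<open>simp add: split_paired_all ap_mg ap_scl scl_scl power_int_add power_int_diff power_int_minus field_simps\<close>)
  then show ?thesis by simp
qed

text \<open>Follows from \<open>mg_Ref_mX\<close> by multiplying with the involution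
  \<open>Ref v\<close> on both sides.\<close>

lemma mg_Ref_mY:
  assumes v: "v \<in> U"
  shows "mg (Ref v) * mY = scal [:inverse v:] * (mX * mg (Ref v))"
proof -
  let ?r = "mg (Ref v)"
  have v0: "v \<noteq> 0" using v U_nonzero by blast
  have rr: "?r * ?r = 1" using v0 by (simp add: mg_one flip: mg_mult one_dih_def)
  have "?r * (?r * mX) * ?r = ?r * (scal [:v:] * (mY * ?r)) * ?r" by (simp add: mg_Ref_mX[OF v])
  then have "mX * ?r = scal [:v:] * (?r * mY)"
    by (metis (no_types, lifting) mult.assoc mult_1 mult_1_right rr scal_left_commute)
  then show ?thesis
    using v0 by (simp add: scal_assoc flip: one_pCons)
qed

lemma S_mX: "S f * mX = mY * S (\<lambda>u. f u * u)"
  unfolding S_def sum_distrib_left sum_distrib_right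
  by (rule sum.cong[OF refl], subst scal_move[OF mg_Ref_mX]) (simp_all add: mult.commute)

lemma S_mY: "S f * mY = mX * S (\<lambda>u. f u * inverse u)"
  unfolding S_def sum_distrib_left sum_distrib_right
  by (rule sum.cong[OF refl], subst scal_move[OF mg_Ref_mY]) (simp_all add: mult.commute)

lemma A_mX_mY: "As * mX = mY * Ap" "As * mY = mX * Am" "Ap * mY = mX * As" "Am * mX = mY * As"
  unfolding A_defs
proof -
  have 1: "S (\<lambda>u. a * u * inverse u) = S (\<lambda>u. a)" "S (\<lambda>u. a * inverse u * u) = S (\<lambda>u. a)"
    by (rule S_cong; simp add: U_nonzero)+
  note S_mX[of "\<lambda>u. a"] S_mY[of "\<lambda>u. a"] S_mY[of "\<lambda>u. a * u"] S_mX[of "\<lambda>u. a * inverse u"]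
  then show "S (\<lambda>u. a) * mX = mY * S (\<lambda>u. a * u)" "S (\<lambda>u. a) * mY = mX * S (\<lambda>u. a * inverse u)" "S (\<lambda>u. a * u) * mY = mX * S (\<lambda>u. a)" "S (\<lambda>u. a * inverse u) * mX = mY * S (\<lambda>u. a)"
    unfolding 1 by blast+
qed

text \<open>By \<open>A_mX_mY\<close> the commutator of X and Y commutes with x and y, and on
  monomials free of x and y both products raise the same two exponents.\<close>

lemma mX_mY: "mX * mY = mY * mX"
proof -
  let ?T = "mX * mY - mY * mX"
  note rels = mX_mx mX_my mY_mx mY_my A_mX_mY
  note rels' = rels rels[THEN assoc_ext]
  have 1: "?T * mx = mx * ?T" and 2: "?T * my = my * ?T"
    by (simp_all add: rels' algebra_simps hb_left)
  have "?T = 0"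
    by (rule endo_eq_0I[OF 1 2]) (simp add: split_paired_all)
  then show ?thesis by simp
qed

fun op :: "gen \<Rightarrow> idx endo" where
  "op (Vec k) = (if k = 1 then mx else my)"
| "op (Covec k) = (if k = 1 then mX else mY)"

text \<open>The rotation by u is the product of the reflections \<open>Ref u\<close> and
  \<open>Ref 1\<close>, so only reflections have to be treated.\<close>

lemma mg_op:
  assumes "g \<in> dihW d"
  shows "mg g * op v = scal [:dsc g v:] * (op (dgen g v) * mg g)"
proof -
  have ref: "mg (Ref u) * op v = scal [:dsc (Ref u) v:] * (op (dgen (Ref u) v) * mg (Ref u))"
    if "u \<in> U" for u v
  proof (cases v)
    case (Vec k)
    then show ?thesis using that exhaust_2[of k] by (auto simp: mg_Ref_mx mg_Ref_my U_nonzero)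
  next
    case (Covec k)
    then show ?thesis using that exhaust_2[of k] by (auto simp: mg_Ref_mX mg_Ref_mY)
  qed
  show ?thesis
  proof (cases g)
    case (Ref u)
    then show ?thesis using ref assms by (simp add: dihW_iff)
  next
    case (Rot u)
    have u: "u \<in> U" "u \<noteq> 0" using assms Rot U_nonzero by (auto simp: dihW_iff)
    have g: "mg g = mg (Ref u) * mg (Ref 1)"
      using u by (simp add: Rot flip: mg_mult)
    have "mg g * op v = mg (Ref u) * (mg (Ref 1) * op v)"
      by (simp add: g mult.assoc)
    also have "\<dots> = scal [:dsc (Ref 1) v:] * (mg (Ref u) * op (dgen (Ref 1) v)) * mg (Ref 1)"
      by (simp only: ref U_one scal_left mult.assoc)
    also have "\<dots> = scal [:dsc (Ref 1) v * dsc (Ref u) (dgen (Ref 1) v):] *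
        (op (dgen (Ref u) (dgen (Ref 1) v)) * mg g)"
      by (simp add: ref u g mult.assoc scal_assoc mult.commute)
    also have "dsc (Ref 1) v * dsc (Ref u) (dgen (Ref 1) v) = dsc g v"
      using Rot exhaust_2 by (cases v) auto
    also have "dgen (Ref u) (dgen (Ref 1) v) = dgen g v"
      using Rot exhaust_2 by (cases v) auto
    finally show ?thesis .
  qed
qed

end

section \<open>The PBW theorem\<close>

lemma keys_add_subset: "Poly_Mapping.keys m \<subseteq> B \<Longrightarrow> Poly_Mapping.keys n \<subseteq> B \<Longrightarrow> Poly_Mapping.keys (m + n) \<subseteq> B"
  using keys_add[of m n] by blast

lemma keys_diff_subset:
  fixes m n :: "'b \<Rightarrow>\<^sub>0 'c::ab_group_add"
  assumes "Poly_Mapping.keys m \<subseteq> B" "Poly_Mapping.keys n \<subseteq> B"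
  shows "Poly_Mapping.keys (m - n) \<subseteq> B"
proof
  fix k assume "k \<in> Poly_Mapping.keys (m - n)"
  then have "Poly_Mapping.lookup m k \<noteq> 0 \<or> Poly_Mapping.lookup n k \<noteq> 0"
    by (metis diff_zero in_keys_iff lookup_minus)
  then show "k \<in> B" using assms by (auto simp flip: in_keys_iff)
qed

lemma keys_scl_subset: "Poly_Mapping.keys m \<subseteq> B \<Longrightarrow> Poly_Mapping.keys (scl c m) \<subseteq> B"
  using keys_scl[of c m] by blast

lemma keys_sum_subset:
  "(\<And>i. i \<in> A \<Longrightarrow> Poly_Mapping.keys (f i) \<subseteq> B) \<Longrightarrow> Poly_Mapping.keys (\<Sum>i\<in>A. f i) \<subseteq> B"
  by (induction A rule: infinite_finite_induct) (simp_all add: keys_add_subset)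

lemma keys_ap_subset:
  assumes "\<And>b. b \<in> B \<Longrightarrow> Poly_Mapping.keys (ap f (bas b)) \<subseteq> B'" "Poly_Mapping.keys m \<subseteq> B"
  shows "Poly_Mapping.keys (ap f m) \<subseteq> B'"
  using assms(2)
proof (induction m rule: pm_induct)
  case (single k c)
  then show ?case
    using assms(1)[of k] by (subst single_eq_scl_bas) (simp only: ap_scl keys_scl_subset)
qed (simp_all add: ap_add keys_add_subset)

fun mon :: "nat \<times> nat \<times> nat \<times> nat \<Rightarrow> tensor" where
  "mon (a, b, c, e) = gx ^ a * gy ^ b * gX ^ c * gY ^ e"

text \<open>Turns a coordinate vector into the corresponding combination of ordered monomials.
  Modulo the ideal it is inverse to evaluating the operator of an element at \<open>v0\<close>, the
  vector of the unit.\<close>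

definition nf :: "(idx \<Rightarrow>\<^sub>0 complex poly) \<Rightarrow> smash" where
  "nf = pm_sum (\<lambda>(a, b, c, e, g) p. Poly_Mapping.single (matof g) (coeff_emb p * mon (a, b, c, e)))"

lemma nf_add: "nf (m + n) = nf m + nf n"
  unfolding nf_def by (rule pm_sum_add) (auto simp: coeff_emb_add distrib_right single_add)

lemma nf_zero [simp]: "nf 0 = 0"
  by (simp add: nf_def)

lemma nf_single: "nf (Poly_Mapping.single (a, b, c, e, g) p) =
    Poly_Mapping.single (matof g) (coeff_emb p * mon (a, b, c, e))"
  unfolding nf_def by (subst pm_sum_single) auto

lemma nf_diff: "nf (m - n) = nf m - nf n"
  by (metis add_diff_cancel_right' diff_add_cancel nf_add)

lemma nf_sum: "nf (\<Sum>i\<in>A. f i) = (\<Sum>i\<in>A. nf (f i))"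
  by (induction A rule: infinite_finite_induct) (auto simp: nf_add)

definition v0 :: "idx \<Rightarrow>\<^sub>0 complex poly" where "v0 = bas (0, 0, 0, 0, 1)"

lemma tensor_emb_mult: "tensor_emb s \<star> Poly_Mapping.single w t = Poly_Mapping.single w (s * t)"
  by (simp add: tensor_emb_def smash_mult_single)

section \<open>The representation and the vanishing of the ideal\<close>

context cherednik
begin

sublocale op: tensor_target scal op
  by standard (rule scal_add scal_mult scal_1 scal_commute)+

definition "rt = tev scal op"

lemmas rt_simps = op.tev_add[folded rt_def] op.tev_mult[folded rt_def] op.tev_coeff_emb[folded rt_def]
  op.tev_one[folded rt_def] op.tev_letter[folded rt_def] op.tev_diff[folded rt_def]
  op.tev_zero[folded rt_def] op.tev_power[folded rt_def]

definition "gof = inv_into (dihW d) matof"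

lemma gof_matof [simp]: "g \<in> dihW d \<Longrightarrow> gof (matof g) = g"
  by (simp add: gof_def inj_matof)

lemma mg_rt:
  assumes g: "g \<in> dihW d"
  shows "mg g * rt t = rt (act (matof g) t) * mg g"
proof (induction t rule: tensor_induct)
  case (monomial c us)
  have "mg g * rt (prod_list (map letter us)) = rt (act (matof g) (prod_list (map letter us))) * mg g"
  proof (induction us)
    case (Cons v us)
    have "mg g * (op v * f) = scal [:dsc g v:] * (op (dgen g v) * (mg g * f))" for f
      by (simp add: mg_op[OF g] mult.assoc flip: mult.assoc[of "mg g"])
    then show ?case
      by (simp add: rt_simps act_mult act_letter act_gen_matof dihW_par g mult.assoc Cons)
  qed (simp add: rt_simps)
  then show ?case
    by (simp add: rt_simps act_mult scal_left mult.assoc)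
qed (simp_all add: rt_simps act_add distrib_left distrib_right)

definition rho :: "smash \<Rightarrow> idx endo" where
  "rho = pm_sum (\<lambda>w t. rt t * mg (gof w))"

lemma rho_add: "rho (F + G) = rho F + rho G"
  unfolding rho_def by (rule pm_sum_add) (auto simp: rt_simps distrib_right)

lemma rho_zero [simp]: "rho 0 = 0"
  by (simp add: rho_def)

lemma rho_single: "rho (Poly_Mapping.single w t) = rt t * mg (gof w)"
  unfolding rho_def by (rule pm_sum_single) (simp add: rt_simps)

lemma rho_diff: "rho (F - G) = rho F - rho G"
  by (metis add_diff_cancel_right' diff_add_cancel rho_add)

lemma rho_sum: "rho (\<Sum>i\<in>A. f i) = (\<Sum>i\<in>A. rho (f i))"
  by (induction A rule: infinite_finite_induct) (auto simp: rho_add)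

lemma rho_tensor_emb: "rho (tensor_emb t) = rt t"
proof -
  have "gof (mat 1) = 1" using gof_matof[of 1] by (simp add: matof_one)
  then show ?thesis by (simp add: tensor_emb_def rho_single mg_one)
qed

lemma rho_mult:
  assumes "F \<in> C" "G \<in> C"
  shows "rho (F \<star> G) = rho F * rho G"
  using assms(1)
proof (induction F rule: C_induct)
  case (single w t)
  show ?case using assms(2)
  proof (induction G rule: C_induct)
    case (single w' t')
    obtain g h where gh: "g \<in> dihW d" "h \<in> dihW d" "w = matof g" "w' = matof h"
      using \<open>w \<in> W\<close> \<open>w' \<in> W\<close> by (auto simp: dihedral_eq)
    have "rt t * mg g * (rt t' * mg h) = rt t * (mg g * rt t') * mg h" by (simp add: mult.assoc)
    also have "\<dots> = rt (t * act w t') * mg (g * h)"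
      by (simp add: gh mg_rt mg_mult dihW_par rt_simps mult.assoc)
    finally show ?case using gh by (simp add: smash_mult_single rho_single dihW_mult flip: matof_mult)
  qed (simp_all add: smash_distrib_left rho_add distrib_left)
qed (simp_all add: smash_distrib_right rho_add distrib_right)

lemma sr [simp]: "F \<otimes>\<^bsub>smash_ring \<zeta>\<^esub> G = F \<star> G" "F \<oplus>\<^bsub>smash_ring \<zeta>\<^esub> G = F + G"
  "\<zero>\<^bsub>smash_ring \<zeta>\<^esub> = 0" "\<one>\<^bsub>smash_ring \<zeta>\<^esub> = tensor_emb 1"
  by (simp_all add: smash_ring_def)

sublocale sm: ring "smash_ring \<zeta>" by (rule smash_ring_ring)

lemma sr_inv: "F \<in> C \<Longrightarrow> \<ominus>\<^bsub>smash_ring \<zeta>\<^esub> F = - F"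
  by (rule sm.minus_equality) (simp_all add: uminus_C)

lemma sr_minus: "F \<in> C \<Longrightarrow> G \<in> C \<Longrightarrow> F \<ominus>\<^bsub>smash_ring \<zeta>\<^esub> G = F - G"
  unfolding a_minus_def by (simp add: sr_inv)

abbreviation "I \<equiv> cherednik_ideal d \<zeta> a"

lemma reflection_W: "reflection \<zeta> i \<in> W"
  unfolding reflection_eq dihedral_eq using zeta_pow_U by (auto simp: dihW_iff)

lemma tensor_emb_C: "tensor_emb t \<in> C"
  unfolding tensor_emb_def by (rule single_C[OF W_one])

lemma scaled_group_C: "w \<in> W \<Longrightarrow> scaled_group c w \<in> C"
  unfolding scaled_group_def by (rule single_C)

lemma diff_C: "F \<in> C \<Longrightarrow> G \<in> C \<Longrightarrow> F - G \<in> C"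
  using add_C[of F "- G"] uminus_C[of G] by simp

lemma sum_C: "(\<And>i. i \<in> A \<Longrightarrow> f i \<in> C) \<Longrightarrow> (\<Sum>i\<in>A. f i) \<in> C"
  by (induction A rule: infinite_finite_induct) (auto intro: add_C zero_C)

lemma relators_C: "cherednik_relators d \<zeta> a \<subseteq> C"
  unfolding cherednik_relators_def tcomm_def
  by (auto intro!: diff_C sum_C tensor_emb_C scaled_group_C reflection_W)

sublocale I: ideal I "smash_ring \<zeta>"
  unfolding cherednik_ideal_def by (rule sm.genideal_ideal[OF relators_C])

lemma I_C: "F \<in> I \<Longrightarrow> F \<in> C"
  by (rule I.a_Hcarr)

lemma I_zero: "0 \<in> I" and I_add: "F \<in> I \<Longrightarrow> G \<in> I \<Longrightarrow> F + G \<in> I"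
  using I.zero_closed I.a_closed by auto

lemma I_uminus: "F \<in> I \<Longrightarrow> - F \<in> I"
  using I.a_inv_closed[of F] sr_inv[OF I_C] by simp

lemma I_diff: "F \<in> I \<Longrightarrow> G \<in> I \<Longrightarrow> F - G \<in> I"
  using I_add[of F "- G"] I_uminus[of G] by simp

lemma I_mult_left: "F \<in> I \<Longrightarrow> G \<in> C \<Longrightarrow> G \<star> F \<in> I" and I_mult_right: "F \<in> I \<Longrightarrow> G \<in> C \<Longrightarrow> F \<star> G \<in> I"
  using I.I_l_closed I.I_r_closed by auto

lemma relators_I: "cherednik_relators d \<zeta> a \<subseteq> I"
  unfolding cherednik_ideal_def by (rule sm.genideal_self[OF relators_C])

lemma smash_diff_left: "F \<star> (G - H) = F \<star> G - F \<star> H"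
  by (metis add_diff_cancel_right' diff_add_cancel smash_distrib_left)

lemma smash_diff_right: "(G - H) \<star> F = G \<star> F - H \<star> F"
  by (metis add_diff_cancel_right' diff_add_cancel smash_distrib_right)

lemma smash_sum_right: "(\<Sum>i\<in>A. f i) \<star> F = (\<Sum>i\<in>A. f i \<star> F)"
  by (induction A rule: infinite_finite_induct) (auto simp: smash_distrib_right)

lemma rho_scaled_group:
  "rho (\<Sum>i<d. scaled_group (f (\<zeta> ^ i)) (reflection \<zeta> i)) = S f"
proof -
  have "Ref (\<zeta> ^ i) \<in> dihW d" for i using zeta_pow_U by (simp add: dihW_iff)
  then have "rho (\<Sum>i<d. scaled_group (f (\<zeta> ^ i)) (reflection \<zeta> i)) =
      (\<Sum>i<d. scal [:f (\<zeta> ^ i):] * mg (Ref (\<zeta> ^ i)))"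
    by (simp add: rho_sum scaled_group_def rho_single rt_simps reflection_eq)
  then show ?thesis
    unfolding S_def using sum_zeta[of "\<lambda>u. scal [:f u:] * mg (Ref u)"] by simp
qed

lemma rho_relators: "F \<in> cherednik_relators d \<zeta> a \<Longrightarrow> rho F = 0"
  unfolding cherednik_relators_def
  using rho_scaled_group[of "\<lambda>u. a"] rho_scaled_group[of "\<lambda>u. a * u"] rho_scaled_group[of "\<lambda>u. a * inverse u"]
  by (auto simp: tcomm_def rho_diff rho_tensor_emb rt_simps mx_my mX_mY mX_mx mX_my mY_mx mY_my
      A_defs hb_def)

lemma rho_I:
  assumes "F \<in> I"
  shows "rho F = 0"
proof -
  let ?K = "{F \<in> C. rho F = 0}"
  have "ideal ?K (smash_ring \<zeta>)"
  proof (rule idealI[OF smash_ring_ring])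
    show "subgroup ?K (add_monoid (smash_ring \<zeta>))"
    proof (unfold_locales)
      fix F assume "F \<in> ?K"
      then show "inv\<^bsub>add_monoid (smash_ring \<zeta>)\<^esub> F \<in> ?K"
        using sr_inv[of F] rho_diff[of 0 F] by (auto simp: a_inv_def uminus_C)
    qed (auto simp: rho_add zero_C add_C)
  qed (auto simp: rho_mult mult_C)
  then have "I \<subseteq> ?K"
    unfolding cherednik_ideal_def
    by (rule sm.genideal_minimal) (use relators_C rho_relators in auto)
  then show ?thesis using assms by auto
qed

text \<open>The index type admits every complex parameter in \<open>dih\<close>; \<open>MU\<close>
  is the submodule spanned by the monomials whose last factor lies in W.\<close>

definition "MU = {m :: idx \<Rightarrow>\<^sub>0 complex poly. Poly_Mapping.keys m \<subseteq> {(a, b, c, e, g). g \<in> dihW d}}"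

lemma MU_ap:
  assumes "m \<in> MU" "\<And>a b c e g. g \<in> dihW d \<Longrightarrow> ap f (bas (a, b, c, e, g)) \<in> MU"
  shows "ap f m \<in> MU"
  unfolding MU_def mem_Collect_eq
proof (rule keys_ap_subset)
  show "Poly_Mapping.keys m \<subseteq> {(a, b, c, e, g). g \<in> dihW d}" using assms(1) by (simp add: MU_def)
  fix k :: idx assume "k \<in> {(a, b, c, e, g). g \<in> dihW d}"
  then show "Poly_Mapping.keys (ap f (bas k)) \<subseteq> {(a, b, c, e, g). g \<in> dihW d}"
    using assms(2) by (cases k) (simp add: MU_def split: prod.splits)
qed

lemma MU_zero: "0 \<in> MU" and MU_add: "m \<in> MU \<Longrightarrow> n \<in> MU \<Longrightarrow> m + n \<in> MU"
  and MU_diff: "m \<in> MU \<Longrightarrow> n \<in> MU \<Longrightarrow> m - n \<in> MU"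
  and MU_scl: "m \<in> MU \<Longrightarrow> scl c m \<in> MU"
  by (simp_all add: MU_def keys_add_subset keys_diff_subset keys_scl_subset)

lemma MU_bas: "g \<in> dihW d \<Longrightarrow> bas (i, j, c, e, g) \<in> MU"
  by (simp add: MU_def)

lemma MU_mx: "m \<in> MU \<Longrightarrow> ap mx m \<in> MU" and MU_my: "m \<in> MU \<Longrightarrow> ap my m \<in> MU"
  by (erule MU_ap; simp add: MU_bas)+

lemma MU_mg:
  assumes "g \<in> dihW d" "m \<in> MU"
  shows "ap (mg g) m \<in> MU"
  using assms(2)
proof (rule MU_ap)
  fix a b c e h assume h: "h \<in> dihW d"
  then have "bas (a, b, c, e, g * h) \<in> MU" "bas (b, a, e, c, g * h) \<in> MU"
    using dihW_mult[OF assms(1) h] by (simp_all add: MU_bas)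
  then show "ap (mg g) (bas (a, b, c, e, h)) \<in> MU"
    by (cases g) (simp_all only: ap_mg mgb.simps MU_scl)
qed

lemma MU_sum: "(\<And>i. i \<in> A \<Longrightarrow> f i \<in> MU) \<Longrightarrow> (\<Sum>i\<in>A. f i) \<in> MU"
  unfolding MU_def mem_Collect_eq by (rule keys_sum_subset)

lemma MU_S:
  assumes "m \<in> MU"
  shows "ap (S f) m \<in> MU"
  unfolding S_def ap_sum_left
proof (rule MU_sum)
  fix u assume "u \<in> U"
  then have "ap (mg (Ref u)) m \<in> MU" using assms by (intro MU_mg) (auto simp: dihW_iff)
  then show "ap (scal [:f u:] * mg (Ref u)) m \<in> MU" by (simp only: ap_simps ap_scal MU_scl)
qed

text \<open>This is linear independence: an ordered monomial applied to \<open>v0\<close> builds its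
  own basis vector from the right, and X and Y only meet monomials free of x and y, where they are
  plain shifts.\<close>

lemma rho_nf:
  assumes "m \<in> MU"
  shows "ap (rho (nf m)) v0 = m"
  using assms unfolding MU_def mem_Collect_eq
proof (induction m rule: pm_induct)
  case (single k p)
  obtain a b c e g where k: "k = (a, b, c, e, g)" by (metis prod_cases5)
  have g: "g \<in> dihW d" using single k by simp
  have 1: "ap (mY ^ e) (bas (0, 0, 0, 0, g)) = bas (0, 0, 0, e, g)"
    by (induction e) auto
  have 2: "ap (mX ^ c) (bas (0, 0, 0, e, g)) = bas (0, 0, c, e, g)"
    by (induction c) auto
  have 3: "ap (my ^ b) (bas (0, 0, c, e, g)) = bas (0, b, c, e, g)"
    by (induction b) auto
  have 4: "ap (mx ^ a) (bas (0, b, c, e, g)) = bas (a, b, c, e, g)"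
    by (induction a) auto
  have 5: "ap (mg g) v0 = bas (0, 0, 0, 0, g)"
    unfolding v0_def one_dih_def by (cases g) (simp_all add: ap_mg flip: one_pCons)
  show ?case using g
    by (simp add: k nf_single rho_single rt_simps 1 2 3 4 5 scl_single)
qed (simp_all add: nf_add rho_add)

lemma nf_C:
  assumes "m \<in> MU"
  shows "nf m \<in> C"
  using assms unfolding MU_def mem_Collect_eq
  by (induction m rule: pm_induct) (auto simp: nf_single nf_add dihedral_eq intro!: zero_C single_C add_C)

section \<open>Reordering words modulo the ideal\<close>

definition cong_I (infix "\<sim>" 50) where "F \<sim> G \<longleftrightarrow> F - G \<in> I"

lemma cong_refl [simp]: "F \<sim> F"
  by (simp add: cong_I_def I_zero)

lemma cong_sym: "F \<sim> G \<Longrightarrow> G \<sim> F"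
  unfolding cong_I_def using I_uminus[of "F - G"] by simp

lemma cong_trans [trans]: "F \<sim> G \<Longrightarrow> G \<sim> H \<Longrightarrow> F \<sim> H"
  unfolding cong_I_def using I_add[of "F - G" "G - H"] by simp

lemma cong_add: "F \<sim> G \<Longrightarrow> F' \<sim> G' \<Longrightarrow> F + F' \<sim> G + G'"
  unfolding cong_I_def using I_add[of "F - G" "F' - G'"] by (simp add: algebra_simps)

lemma cong_diff: "F \<sim> G \<Longrightarrow> F' \<sim> G' \<Longrightarrow> F - F' \<sim> G - G'"
  unfolding cong_I_def using I_diff[of "F - G" "F' - G'"] by (simp add: algebra_simps)

lemma cong_sum: "(\<And>i. i \<in> A \<Longrightarrow> f i \<sim> g i) \<Longrightarrow> (\<Sum>i\<in>A. f i) \<sim> (\<Sum>i\<in>A. g i)"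
  by (induction A rule: infinite_finite_induct) (auto intro: cong_add)

lemma cong_mult_left: "F \<sim> G \<Longrightarrow> H \<in> C \<Longrightarrow> H \<star> F \<sim> H \<star> G"
  unfolding cong_I_def using I_mult_left[of "F - G" H] by (simp add: smash_diff_left)

lemma cong_mult_right: "F \<sim> G \<Longrightarrow> H \<in> C \<Longrightarrow> F \<star> H \<sim> G \<star> H"
  unfolding cong_I_def using I_mult_right[of "F - G" H] by (simp add: smash_diff_right)

lemma cong_tensor_mult:
  assumes "tensor_emb s \<sim> tensor_emb s'" "w \<in> W"
  shows "Poly_Mapping.single w (l * s * r) \<sim> Poly_Mapping.single w (l * s' * r)"
  using cong_mult_left[OF cong_mult_right[OF assms(1) single_C[OF assms(2), of r]] tensor_emb_C[of l]]
  by (simp add: tensor_emb_mult mult.assoc)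

lemma cong_powers_commute:
  assumes "tensor_emb (s * t) \<sim> tensor_emb (t * s)"
  shows "tensor_emb (s ^ m * t ^ n) \<sim> tensor_emb (t ^ n * s ^ m)"
proof -
  have step: "tensor_emb (p ^ n * q) \<sim> tensor_emb (q * p ^ n)"
    if "tensor_emb (p * q) \<sim> tensor_emb (q * p)" for p q n
  proof (induction n)
    case (Suc n)
    have "tensor_emb (p ^ Suc n * q) \<sim> tensor_emb (p * (q * p ^ n))"
      using cong_tensor_mult[OF Suc W_one, of p 1] by (simp add: tensor_emb_def mult.assoc)
    also have "\<dots> \<sim> tensor_emb (q * p * p ^ n)"
      using cong_tensor_mult[OF that W_one, of 1 "p ^ n"] by (simp add: tensor_emb_def mult.assoc)
    finally show ?case by (simp add: mult.assoc)
  qed simp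
  show ?thesis
    by (rule step) (rule cong_sym, rule step, rule cong_sym, rule assms)
qed

lemma relator_cong:
  "tensor_emb (gx * gy) \<sim> tensor_emb (gy * gx)" "tensor_emb (gX * gY) \<sim> tensor_emb (gY * gX)"
  using relators_I by (auto simp: cherednik_relators_def tcomm_def cong_I_def tensor_emb_def single_diff)

lemma nf_coeff: "tensor_emb (coeff_emb c) \<star> nf m = nf (scl c m)"
proof (induction m rule: pm_induct_UNIV)
  case (single k p)
  obtain a b c' e g where k: "k = (a, b, c', e, g)" by (metis prod_cases5)
  show ?case by (simp add: k nf_single scl_single tensor_emb_mult coeff_emb_assoc del: mon.simps)
qed (simp_all add: nf_add scl_add smash_distrib_left)

lemma nf_mx: "tensor_emb gx \<star> nf m = nf (ap mx m)"
proof (induction m rule: pm_induct_UNIV)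
  case (single k p)
  obtain a b c e g where k: "k = (a, b, c, e, g)" by (metis prod_cases5)
  have "gx * (coeff_emb p * t) = coeff_emb p * (gx * t)" for t
    by (metis coeff_emb_commute mult.assoc)
  moreover have "ap mx (Poly_Mapping.single (a, b, c, e, g) p) = scl p (ap mx (bas (a, b, c, e, g)))"
    by (subst single_eq_scl_bas) (rule ap_scl)
  ultimately show ?case
    by (simp add: k scl_single nf_single tensor_emb_mult mult.assoc)
qed (simp_all add: nf_add ap_add smash_distrib_left)

text \<open>Both sides are linear over polynomials in \<hbar>, so ordered monomials suffice. That
  scalars pass through G is an assumption here and is discharged by
  \<open>coeff_central\<close>.\<close>

lemma nf_congI:
  assumes "m \<in> MU" "G \<in> C"
    and "\<And>a b c e g. g \<in> dihW d \<Longrightarrow> G \<star> nf (bas (a, b, c, e, g)) \<sim> nf (ap f (bas (a, b, c, e, g)))"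
    and "\<And>c F. F \<in> C \<Longrightarrow> G \<star> (tensor_emb (coeff_emb c) \<star> F) = tensor_emb (coeff_emb c) \<star> (G \<star> F)"
  shows "G \<star> nf m \<sim> nf (ap f m)"
  using assms(1) unfolding MU_def mem_Collect_eq
proof (induction m rule: pm_induct)
  case (single k p)
  obtain a b c e g where k: "k = (a, b, c, e, g)" by (metis prod_cases5)
  have g: "g \<in> dihW d" using single k by simp
  have "G \<star> nf (scl p (bas k)) = tensor_emb (coeff_emb p) \<star> (G \<star> nf (bas k))"
    using assms(4)[OF nf_C[OF MU_bas[OF g]]] by (simp add: k flip: nf_coeff)
  also have "\<dots> \<sim> tensor_emb (coeff_emb p) \<star> nf (ap f (bas k))"
    unfolding k by (rule cong_mult_left[OF assms(3)[OF g] tensor_emb_C])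
  also have "\<dots> = nf (ap f (scl p (bas k)))" by (simp add: nf_coeff ap_scl)
  finally show ?case by (simp add: scl_single)
qed (simp_all add: smash_distrib_left nf_add ap_add cong_add)

lemma coeff_central:
  assumes "G \<in> C" "F \<in> C"
  shows "G \<star> (tensor_emb (coeff_emb c) \<star> F) = tensor_emb (coeff_emb c) \<star> (G \<star> F)"
proof -
  have "G \<star> tensor_emb (coeff_emb c) = tensor_emb (coeff_emb c) \<star> G"
    using assms(1)
  proof (induction G rule: C_induct)
    case (single w t)
    show ?case by (simp add: tensor_emb_def smash_mult_single coeff_emb_commute)
  qed (simp_all add: smash_distrib_left smash_distrib_right)
  then show ?thesis using assms tensor_emb_C by (metis smash_assoc)
qed

lemmas nf_congI' = nf_congI[OF _ _ _ coeff_central]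

lemma nf_my:
  assumes "m \<in> MU"
  shows "tensor_emb gy \<star> nf m \<sim> nf (ap my m)"
proof (rule nf_congI'[OF assms tensor_emb_C _ tensor_emb_C])
  fix a b c e g assume g: "g \<in> dihW d"
  have "tensor_emb (gy ^ 1 * gx ^ a) \<sim> tensor_emb (gx ^ a * gy ^ 1)"
    by (rule cong_powers_commute) (rule cong_sym, rule relator_cong)
  from cong_tensor_mult[OF this, of "matof g" 1 "gy ^ b * gX ^ c * gY ^ e"]
  show "tensor_emb gy \<star> nf (bas (a, b, c, e, g)) \<sim> nf (ap my (bas (a, b, c, e, g)))"
    using g by (simp add: nf_single tensor_emb_mult mult.assoc dihedral_eq)
qed

lemma act_power: "act w (t ^ n) = act w t ^ n"
  by (induction n) (auto simp: act_mult)

lemma coeff_emb_power: "(coeff_emb [:c:] * t) ^ n = coeff_emb [:c ^ n:] * t ^ n"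
proof (induction n)
  case (Suc n)
  have "coeff_emb [:c:] * t * (coeff_emb [:c ^ n:] * t ^ n) = coeff_emb [:c:] * (t * coeff_emb [:c ^ n:]) * t ^ n"
    by (simp add: mult.assoc)
  also have "\<dots> = coeff_emb [:c ^ Suc n:] * t ^ Suc n"
    by (simp add: coeff_emb_commute mult.assoc coeff_emb_assoc mult.commute)
  finally show ?case by (simp add: Suc)
qed (simp flip: one_pCons)

text \<open>Rotations scale each ordered monomial. A reflection leaves y^a x^b and Y^c X^e in the
  wrong order, which the relations [x, y] = [X, Y] = 0 repair.\<close>

lemma nf_mg:
  assumes g: "g \<in> dihW d" and "m \<in> MU"
  shows "group_emb (matof g) \<star> nf m \<sim> nf (ap (mg g) m)"
proof -
  have gW: "matof g \<in> W" using g by (simp add: dihedral_eq)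
  have GC: "group_emb (matof g) \<in> C" unfolding group_emb_def by (rule single_C[OF gW])
  show ?thesis
  proof (rule nf_congI'[OF assms(2) GC _ GC])
    fix a b c e h assume h: "h \<in> dihW d"
    have ghW: "matof (g * h) \<in> W" using dihW_mult[OF g h] by (simp add: dihedral_eq)
    have move: "letter v ^ n * (coeff_emb p * s) = coeff_emb p * (letter v ^ n * s)" for v n s p
      by (metis coeff_emb_commute mult.assoc)
    have "group_emb (matof g) \<star> nf (bas (a, b, c, e, h)) =
        Poly_Mapping.single (matof (g * h)) (act (matof g) (mon (a, b, c, e)))"
      by (simp add: group_emb_def nf_single smash_mult_single matof_mult del: mon.simps)
    also have "\<dots> \<sim> nf (ap (mg g) (bas (a, b, c, e, h)))"
    proof (cases g)
      case (Rot u)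
      have u: "u \<noteq> 0" using dihW_par[OF g] Rot by simp
      have "u ^ a * (inverse u ^ b * (inverse u ^ c * u ^ e)) = u powi wgt (a, b, c, e, h)"
        using u by (simp add: power_int_diff power_int_add field_simps)
      then have "act (matof g) (mon (a, b, c, e)) = coeff_emb [:u powi wgt (a, b, c, e, h):] * mon (a, b, c, e)"
        using u by (simp add: Rot act_mult act_power act_letter act_gen_matof coeff_emb_power
            mult.assoc move coeff_emb_assoc mult.commute mult.left_commute del: wgt.simps)
      then show ?thesis
        by (simp add: Rot ap_mg scl_single nf_single del: mon.simps wgt.simps)
    next
      case (Ref u)
      have u: "u \<noteq> 0" using dihW_par[OF g] Ref by simp
      have "inverse u ^ a * (u ^ b * (u ^ c * inverse u ^ e)) = u powi (- wgt (a, b, c, e, h))"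
        using u by (simp add: power_int_diff power_int_add field_simps)
      then have "act (matof g) (mon (a, b, c, e)) =
          coeff_emb [:u powi (- wgt (a, b, c, e, h)):] * (gy ^ a * gx ^ b * (gY ^ c * gX ^ e))"
        using u by (simp add: Ref act_mult act_power act_letter act_gen_matof coeff_emb_power
            mult.assoc move coeff_emb_assoc mult.commute mult.left_commute del: wgt.simps)
      moreover have "Poly_Mapping.single (matof (g * h)) (coeff_emb p * (gy ^ a * gx ^ b * (gY ^ c * gX ^ e))) \<sim>
          Poly_Mapping.single (matof (g * h)) (coeff_emb p * mon (b, a, e, c))" for p
      proof -
        have 1: "tensor_emb (gy ^ a * gx ^ b) \<sim> tensor_emb (gx ^ b * gy ^ a)"
          by (rule cong_powers_commute) (rule cong_sym, rule relator_cong)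
        have 2: "tensor_emb (gY ^ c * gX ^ e) \<sim> tensor_emb (gX ^ e * gY ^ c)"
          by (rule cong_powers_commute) (rule cong_sym, rule relator_cong)
        have "Poly_Mapping.single (matof (g * h)) (coeff_emb p * (gy ^ a * gx ^ b * (gY ^ c * gX ^ e))) \<sim>
            Poly_Mapping.single (matof (g * h)) (coeff_emb p * (gx ^ b * gy ^ a) * (gY ^ c * gX ^ e))"
          using cong_tensor_mult[OF 1 ghW, of "coeff_emb p" "gY ^ c * gX ^ e"] by (simp add: mult.assoc)
        also have "\<dots> \<sim> Poly_Mapping.single (matof (g * h)) (coeff_emb p * mon (b, a, e, c))"
          using cong_tensor_mult[OF 2 ghW, of "coeff_emb p * (gx ^ b * gy ^ a)" 1] by (simp add: mult.assoc)
        finally show ?thesis .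
      qed
      ultimately show ?thesis
        by (simp add: Ref ap_mg scl_single nf_single del: mon.simps wgt.simps)
    qed
    finally show "group_emb (matof g) \<star> nf (bas (a, b, c, e, h)) \<sim> nf (ap (mg g) (bas (a, b, c, e, h)))" .
  qed
qed

lemma nf_S:
  assumes "m \<in> MU"
  shows "(\<Sum>i<d. scaled_group (f (\<zeta> ^ i)) (reflection \<zeta> i)) \<star> nf m \<sim> nf (ap (S f) m)"
proof -
  have "scaled_group (f (\<zeta> ^ i)) (reflection \<zeta> i) \<star> nf m \<sim>
      nf (scl [:f (\<zeta> ^ i):] (ap (mg (Ref (\<zeta> ^ i))) m))" for i
  proof -
    have "scaled_group (f (\<zeta> ^ i)) (reflection \<zeta> i) =
        tensor_emb (coeff_emb [:f (\<zeta> ^ i):]) \<star> group_emb (reflection \<zeta> i)"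
      by (simp add: scaled_group_def group_emb_def tensor_emb_mult)
    moreover have "group_emb (reflection \<zeta> i) \<in> C"
      unfolding group_emb_def by (rule single_C[OF reflection_W])
    moreover have "group_emb (reflection \<zeta> i) \<star> nf m \<sim> nf (ap (mg (Ref (\<zeta> ^ i))) m)"
      unfolding reflection_eq by (rule nf_mg) (use assms zeta_pow_U in \<open>auto simp: dihW_iff\<close>)
    ultimately show ?thesis
      using cong_mult_left[of _ _ "tensor_emb (coeff_emb [:f (\<zeta> ^ i):])"] assms
      by (simp add: smash_assoc tensor_emb_C nf_C flip: nf_coeff)
  qed
  then have "(\<Sum>i<d. scaled_group (f (\<zeta> ^ i)) (reflection \<zeta> i)) \<star> nf m \<sim>
      (\<Sum>i<d. nf (scl [:f (\<zeta> ^ i):] (ap (mg (Ref (\<zeta> ^ i))) m)))"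
    unfolding smash_sum_right by (intro cong_sum)
  also have "\<dots> = nf (ap (S f) m)"
    unfolding S_def ap_sum_left nf_sum
    using sum_zeta[of "\<lambda>u. nf (scl [:f u:] (ap (mg (Ref u)) m))"] by simp
  finally show ?thesis .
qed

text \<open>The recursion defining \<open>mX\<close> and \<open>mY\<close> mirrors the reordering of words in the algebra.\<close>

lemma nf_kend:
  assumes FC: "Fx \<in> C" "Fy \<in> C"
    and comm: "tcomm gx k \<sim> Fx" "tcomm gy k \<sim> Fy"
    and cx: "\<And>m. m \<in> MU \<Longrightarrow> Fx \<star> nf m \<sim> nf (ap cx m) \<and> ap cx m \<in> MU"
    and cy: "\<And>m. m \<in> MU \<Longrightarrow> Fy \<star> nf m \<sim> nf (ap cy m) \<and> ap cy m \<in> MU"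
    and K: "K * mx = mx * K - cx" "K * my = my * K - cy"
    and base: "\<And>c e g. g \<in> dihW d \<Longrightarrow>
      tensor_emb k \<star> nf (bas (0, 0, c, e, g)) \<sim> nf (ap K (bas (0, 0, c, e, g))) \<and>
      ap K (bas (0, 0, c, e, g)) \<in> MU"
    and m: "m \<in> MU"
  shows "tensor_emb k \<star> nf m \<sim> nf (ap K m) \<and> ap K m \<in> MU"
proof -
  \<comment> \<open>Treats x and y at once: z is the operator of the letter t, and k t is rewritten
    as t k - [t, k].\<close>
  have step: "tensor_emb k \<star> nf (ap z m) \<sim> nf (ap K (ap z m)) \<and> ap K (ap z m) \<in> MU"
    if m: "m \<in> MU" and IH: "tensor_emb k \<star> nf m \<sim> nf (ap K m) \<and> ap K m \<in> MU"
      and zm: "\<And>m. m \<in> MU \<Longrightarrow> tensor_emb t \<star> nf m \<sim> nf (ap z m) \<and> ap z m \<in> MU"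
      and zc: "tcomm t k \<sim> F" "F \<in> C"
      and cz: "\<And>m. m \<in> MU \<Longrightarrow> F \<star> nf m \<sim> nf (ap cz m) \<and> ap cz m \<in> MU"
      and Kz: "K * z = z * K - cz"
    for z t F cz m
  proof -
    have Kz': "ap K (ap z m) = ap z (ap K m) - ap cz m"
      using arg_cong[OF Kz, of "\<lambda>f. ap f m"] by simp
    have "tensor_emb k \<star> nf (ap z m) \<sim> tensor_emb k \<star> (tensor_emb t \<star> nf m)"
      by (rule cong_mult_left[OF cong_sym tensor_emb_C]) (use zm m in blast)
    also have "\<dots> = (tensor_emb k \<star> tensor_emb t) \<star> nf m"
      by (rule smash_assoc[symmetric]) (simp_all add: tensor_emb_C nf_C m)
    also have "tensor_emb k \<star> tensor_emb t = tensor_emb t \<star> tensor_emb k - tcomm t k"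
      by (simp add: tensor_emb_def tcomm_def smash_mult_single single_diff)
    also have "(tensor_emb t \<star> tensor_emb k - tcomm t k) \<star> nf m =
        tensor_emb t \<star> (tensor_emb k \<star> nf m) - tcomm t k \<star> nf m"
      by (simp add: smash_diff_right smash_assoc tensor_emb_C nf_C m)
    also have "\<dots> \<sim> nf (ap z (ap K m)) - nf (ap cz m)"
    proof (rule cong_diff)
      show "tensor_emb t \<star> (tensor_emb k \<star> nf m) \<sim> nf (ap z (ap K m))"
        using cong_trans[OF cong_mult_left[OF conjunct1[OF IH] tensor_emb_C]] zm IH by blast
      show "tcomm t k \<star> nf m \<sim> nf (ap cz m)"
        using cong_trans[OF cong_mult_right[OF zc(1) nf_C[OF m]]] cz m by blast
    qed
    also have "\<dots> = nf (ap K (ap z m))" by (simp add: Kz' nf_diff)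
    finally show ?thesis unfolding Kz' using zm cz IH m MU_diff by blast
  qed
  have x: "tensor_emb gx \<star> nf m \<sim> nf (ap mx m) \<and> ap mx m \<in> MU" if "m \<in> MU" for m
    using MU_mx[OF that] by (simp add: nf_mx)
  have y: "tensor_emb gy \<star> nf m \<sim> nf (ap my m) \<and> ap my m \<in> MU" if "m \<in> MU" for m
    using MU_my[OF that] nf_my[OF that] by simp
  have main: "tensor_emb k \<star> nf (bas (a, b, c, e, g)) \<sim> nf (ap K (bas (a, b, c, e, g))) \<and>
      ap K (bas (a, b, c, e, g)) \<in> MU" if g: "g \<in> dihW d" for a b c e g
  proof (induction a)
    case 0
    show ?case
    proof (induction b)
      case 0
      show ?case by (rule base[OF g])
    next
      case (Suc b)
      from step[OF MU_bas[OF g] Suc y comm(2) FC(2) cy K(2)] show ?case by simp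
    qed
  next
    case (Suc a)
    from step[OF MU_bas[OF g] Suc x comm(1) FC(1) cx K(1)] show ?case by simp
  qed
  show ?thesis
    using nf_congI'[OF m tensor_emb_C _ tensor_emb_C, of k K] MU_ap[OF m, of K] main by blast
qed

lemma nf_hb_As:
  assumes "m \<in> MU"
  shows "(tensor_emb ghbar - (\<Sum>i<d. scaled_group a (reflection \<zeta> i))) \<star> nf m \<sim> nf (ap (hb - As) m) \<and>
    ap (hb - As) m \<in> MU"
  using nf_S[OF assms, of "\<lambda>u. a"] MU_S[OF assms, of "\<lambda>u. a"] MU_scl[OF assms, of "[:0, 1:]"]
  by (simp add: smash_diff_right nf_coeff hb_def nf_diff cong_diff As_def MU_diff)

lemma nf_mX:
  assumes "m \<in> MU"
  shows "tensor_emb gX \<star> nf m \<sim> nf (ap mX m) \<and> ap mX m \<in> MU"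
proof (rule nf_kend[OF _ _ _ _ nf_hb_As _ mX_mx mX_my _ assms])
  show "tcomm gx gX \<sim> tensor_emb ghbar - (\<Sum>i<d. scaled_group a (reflection \<zeta> i))"
    "tcomm gy gX \<sim> (\<Sum>i<d. scaled_group (a * \<zeta> ^ i) (reflection \<zeta> i))"
    using relators_I by (auto simp: cherednik_relators_def cong_I_def)
  show "(\<Sum>i<d. scaled_group (a * \<zeta> ^ i) (reflection \<zeta> i)) \<star> nf m \<sim> nf (ap Ap m) \<and> ap Ap m \<in> MU"
    if "m \<in> MU" for m
    unfolding Ap_def using nf_S[OF that, of "\<lambda>u. a * u"] MU_S[OF that] by blast
  show "tensor_emb gX \<star> nf (bas (0, 0, c, e, g)) \<sim> nf (ap mX (bas (0, 0, c, e, g))) \<and>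
      ap mX (bas (0, 0, c, e, g)) \<in> MU" if "g \<in> dihW d" for c e g
    using that by (simp add: nf_single tensor_emb_mult mult.assoc MU_bas)
qed (auto intro!: diff_C sum_C tensor_emb_C scaled_group_C reflection_W)

lemma nf_mY:
  assumes "m \<in> MU"
  shows "tensor_emb gY \<star> nf m \<sim> nf (ap mY m) \<and> ap mY m \<in> MU"
proof (rule nf_kend[OF _ _ _ _ _ nf_hb_As mY_mx mY_my _ assms])
  show "tcomm gy gY \<sim> tensor_emb ghbar - (\<Sum>i<d. scaled_group a (reflection \<zeta> i))"
    "tcomm gx gY \<sim> (\<Sum>i<d. scaled_group (a * inverse (\<zeta> ^ i)) (reflection \<zeta> i))"
    using relators_I by (auto simp: cherednik_relators_def cong_I_def)
  show "(\<Sum>i<d. scaled_group (a * inverse (\<zeta> ^ i)) (reflection \<zeta> i)) \<star> nf m \<sim> nf (ap Am m) \<and> ap Am m \<in> MU"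
    if "m \<in> MU" for m
    unfolding Am_def using nf_S[OF that, of "\<lambda>u. a * inverse u"] MU_S[OF that] by blast
  show "tensor_emb gY \<star> nf (bas (0, 0, c, e, g)) \<sim> nf (ap mY (bas (0, 0, c, e, g))) \<and>
      ap mY (bas (0, 0, c, e, g)) \<in> MU" if g: "g \<in> dihW d" for c e g
  proof -
    \<comment> \<open>Unlike X, the letter Y first has to pass X^c to reach its place.\<close>
    have "tensor_emb (gY ^ 1 * gX ^ c) \<sim> tensor_emb (gX ^ c * gY ^ 1)"
      by (rule cong_powers_commute) (rule cong_sym, rule relator_cong)
    from cong_tensor_mult[OF this, of "matof g" 1 "gY ^ e"]
    show ?thesis using g by (simp add: nf_single tensor_emb_mult mult.assoc dihedral_eq MU_bas)
  qed
qed (auto intro!: diff_C sum_C tensor_emb_C scaled_group_C reflection_W)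

lemma nf_op:
  assumes "m \<in> MU"
  shows "tensor_emb (letter v) \<star> nf m \<sim> nf (ap (op v) m) \<and> ap (op v) m \<in> MU"
proof (cases v)
  case (Vec k)
  then show ?thesis using exhaust_2[of k] nf_mx[of m] nf_my[OF assms] MU_mx[OF assms] MU_my[OF assms] by auto
next
  case (Covec k)
  then show ?thesis using exhaust_2[of k] nf_mX[OF assms] nf_mY[OF assms] by auto
qed

text \<open>Words are built up from the left, and \<open>nf_op\<close> puts each new letter into
  ordered form.\<close>

lemma spanning:
  assumes "F \<in> C"
  shows "\<exists>m\<in>MU. F \<sim> nf m"
  using assms
proof (induction F rule: C_induct)
  case zero
  have "0 \<sim> nf 0" by simp
  then show ?case using MU_zero by blast
next
  case (add F G)
  then obtain m n where "m \<in> MU" "n \<in> MU" "F \<sim> nf m" "G \<sim> nf n" by blast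
  then have "m + n \<in> MU" "F + G \<sim> nf (m + n)" using MU_add by (auto simp: nf_add cong_add)
  then show ?case by blast
next
  case (single w t)
  obtain g where g: "g \<in> dihW d" "w = matof g" using single by (auto simp: dihedral_eq)
  show ?case
  proof (induction t rule: tensor_induct)
    case zero
    have "Poly_Mapping.single w 0 \<sim> nf 0" by simp
    then show ?case using MU_zero by blast
  next
    case (add s t)
    then obtain m n where "m \<in> MU" "n \<in> MU" "Poly_Mapping.single w s \<sim> nf m" "Poly_Mapping.single w t \<sim> nf n" by blast
    then have "m + n \<in> MU" "Poly_Mapping.single w (s + t) \<sim> nf (m + n)"
      using MU_add by (auto simp: nf_add cong_add single_add)
    then show ?case by blast
  next
    case (monomial c us)
    have "\<exists>m\<in>MU. Poly_Mapping.single w (prod_list (map letter us)) \<sim> nf m"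
    proof (induction us)
      case Nil
      have "Poly_Mapping.single w (prod_list (map letter [])) \<sim> nf (bas (0, 0, 0, 0, g))" by (simp add: nf_single g)
      then show ?case using MU_bas[OF g(1)] by blast
    next
      case (Cons v us)
      then obtain m where m: "m \<in> MU" "Poly_Mapping.single w (prod_list (map letter us)) \<sim> nf m" by blast
      have "Poly_Mapping.single w (prod_list (map letter (v # us))) \<sim> tensor_emb (letter v) \<star> nf m"
        using cong_mult_left[OF m(2) tensor_emb_C[of "letter v"]] by (simp add: tensor_emb_mult)
      also have "\<dots> \<sim> nf (ap (op v) m)" using nf_op[OF m(1)] by blast
      finally show ?case using nf_op[OF m(1)] by blast
    qed
    then obtain m where m: "m \<in> MU" "Poly_Mapping.single w (prod_list (map letter us)) \<sim> nf m" by blast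
    have "Poly_Mapping.single w (coeff_emb c * prod_list (map letter us)) \<sim> nf (scl c m)"
      using cong_mult_left[OF m(2) tensor_emb_C[of "coeff_emb c"]] by (simp add: tensor_emb_mult nf_coeff)
    then show ?case using MU_scl[OF m(1)] by blast
  qed
qed

text \<open>\<open>spanning\<close> supplies some coordinate vector; applying both sides to
  \<open>v0\<close> identifies it by \<open>rho_nf\<close>.\<close>

theorem PBW:
  assumes "F \<in> C"
  shows "ap (rho F) v0 \<in> MU" and "F \<sim> nf (ap (rho F) v0)"
proof -
  obtain m where m: "m \<in> MU" "F \<sim> nf m" using spanning[OF assms] by blast
  have "rho F = rho (nf m)" using rho_I[of "F - nf m"] m(2) by (simp add: cong_I_def rho_diff)
  then have "ap (rho F) v0 = m" using rho_nf[OF m(1)] by simp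
  then show "ap (rho F) v0 \<in> MU" "F \<sim> nf (ap (rho F) v0)" using m by auto
qed

text \<open>The representation is faithful modulo the ideal, and an operator in its image is already
  determined by its value at the single vector \<open>v0\<close>.\<close>

lemma ap_v0_eq_iff:
  assumes "F \<in> C" "G \<in> C"
  shows "ap (rho F) v0 = ap (rho G) v0 \<longleftrightarrow> F \<sim> G" "rho F = rho G \<longleftrightarrow> F \<sim> G"
proof -
  have "F \<sim> G" if "ap (rho F) v0 = ap (rho G) v0"
    using PBW(2)[OF assms(1)] PBW(2)[OF assms(2)] that cong_trans cong_sym by metis
  moreover have "rho F = rho G" if "F \<sim> G"
    using that rho_I[of "F - G"] by (simp add: cong_I_def rho_diff)
  ultimately show "ap (rho F) v0 = ap (rho G) v0 \<longleftrightarrow> F \<sim> G" "rho F = rho G \<longleftrightarrow> F \<sim> G" by auto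
qed

end

section \<open>The algebras, their center and the bracket in terms of operators\<close>

lemma (in ideal) carrier_Quot: "carrier (R Quot I) = (\<lambda>x. I +> x) ` carrier R"
  by (auto simp: FactRing_def A_RCOSETS_def')

lemma (in ideal) Quot_hom:
  assumes "x \<in> carrier R" "y \<in> carrier R"
  shows "(I +> x) \<otimes>\<^bsub>R Quot I\<^esub> (I +> y) = I +> (x \<otimes> y)"
    and "(I +> x) \<oplus>\<^bsub>R Quot I\<^esub> (I +> y) = I +> (x \<oplus> y)"
    and "(I +> x) \<ominus>\<^bsub>R Quot I\<^esub> (I +> y) = I +> (x \<ominus> y)"
proof -
  interpret h: ring_hom_ring R "R Quot I" "(+>) I" by (rule rcos_ring_hom_ring)
  show "(I +> x) \<otimes>\<^bsub>R Quot I\<^esub> (I +> y) = I +> (x \<otimes> y)" "(I +> x) \<oplus>\<^bsub>R Quot I\<^esub> (I +> y) = I +> (x \<oplus> y)"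
    using assms by auto
  show "(I +> x) \<ominus>\<^bsub>R Quot I\<^esub> (I +> y) = I +> (x \<ominus> y)"
    using assms by (simp add: a_minus_def)
qed

lemma scl_hb_cancel: "scl [:0, 1:] m = scl [:0, 1:] n \<Longrightarrow> m = n"
  by (rule poly_mapping_eqI) (metis lookup_scl mult_cancel_left one_neq_zero pCons_eq_0_iff)

lemma hb_cancel: "hb * f = hb * g \<Longrightarrow> f = g"
  unfolding hb_def by (metis ap_scal ap_simps(6) endo_eqI scl_hb_cancel)

section \<open>Coordinates of polynomials and of families over W\<close>

definition exps :: "(gen \<Rightarrow>\<^sub>0 nat) \<Rightarrow> nat \<times> nat \<times> nat \<times> nat" where
  "exps \<mu> = (Poly_Mapping.lookup \<mu> (Vec 1), Poly_Mapping.lookup \<mu> (Vec 2),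
    Poly_Mapping.lookup \<mu> (Covec 1), Poly_Mapping.lookup \<mu> (Covec 2))"

fun of_exps :: "nat \<times> nat \<times> nat \<times> nat \<Rightarrow> (gen \<Rightarrow>\<^sub>0 nat)" where
  "of_exps (a, b, c, e) = Poly_Mapping.single (Vec 1) a + Poly_Mapping.single (Vec 2) b +
    Poly_Mapping.single (Covec 1) c + Poly_Mapping.single (Covec 2) e"

lemma gen_cases: "v = Vec 1 \<or> v = Vec 2 \<or> v = Covec 1 \<or> v = Covec 2"
  using exhaust_2 by (cases v) auto

lemma exps_of_exps [simp]: "exps (of_exps k) = k"
  by (cases k) (auto simp: exps_def lookup_add lookup_single)

lemma of_exps_exps [simp]: "of_exps (exps \<mu>) = \<mu>"
proof (rule poly_mapping_eqI)
  show "Poly_Mapping.lookup (of_exps (exps \<mu>)) v = Poly_Mapping.lookup \<mu> v" for v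
    using gen_cases[of v] by (auto simp: exps_def lookup_add lookup_single)
qed

lemma ordered_monomial_eq: "ordered_monomial \<mu> = mon (exps \<mu>)"
  by (simp add: ordered_monomial_def exps_def)

lemma ordered_eq: "ordered = pm_sum (\<lambda>m c. coeff_emb [:c:] * ordered_monomial m)"
  by (simp add: fun_eq_iff ordered_def pm_sum_def)

lemma ordered_add: "ordered (f + g) = ordered f + ordered g"
proof -
  have "coeff_emb [:b + c:] = coeff_emb [:b:] + coeff_emb [:c:]" for b c
    by (simp flip: coeff_emb_add)
  then show ?thesis
    unfolding ordered_eq by (intro pm_sum_add) (auto simp: distrib_right)
qed

lemma ordered_zero [simp]: "ordered 0 = 0"
  by (simp add: ordered_eq)

lemma ordered_single: "ordered (Poly_Mapping.single \<mu> c) = coeff_emb [:c:] * mon (exps \<mu>)"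
  unfolding ordered_eq by (subst pm_sum_single) (simp_all add: ordered_monomial_eq)

definition pbw_lift :: "(mat2 \<Rightarrow>\<^sub>0 cpoly) \<Rightarrow> smash" where
  "pbw_lift = pm_sum (\<lambda>w f. Poly_Mapping.single w (ordered f))"

lemma pbw_eq: "pbw d \<zeta> a F = to_H_c d \<zeta> a (pbw_lift F)"
  by (simp add: pbw_def pbw_lift_def pm_sum_def)

lemma pbw_lift_add: "pbw_lift (F + G) = pbw_lift F + pbw_lift G"
  unfolding pbw_lift_def by (rule pm_sum_add) (auto simp: ordered_add single_add)

lemma pbw_lift_zero [simp]: "pbw_lift 0 = 0"
  by (simp add: pbw_lift_def)

lemma pbw_lift_single: "pbw_lift (Poly_Mapping.single w f) = Poly_Mapping.single w (ordered f)"
  unfolding pbw_lift_def by (rule pm_sum_single) simp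

section \<open>The operator ring and its reductions\<close>

context cherednik
begin

definition "R = rho ` C"

lemma R_rho: "F \<in> C \<Longrightarrow> rho F \<in> R"
  by (simp add: R_def)

lemma R_add: "f \<in> R \<Longrightarrow> g \<in> R \<Longrightarrow> f + g \<in> R" and R_mult: "f \<in> R \<Longrightarrow> g \<in> R \<Longrightarrow> f * g \<in> R"
  and R_diff: "f \<in> R \<Longrightarrow> g \<in> R \<Longrightarrow> f - g \<in> R"
  using add_C mult_C diff_C by (auto simp: R_def simp flip: rho_add rho_mult rho_diff intro!: imageI)

lemma R_scal: "scal c \<in> R" and R_op: "op v \<in> R"
  using R_rho[OF tensor_emb_C[of "coeff_emb c"]] R_rho[OF tensor_emb_C[of "letter v"]]
  by (simp_all add: rho_tensor_emb rt_simps)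

lemma R_xyXY: "mx \<in> R" "my \<in> R" "mX \<in> R" "mY \<in> R"
  using R_op[of "Vec 1"] R_op[of "Vec 2"] R_op[of "Covec 1"] R_op[of "Covec 2"] by auto

lemma R_zero: "0 \<in> R" and R_one: "1 \<in> R" and R_hb: "hb \<in> R"
  using R_scal[of 0] R_scal[of 1] R_scal[of "[:0, 1:]"] by (simp_all add: hb_def)

lemma R_uminus: "f \<in> R \<Longrightarrow> - f \<in> R"
  using R_diff[OF R_zero, of f] by simp

lemma R_power: "f \<in> R \<Longrightarrow> f ^ n \<in> R"
  by (induction n) (auto simp: R_one R_mult)

lemma R_sum: "(\<And>i. i \<in> A \<Longrightarrow> f i \<in> R) \<Longrightarrow> (\<Sum>i\<in>A. f i) \<in> R"
  by (induction A rule: infinite_finite_induct) (auto simp: R_zero R_add)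

lemma R_mg:
  assumes "g \<in> dihW d"
  shows "mg g \<in> R"
  using R_rho[OF single_C[of "matof g" 1]] assms by (simp add: rho_single rt_simps dihedral_eq)

lemma R_S: "S f \<in> R"
  unfolding S_def by (intro R_sum R_mult R_scal R_mg) (simp add: dihW_iff)

lemma R_v0_inj: "f \<in> R \<Longrightarrow> g \<in> R \<Longrightarrow> ap f v0 = ap g v0 \<Longrightarrow> f = g"
  using ap_v0_eq_iff by (auto simp: R_def)

lemma R_MU: "f \<in> R \<Longrightarrow> ap f v0 \<in> MU"
  using PBW(1) by (auto simp: R_def)

lemma R_nf: "m \<in> MU \<Longrightarrow> rho (nf m) \<in> R"
  by (intro R_rho nf_C)

lemma R_induct [consumes 1, case_names coeff op mg add mult]:
  assumes "f \<in> R"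
    and P_coeff: "\<And>c. P (scal c)" and P_op: "\<And>v. P (op v)" and P_mg: "\<And>g. g \<in> dihW d \<Longrightarrow> P (mg g)"
    and P_add: "\<And>f g. f \<in> R \<Longrightarrow> g \<in> R \<Longrightarrow> P f \<Longrightarrow> P g \<Longrightarrow> P (f + g)"
    and P_mult: "\<And>f g. f \<in> R \<Longrightarrow> g \<in> R \<Longrightarrow> P f \<Longrightarrow> P g \<Longrightarrow> P (f * g)"
  shows "P f"
proof -
  obtain F where F: "F \<in> C" "f = rho F" using assms(1) by (auto simp: R_def)
  have rtR: "rt t \<in> R" for t using R_rho[OF tensor_emb_C[of t]] by (simp add: rho_tensor_emb)
  have rtP: "P (rt t)" for t
  proof (induction t rule: tensor_induct)
    case zero
    show ?case using P_coeff[of 0] by (simp add: rt_simps)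
  next
    case (add s t)
    then show ?case by (simp add: rt_simps P_add rtR)
  next
    case (monomial c us)
    have "P (rt (prod_list (map letter us)))"
    proof (induction us)
      case Nil
      show ?case using P_coeff[of 1] by (simp add: rt_simps)
    next
      case (Cons v us)
      then show ?case by (simp add: rt_simps P_mult P_op R_op rtR)
    qed
    then show ?case by (simp add: rt_simps P_mult P_coeff R_scal rtR)
  qed
  from F(1) have "P (rho F)"
  proof (induction F rule: C_induct)
    case zero
    show ?case using P_coeff[of 0] by simp
  next
    case (single w t)
    then show ?case by (auto simp: dihedral_eq rho_single intro!: P_mult rtR R_mg rtP P_mg)
  qed (simp add: rho_add P_add R_rho)
  then show ?thesis by (simp add: F)
qed

abbreviation "H \<equiv> H_hbar d \<zeta> a"
abbreviation "Hc \<equiv> H_c d \<zeta> a"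
abbreviation "J \<equiv> hbar_ideal d \<zeta> a"

text \<open>Inverse of the isomorphism induced by \<open>rho\<close> from the \<hbar>-algebra onto
  \<open>R\<close>. The preimage is chosen arbitrarily; its class does not depend on the choice
  because \<open>rho\<close> is faithful modulo the ideal.\<close>

definition kap1 :: "idx endo \<Rightarrow> smash set" where
  "kap1 f = to_H_hbar d \<zeta> a (inv_into C rho f)"

lemma to_H_hbar_eq_iff:
  assumes "F \<in> C" "G \<in> C"
  shows "to_H_hbar d \<zeta> a F = to_H_hbar d \<zeta> a G \<longleftrightarrow> rho F = rho G"
  using sm.quotient_eq_iff_same_a_r_cos[OF I.ideal_axioms assms] ap_v0_eq_iff(2)[OF assms]
  by (simp add: to_H_hbar_def sr_minus assms cong_I_def)

lemma inv_into_rho: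
  assumes "f \<in> R"
  shows "inv_into C rho f \<in> C" "rho (inv_into C rho f) = f"
  using assms unfolding R_def by (rule inv_into_into, rule f_inv_into_f)

lemma kap1_rho: "F \<in> C \<Longrightarrow> kap1 (rho F) = to_H_hbar d \<zeta> a F"
  unfolding kap1_def by (subst to_H_hbar_eq_iff) (simp_all add: inv_into_rho R_rho)

lemma kap1_inj: "f \<in> R \<Longrightarrow> g \<in> R \<Longrightarrow> kap1 f = kap1 g \<longleftrightarrow> f = g"
  unfolding kap1_def by (subst to_H_hbar_eq_iff) (simp_all add: inv_into_rho)

lemma carrier_H: "carrier H = kap1 ` R"
proof -
  have "carrier H = to_H_hbar d \<zeta> a ` C"
    unfolding H_hbar_def I.carrier_Quot to_H_hbar_def ..
  then show ?thesis by (auto simp: R_def kap1_rho image_image)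
qed

lemma kap1_hom:
  assumes "f \<in> R" "g \<in> R"
  shows "kap1 f \<otimes>\<^bsub>H\<^esub> kap1 g = kap1 (f * g)" "kap1 f \<oplus>\<^bsub>H\<^esub> kap1 g = kap1 (f + g)"
    "kap1 f \<ominus>\<^bsub>H\<^esub> kap1 g = kap1 (f - g)"
proof -
  obtain F G where FG: "F \<in> C" "G \<in> C" "f = rho F" "g = rho G" using assms by (auto simp: R_def)
  show "kap1 f \<otimes>\<^bsub>H\<^esub> kap1 g = kap1 (f * g)" "kap1 f \<oplus>\<^bsub>H\<^esub> kap1 g = kap1 (f + g)"
    "kap1 f \<ominus>\<^bsub>H\<^esub> kap1 g = kap1 (f - g)"
    using FG I.Quot_hom[OF FG(1,2)]
    by (simp_all add: kap1_rho mult_C add_C diff_C sr_minus flip: rho_mult rho_add rho_diff)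
       (simp_all add: H_hbar_def to_H_hbar_def)
qed

lemma H_ring: "ring H"
  unfolding H_hbar_def by (rule I.quotient_is_ring)

lemma H_zero: "\<zero>\<^bsub>H\<^esub> = kap1 0"
proof -
  interpret ring H by (rule H_ring)
  have "kap1 0 \<oplus>\<^bsub>H\<^esub> kap1 0 = kap1 0" using kap1_hom(2)[OF R_zero R_zero] by simp
  moreover have "kap1 0 \<in> carrier H" using R_zero by (simp add: carrier_H)
  ultimately show ?thesis by (metis add.l_cancel_one)
qed

lemma hbar_eq: "hbar d \<zeta> a = kap1 hb"
  unfolding hbar_def by (simp add: rho_tensor_emb rt_simps hb_def tensor_emb_C flip: kap1_rho)

lemma J_eq: "J = (\<lambda>f. kap1 (hb * f)) ` R"
proof -
  have "J = (\<lambda>h. kap1 hb \<otimes>\<^bsub>H\<^esub> h) ` kap1 ` R"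
    unfolding hbar_ideal_def hbar_eq carrier_H by blast
  also have "\<dots> = (\<lambda>f. kap1 (hb * f)) ` R"
    unfolding image_image by (rule image_cong) (simp_all add: kap1_hom R_hb)
  finally show ?thesis .
qed

text \<open>\<open>hbar_ideal\<close> is defined as a set of multiples of \<hbar>; it absorbs
  products on both sides because \<open>hb\<close> commutes with every operator.\<close>

lemma J_ideal: "ideal J H"
proof (rule idealI[OF H_ring])
  interpret ring H by (rule H_ring)
  show "subgroup J (add_monoid H)"
  proof (rule add.subgroupI)
    show "J \<subseteq> carrier H" by (auto simp: J_eq carrier_H R_mult R_hb)
    show "J \<noteq> {}" using R_zero by (auto simp: J_eq)
  next
    fix h assume "h \<in> J"
    then obtain f where f: "f \<in> R" "h = kap1 (hb * f)" by (auto simp: J_eq)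
    have "\<ominus>\<^bsub>H\<^esub> h = kap1 (hb * (- f))"
      using f by (intro minus_equality)
        (auto simp: kap1_hom R_mult R_hb R_uminus H_zero carrier_H simp flip: distrib_left)
    then show "\<ominus>\<^bsub>H\<^esub> h \<in> J" using R_uminus[OF f(1)] unfolding J_eq by (rule image_eqI)
  next
    fix h h' assume "h \<in> J" "h' \<in> J"
    then show "h \<oplus>\<^bsub>H\<^esub> h' \<in> J"
      by (auto simp: J_eq kap1_hom R_mult R_hb R_add simp flip: distrib_left)
  qed
next
  fix h x assume h: "h \<in> J" and x: "x \<in> carrier H"
  obtain f g where fg: "f \<in> R" "g \<in> R" "h = kap1 (hb * f)" "x = kap1 g"
    using h x by (auto simp: J_eq carrier_H)
  have "x \<otimes>\<^bsub>H\<^esub> h = kap1 (hb * (g * f))" "h \<otimes>\<^bsub>H\<^esub> x = kap1 (hb * (f * g))"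
    using fg by (simp_all add: kap1_hom R_mult R_hb hb_left_commute mult.assoc)
  then show "x \<otimes>\<^bsub>H\<^esub> h \<in> J" "h \<otimes>\<^bsub>H\<^esub> x \<in> J" using fg by (auto simp: J_eq R_mult)
qed

sublocale J: ideal J H by (rule J_ideal)

definition kap :: "idx endo \<Rightarrow> smash set set" where
  "kap f = mod_hbar d \<zeta> a (kap1 f)"

lemma kap_rho: "F \<in> C \<Longrightarrow> kap (rho F) = to_H_c d \<zeta> a F"
  by (simp add: kap_def to_H_c_def kap1_rho)

lemma kap_eq_iff:
  assumes "f \<in> R" "g \<in> R"
  shows "kap f = kap g \<longleftrightarrow> (\<exists>u\<in>R. f - g = hb * u)"
proof -
  have "kap f = kap g \<longleftrightarrow> kap1 (f - g) \<in> J"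
    using ring.quotient_eq_iff_same_a_r_cos[OF H_ring J_ideal, of "kap1 f" "kap1 g"] assms
    by (simp add: kap_def mod_hbar_def carrier_H kap1_hom)
  also have "\<dots> \<longleftrightarrow> (\<exists>u\<in>R. f - g = hb * u)"
    using assms by (auto simp: J_eq image_iff kap1_inj R_diff R_mult R_hb)
  finally show ?thesis .
qed

lemma carrier_Hc: "carrier Hc = kap ` R"
  unfolding H_c_def J.carrier_Quot by (simp add: carrier_H kap_def mod_hbar_def image_image)

lemma kap_hom:
  assumes "f \<in> R" "g \<in> R"
  shows "kap f \<otimes>\<^bsub>Hc\<^esub> kap g = kap (f * g)" "kap f \<oplus>\<^bsub>Hc\<^esub> kap g = kap (f + g)"
  using J.Quot_hom[of "kap1 f" "kap1 g"] assms
  by (simp_all add: H_c_def kap_def mod_hbar_def carrier_H kap1_hom)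

lemma Hc_zero: "\<zero>\<^bsub>Hc\<^esub> = kap 0"
proof -
  interpret ring Hc unfolding H_c_def by (rule J.quotient_is_ring)
  have "kap 0 \<oplus>\<^bsub>Hc\<^esub> kap 0 = kap 0" using kap_hom(2)[OF R_zero R_zero] by simp
  moreover have "kap 0 \<in> carrier Hc" using R_zero by (simp add: carrier_Hc)
  ultimately show ?thesis by (metis add.l_cancel_one)
qed

lemma scale_kap: "f \<in> R \<Longrightarrow> scale_c d \<zeta> a c (kap f) = kap (scal [:c:] * f)"
  unfolding scale_c_def
  by (simp add: kap_hom R_scal rho_tensor_emb rt_simps tensor_emb_C flip: kap_rho)

lemma qc_eq: "qc d \<zeta> a = kap (mx * my)" and Qc_eq: "Qc d \<zeta> a = kap (mX * mY)"
  by (simp_all add: qc_def Qc_def rho_tensor_emb rt_simps tensor_emb_C flip: kap_rho)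

text \<open>Describes lifts of central elements: centrality modulo \<hbar> is stated as divisibility
  of commutators, the form in which the bracket divides by \<hbar>.\<close>

definition central :: "idx endo \<Rightarrow> bool" where
  "central f \<longleftrightarrow> f \<in> R \<and> (\<forall>g\<in>R. \<exists>u\<in>R. f * g - g * f = hb * u)"

lemma Z_c_eq: "Z_c d \<zeta> a = kap ` {f. central f}"
proof -
  have "kap f \<otimes>\<^bsub>Hc\<^esub> kap g = kap g \<otimes>\<^bsub>Hc\<^esub> kap f \<longleftrightarrow> (\<exists>u\<in>R. f * g - g * f = hb * u)"
    if "f \<in> R" "g \<in> R" for f g
    using that by (simp add: kap_hom R_mult kap_eq_iff)
  then show ?thesis
    unfolding Z_c_def central_def carrier_Hc by blast
qed

lemma centralD: "central f \<Longrightarrow> f \<in> R" "central f \<Longrightarrow> g \<in> R \<Longrightarrow> \<exists>u\<in>R. f * g - g * f = hb * u"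
  by (auto simp: central_def)

lemma poisson_kap:
  assumes f: "central f" and g: "central g" and u: "u \<in> R" and fg: "f * g - g * f = hb * u"
  shows "poisson d \<zeta> a (kap f) (kap g) = kap u"
  unfolding poisson_def
proof (rule the_equality)
  have "kap1 f \<otimes>\<^bsub>H\<^esub> kap1 g \<ominus>\<^bsub>H\<^esub> kap1 g \<otimes>\<^bsub>H\<^esub> kap1 f = hbar d \<zeta> a \<otimes>\<^bsub>H\<^esub> kap1 u"
    using u fg centralD(1)[OF f] centralD(1)[OF g] by (simp add: kap1_hom R_mult hbar_eq R_hb)
  then show "\<exists>l l' u'. l \<in> carrier H \<and> l' \<in> carrier H \<and> u' \<in> carrier H \<and>
     mod_hbar d \<zeta> a l = kap f \<and> mod_hbar d \<zeta> a l' = kap g \<and>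
     l \<otimes>\<^bsub>H\<^esub> l' \<ominus>\<^bsub>H\<^esub> l' \<otimes>\<^bsub>H\<^esub> l = hbar d \<zeta> a \<otimes>\<^bsub>H\<^esub> u' \<and> kap u = mod_hbar d \<zeta> a u'"
    using centralD(1)[OF f] centralD(1)[OF g] u by (auto simp: kap_def carrier_H)
next
  fix P
  assume "\<exists>l l' u'. l \<in> carrier H \<and> l' \<in> carrier H \<and> u' \<in> carrier H \<and>
     mod_hbar d \<zeta> a l = kap f \<and> mod_hbar d \<zeta> a l' = kap g \<and>
     l \<otimes>\<^bsub>H\<^esub> l' \<ominus>\<^bsub>H\<^esub> l' \<otimes>\<^bsub>H\<^esub> l = hbar d \<zeta> a \<otimes>\<^bsub>H\<^esub> u' \<and> P = mod_hbar d \<zeta> a u'"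
  then obtain f' g' w where R': "f' \<in> R" "g' \<in> R" "w \<in> R" and eq: "kap f' = kap f" "kap g' = kap g"
    and P: "P = kap w"
    and br: "kap1 f' \<otimes>\<^bsub>H\<^esub> kap1 g' \<ominus>\<^bsub>H\<^esub> kap1 g' \<otimes>\<^bsub>H\<^esub> kap1 f' = hbar d \<zeta> a \<otimes>\<^bsub>H\<^esub> kap1 w"
    by (auto simp: carrier_H kap_def)
  have br': "f' * g' - g' * f' = hb * w"
    using br R' by (simp add: kap1_hom R_mult hbar_eq R_hb kap1_inj R_diff)
  have fR: "f \<in> R" "g \<in> R" using f g centralD by auto
  obtain p where p: "p \<in> R" "f' - f = hb * p" using eq(1) R' fR by (auto simp: kap_eq_iff)
  obtain q where q: "q \<in> R" "g' - g = hb * q" using eq(2) R' fR by (auto simp: kap_eq_iff)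
  obtain r where r: "r \<in> R" "g * p - p * g = hb * r" using centralD(2)[OF g p(1)] by blast
  obtain s where s: "s \<in> R" "f * q - q * f = hb * s" using centralD(2)[OF f q(1)] by blast
  \<comment> \<open>Changing the lifts to f + \<hbar>p and g + \<hbar>q changes [f, g] by
    \<hbar>([f, q] - [g, p] + \<hbar>[p, q]). As f and g are central modulo \<hbar>, the first two
    commutators contain another \<hbar>, with quotients s and r.\<close>
  let ?t = "s - r + (p * q - q * p)"
  have f': "f' = f + hb * p" and g': "g' = g + hb * q" using p q by (simp_all add: algebra_simps)
  have "hb * w = (f * g - g * f) + hb * ((f * q - q * f) - (g * p - p * g) + hb * (p * q - q * p))"
    unfolding br'[symmetric] f' g'
    by (simp add: algebra_simps hb_commute[symmetric, of f] hb_commute[symmetric, of g]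
      hb_commute[symmetric, of p] hb_commute[symmetric, of q] hb_left_commute[of f] hb_left_commute[of g]
      hb_left_commute[of p] hb_left_commute[of q])
  also have "\<dots> = hb * (u + hb * ?t)"
    unfolding r s fg by (simp add: algebra_simps)
  finally have "w - u = hb * ?t" using hb_cancel by fastforce
  moreover have "?t \<in> R" using r s p q by (auto intro!: R_add R_diff R_mult)
  ultimately show "P = kap u" unfolding P using R' u by (auto simp: kap_eq_iff)
qed

text \<open>PBW at \<hbar> = 0. A coordinate vector that vanishes there is divisible by \<hbar>, and
  the quotient is again the vector of an element of \<open>R\<close>.\<close>

lemma kap_eq_iff_lookup:
  assumes "f \<in> R" "g \<in> R"
  shows "kap f = kap g \<longleftrightarrow>
    (\<forall>k. poly (Poly_Mapping.lookup (ap f v0) k) 0 = poly (Poly_Mapping.lookup (ap g v0) k) 0)"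
proof
  assume "kap f = kap g"
  then obtain u where "f - g = hb * u" using assms by (auto simp: kap_eq_iff)
  then have "f = g + hb * u" by (simp add: algebra_simps)
  then show "\<forall>k. poly (Poly_Mapping.lookup (ap f v0) k) 0 = poly (Poly_Mapping.lookup (ap g v0) k) 0"
    by (simp add: lookup_add hb_def)
next
  assume *: "\<forall>k. poly (Poly_Mapping.lookup (ap f v0) k) 0 = poly (Poly_Mapping.lookup (ap g v0) k) 0"
  let ?m = "ap f v0 - ap g v0"
  define n where "n = Poly_Mapping.map (\<lambda>p. p div [:0, 1:]) ?m"
  have "[:0, 1:] dvd Poly_Mapping.lookup ?m k" for k
    using spec[OF *, of k] poly_eq_0_iff_dvd[of "Poly_Mapping.lookup ?m k" 0]
    by (simp only: lookup_minus poly_diff) simp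
  note dv = this
  have m: "?m = scl [:0, 1:] n"
  proof (intro poly_mapping_eqI)
    fix k
    have "[:0, 1:] * (Poly_Mapping.lookup ?m k div [:0, 1:]) = Poly_Mapping.lookup ?m k"
      by (rule dvd_mult_div_cancel[OF dv])
    then show "Poly_Mapping.lookup ?m k = Poly_Mapping.lookup (scl [:0, 1:] n) k"
      unfolding lookup_scl n_def Poly_Mapping.map.rep_eq when_def by (cases "Poly_Mapping.lookup ?m k = 0") auto
  qed
  have "?m \<in> MU" using assms by (intro MU_diff R_MU)
  then have n: "n \<in> MU"
    by (auto simp: MU_def n_def in_keys_iff Poly_Mapping.map.rep_eq when_def lookup_minus split: if_splits)
  have "f - g = hb * rho (nf n)"
  proof (rule R_v0_inj)
    show "ap (f - g) v0 = ap (hb * rho (nf n)) v0"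
      using m rho_nf[OF n] by (simp add: hb_def)
  qed (use assms R_nf[OF n] in \<open>auto intro: R_diff R_mult R_hb\<close>)
  then show "kap f = kap g" using assms R_nf[OF n] by (auto simp: kap_eq_iff)
qed

section \<open>The multiplication map and the truncation in coordinates\<close>

lemma pbw_lift_C:
  assumes "Poly_Mapping.keys F \<subseteq> W"
  shows "pbw_lift F \<in> C"
  using assms
  by (induction F rule: pm_induct) (auto simp: pbw_lift_single pbw_lift_add intro!: zero_C single_C add_C)

lemma lookup_pbw_lift:
  assumes "Poly_Mapping.keys F \<subseteq> W" and g: "g \<in> dihW d"
  shows "Poly_Mapping.lookup (ap (rho (pbw_lift F)) v0) (i, j, c, e, g) =
    [:Poly_Mapping.lookup (Poly_Mapping.lookup F (matof g)) (of_exps (i, j, c, e)):]"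
  using assms(1)
proof (induction F rule: pm_induct)
  case (single w f)
  obtain h where h: "h \<in> dihW d" "w = matof h" using single by (auto simp: dihedral_eq)
  have hg: "matof h = matof g \<longleftrightarrow> h = g" using h g by (simp add: matof_inject dihW_par)
  show ?case
  proof (induction f rule: pm_induct_UNIV)
    case (single \<mu> b)
    obtain i' j' c' e' where ex: "exps \<mu> = (i', j', c', e')" by (metis prod_cases4)
    have mu: "of_exps (i, j, c, e) = \<mu> \<longleftrightarrow> (i, j, c, e) = exps \<mu>"
      by (metis exps_of_exps of_exps_exps)
    have "pbw_lift (Poly_Mapping.single w (Poly_Mapping.single \<mu> b)) =
        nf (Poly_Mapping.single (i', j', c', e', h) [:b:])"
      by (simp add: pbw_lift_single ordered_single ex nf_single h del: mon.simps)
    moreover have "Poly_Mapping.single (i', j', c', e', h) [:b:] \<in> MU" using h by (simp add: MU_def)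
    ultimately have "ap (rho (pbw_lift (Poly_Mapping.single w (Poly_Mapping.single \<mu> b)))) v0 =
        Poly_Mapping.single (i', j', c', e', h) [:b:]" by (simp add: rho_nf)
    then show ?case
      using mu hg by (auto simp: lookup_single when_def h ex simp del: of_exps.simps)
  next
    case (add p q)
    show ?case unfolding single_add pbw_lift_add rho_add ap_simps lookup_add add by simp
  qed simp
qed (simp_all add: pbw_lift_add rho_add lookup_add)

lemma pbw_coeffs_exist:
  assumes "m \<in> MU"
  shows "\<exists>F. Poly_Mapping.keys F \<subseteq> W \<and> (\<forall>i j c e. \<forall>g\<in>dihW d.
    Poly_Mapping.lookup (Poly_Mapping.lookup F (matof g)) (of_exps (i, j, c, e)) =
    poly (Poly_Mapping.lookup m (i, j, c, e, g)) 0)"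
  using assms unfolding MU_def mem_Collect_eq
proof (induction m rule: pm_induct)
  case zero
  show ?case by (intro exI[of _ 0]) auto
next
  case (add m n)
  then obtain F G where
    FG: "Poly_Mapping.keys F \<subseteq> W" "\<forall>i j c e. \<forall>g\<in>dihW d.
      Poly_Mapping.lookup (Poly_Mapping.lookup F (matof g)) (of_exps (i, j, c, e)) =
      poly (Poly_Mapping.lookup m (i, j, c, e, g)) 0"
    "Poly_Mapping.keys G \<subseteq> W" "\<forall>i j c e. \<forall>g\<in>dihW d.
      Poly_Mapping.lookup (Poly_Mapping.lookup G (matof g)) (of_exps (i, j, c, e)) =
      poly (Poly_Mapping.lookup n (i, j, c, e, g)) 0" by blast
  show ?case
  proof (intro exI[of _ "F + G"] conjI allI ballI)
    show "Poly_Mapping.keys (F + G) \<subseteq> W" using FG by (intro keys_add_subset)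
    show "Poly_Mapping.lookup (Poly_Mapping.lookup (F + G) (matof g)) (of_exps (i, j, c, e)) =
      poly (Poly_Mapping.lookup (m + n) (i, j, c, e, g)) 0" if "g \<in> dihW d" for i j c e g
      using FG(2,4) that by (simp only: lookup_add poly_add)
  qed
next
  case (single k p)
  obtain i j c e h where k: "k = (i, j, c, e, h)" by (metis prod_cases5)
  have h: "h \<in> dihW d" using single k by simp
  have hg: "matof h = matof g \<longleftrightarrow> h = g" if "g \<in> dihW d" for g
    using h that by (simp add: matof_inject dihW_par)
  have mu: "of_exps x = of_exps y \<longleftrightarrow> x = y" for x y by (metis exps_of_exps)
  show ?case
    by (intro exI[of _ "Poly_Mapping.single (matof h) (Poly_Mapping.single (of_exps (i, j, c, e)) (poly p 0))"])
       (use h in \<open>auto simp: k lookup_single when_def hg mu dihedral_eq simp del: of_exps.simps\<close>)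
qed

text \<open>Every element of H_c is hit by \<open>pbw\<close> (\<open>pbw_coeffs_exist\<close>), and
  from one family only, since coordinates at \<hbar> = 0 are unique. So the description inside
  \<open>Trunc\<close> denotes.\<close>

lemma lookup_Trunc:
  assumes f: "f \<in> R"
  shows "Poly_Mapping.lookup (Trunc d \<zeta> a (kap f)) (of_exps (i, j, c, e)) =
    poly (Poly_Mapping.lookup (ap f v0) (i, j, c, e, 1)) 0"
proof -
  obtain F where F: "Poly_Mapping.keys F \<subseteq> W" and lF: "\<And>i j c e g. g \<in> dihW d \<Longrightarrow>
    Poly_Mapping.lookup (Poly_Mapping.lookup F (matof g)) (of_exps (i, j, c, e)) =
    poly (Poly_Mapping.lookup (ap f v0) (i, j, c, e, g)) 0"
    using pbw_coeffs_exist[OF R_MU[OF f]] by blast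
  have out: "Poly_Mapping.lookup m (i, j, c, e, g) = 0" if "m \<in> MU" "g \<notin> dihW d" for m i j c e g
    using that by (auto simp: MU_def simp flip: not_in_keys_iff_lookup_eq_zero)
  have iff: "pbw d \<zeta> a G = kap f \<longleftrightarrow> G = F" if G: "Poly_Mapping.keys G \<subseteq> W" for G
  proof -
    have GR: "rho (pbw_lift G) \<in> R" by (rule R_rho[OF pbw_lift_C[OF G]])
    have "pbw d \<zeta> a G = kap f \<longleftrightarrow> kap (rho (pbw_lift G)) = kap f"
      by (simp add: pbw_eq kap_rho pbw_lift_C G)
    also have "\<dots> \<longleftrightarrow> (\<forall>k. poly (Poly_Mapping.lookup (ap (rho (pbw_lift G)) v0) k) 0 =
        poly (Poly_Mapping.lookup (ap f v0) k) 0)"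
      by (rule kap_eq_iff_lookup[OF GR f])
    also have "\<dots> \<longleftrightarrow> (\<forall>i j c e. \<forall>g\<in>dihW d.
        Poly_Mapping.lookup (Poly_Mapping.lookup G (matof g)) (of_exps (i, j, c, e)) =
        Poly_Mapping.lookup (Poly_Mapping.lookup F (matof g)) (of_exps (i, j, c, e)))" (is "?l = ?r")
    proof
      assume ?l
      have "poly [:x:] 0 = x" for x :: complex by simp
      then show ?r using \<open>?l\<close> by (metis G lF lookup_pbw_lift)
    next
      assume r: ?r
      have "poly (Poly_Mapping.lookup (ap (rho (pbw_lift G)) v0) (i, j, c, e, g)) 0 =
          poly (Poly_Mapping.lookup (ap f v0) (i, j, c, e, g)) 0" for i j c e g
      proof (cases "g \<in> dihW d")
        case True
        then show ?thesis using r lF lookup_pbw_lift[OF G] by (simp del: of_exps.simps)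
      qed (use out R_MU GR f in simp)
      then show ?l by auto
    qed
    also have "\<dots> \<longleftrightarrow> G = F"
    proof
      assume *: "\<forall>i j c e. \<forall>g\<in>dihW d.
        Poly_Mapping.lookup (Poly_Mapping.lookup G (matof g)) (of_exps (i, j, c, e)) =
        Poly_Mapping.lookup (Poly_Mapping.lookup F (matof g)) (of_exps (i, j, c, e))"
      show "G = F"
      proof (rule poly_mapping_eqI)
        fix w show "Poly_Mapping.lookup G w = Poly_Mapping.lookup F w"
        proof (cases "w \<in> W")
          case True
          then obtain g where g: "g \<in> dihW d" "w = matof g" by (auto simp: dihedral_eq)
          show ?thesis
          proof (rule poly_mapping_eqI)
            fix \<mu>
            show "Poly_Mapping.lookup (Poly_Mapping.lookup G w) \<mu> = Poly_Mapping.lookup (Poly_Mapping.lookup F w) \<mu>"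
              using * g by (metis of_exps_exps prod_cases4)
          qed
        next
          case False
          then have "w \<notin> Poly_Mapping.keys G" "w \<notin> Poly_Mapping.keys F" using F G by auto
          then show ?thesis by (simp add: in_keys_iff)
        qed
      qed
    qed simp
    finally show ?thesis .
  qed
  have "(THE G. Poly_Mapping.keys G \<subseteq> W \<and> pbw d \<zeta> a G = kap f) = F"
    using F iff by (intro the_equality) auto
  then show ?thesis
    unfolding Trunc_def using lF[of 1] by (simp add: matof_one del: of_exps.simps)
qed

lemma Trunc_eqI:
  assumes "f \<in> R" "\<And>i j c e. poly (Poly_Mapping.lookup (ap f v0) (i, j, c, e, 1)) 0 =
    Poly_Mapping.lookup p (of_exps (i, j, c, e))"
  shows "Trunc d \<zeta> a (kap f) = p"
proof (rule poly_mapping_eqI)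
  fix \<mu>
  show "Poly_Mapping.lookup (Trunc d \<zeta> a (kap f)) \<mu> = Poly_Mapping.lookup p \<mu>"
    using lookup_Trunc[OF assms(1)] assms(2) by (metis of_exps_exps prod_cases4)
qed

end

section \<open>The degree filtration and injectivity of the truncation on the center\<close>

fun deg :: "idx \<Rightarrow> nat" where
  "deg (a, b, c, e, g) = a + b + c + e"

text \<open>The strict bound lets \<open>m - bas b \<in> Dl (deg b)\<close> say that m has leading
  term b, and makes \<open>Dl 0\<close> trivial.\<close>

definition Dl :: "nat \<Rightarrow> (idx \<Rightarrow>\<^sub>0 complex poly) set" where
  "Dl k = {m. Poly_Mapping.keys m \<subseteq> {b. deg b < k}}"

lemma Dl_add: "m \<in> Dl k \<Longrightarrow> n \<in> Dl k \<Longrightarrow> m + n \<in> Dl k" and Dl_diff: "m \<in> Dl k \<Longrightarrow> n \<in> Dl k \<Longrightarrow> m - n \<in> Dl k"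
  and Dl_scl: "m \<in> Dl k \<Longrightarrow> scl c m \<in> Dl k" and Dl_zero [simp]: "0 \<in> Dl k"
  by (simp_all add: Dl_def keys_add_subset keys_diff_subset keys_scl_subset)

lemma Dl_bas: "bas b \<in> Dl k \<longleftrightarrow> deg b < k"
  by (simp add: Dl_def)

lemma Dl_mono: "m \<in> Dl k \<Longrightarrow> k \<le> l \<Longrightarrow> m \<in> Dl l"
  by (auto simp: Dl_def)

lemma Dl_sum: "(\<And>i. i \<in> A \<Longrightarrow> f i \<in> Dl k) \<Longrightarrow> (\<Sum>i\<in>A. f i) \<in> Dl k"
  by (induction A rule: infinite_finite_induct) (auto intro: Dl_add)

lemma Dl_lookup: "m \<in> Dl k \<Longrightarrow> k \<le> deg b \<Longrightarrow> Poly_Mapping.lookup m b = 0"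
  by (auto simp: Dl_def simp flip: not_in_keys_iff_lookup_eq_zero)

definition raises :: "nat \<Rightarrow> idx endo \<Rightarrow> bool" where
  "raises r f \<longleftrightarrow> (\<forall>k. \<forall>m\<in>Dl k. ap f m \<in> Dl (k + r))"

lemma raisesI:
  assumes "\<And>b. ap f (bas b) \<in> Dl (Suc (deg b) + r)"
  shows "raises r f"
  unfolding raises_def
proof (intro allI ballI)
  fix k m assume m: "m \<in> Dl k"
  show "ap f m \<in> Dl (k + r)"
    unfolding Dl_def mem_Collect_eq
  proof (rule keys_ap_subset)
    show "Poly_Mapping.keys m \<subseteq> {b. deg b < k}" using m by (simp add: Dl_def)
    fix b assume "b \<in> {b. deg b < k}"
    then have "ap f (bas b) \<in> Dl (k + r)" by (intro Dl_mono[OF assms]) auto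
    then show "Poly_Mapping.keys (ap f (bas b)) \<subseteq> {b. deg b < k + r}" by (simp add: Dl_def)
  qed
qed

lemma raisesD: "raises r f \<Longrightarrow> m \<in> Dl k \<Longrightarrow> ap f m \<in> Dl (k + r)"
  by (auto simp: raises_def)

lemma raises_mx: "raises 1 mx" and raises_my: "raises 1 my"
  by (rule raisesI; simp add: split_paired_all Dl_bas)+

lemma raises_mg: "raises 0 (mg g)"
  by (rule raisesI) (cases g; simp add: split_paired_all ap_mg Dl_bas Dl_scl)

lemma raises_scal: "raises 0 (scal c)"
  by (auto simp: raises_def Dl_scl)

text \<open>Each commutator replaces x K or y K by an operator of degree 0; when K raises the degree
  by one, the corrections lie at least two degrees below the leading monomial.\<close>

lemma kop_leading:
  assumes "raises 0 cx" "raises 0 cy" "\<And>n. s n = (fst n + p, fst (snd n) + q, snd (snd n))"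
  shows "kop cx cy s a b n - bas (a, b, s n) \<in> Dl (a + b + fst n + fst (snd n))"
proof -
  obtain c e g where n: "n = (c, e, g)" by (metis prod_cases3)
  have *: "ap z k - ap cz (bas k') - bas b'' \<in> Dl (Suc r)"
    if "k - bas b' \<in> Dl r" "raises 1 z" "ap z (bas b') = bas b''" "raises 0 cz" "deg k' < Suc r"
    for z k cz k' b' b'' r
  proof -
    have "ap z (k - bas b') \<in> Dl (Suc r)" using raisesD[OF that(2,1)] by simp
    moreover have "ap cz (bas k') \<in> Dl (Suc r)"
      using raisesD[OF that(4), of "bas k'" "Suc r"] that(5) by (simp add: Dl_bas)
    ultimately have "ap z (k - bas b') - ap cz (bas k') \<in> Dl (Suc r)" by (rule Dl_diff)
    then show ?thesis using that(3) by (simp add: ap_diff algebra_simps)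
  qed
  have "kop cx cy s a b n - bas (a, b, s n) \<in> Dl (a + b + c + e)"
  proof (induction a)
    case 0
    show ?case
    proof (induction b)
      case (Suc b)
      show ?case
        using *[OF Suc raises_my _ assms(2), of "(0, Suc b, s n)" "(0, b, n)"] by (simp add: n)
    qed simp
  next
    case (Suc a)
    show ?case
      using *[OF Suc raises_mx _ assms(1), of "(Suc a, b, s n)" "(a, b, n)"] by (simp add: n)
  qed
  then show ?thesis by (simp add: n)
qed

lemma ap_lin: "ap (lin f) m = pm_sum (\<lambda>b c. scl c (f b)) m"
  by transfer simp

lemma power_leading:
  assumes "raises 1 K" "\<And>n. ap K (bas (s n)) - bas (s (Suc n)) \<in> Dl (r + Suc n)" "m - bas (s 0) \<in> Dl r"
  shows "ap (K ^ n) m - bas (s n) \<in> Dl (r + n)"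
proof (induction n)
  case (Suc n)
  have "ap K (ap (K ^ n) m - bas (s n)) \<in> Dl (r + Suc n)"
    using raisesD[OF assms(1) Suc] by simp
  from Dl_add[OF this assms(2)[of n]] show ?case by (simp add: ap_diff)
qed (use assms(3) in simp)

text \<open>Right multiplication by \<open>x\<close>, up to terms of lower degree.\<close>

fun rxb :: "idx \<Rightarrow> (idx \<Rightarrow>\<^sub>0 complex poly)" where
  "rxb (a, b, c, e, Rot u) = scl [:u:] (bas (Suc a, b, c, e, Rot u))"
| "rxb (a, b, c, e, Ref u) = scl [:inverse u:] (bas (a, Suc b, c, e, Ref u))"

lemma ap_single: "ap f (Poly_Mapping.single b c) = scl c (ap f (bas b))"
  using ap_scl[of f c "bas b"] by (simp add: scl_single)

lemma lookup_ap_mx: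
  "Poly_Mapping.lookup (ap mx m) (Suc a, b, n) = Poly_Mapping.lookup m (a, b, n)"
  "Poly_Mapping.lookup (ap mx m) (0, b, n) = 0"
proof -
  have "Poly_Mapping.lookup (ap mx m) (Suc a, b, n) = Poly_Mapping.lookup m (a, b, n) \<and>
    Poly_Mapping.lookup (ap mx m) (0, b, n) = 0"
  proof (induction m rule: pm_induct_UNIV)
    case (single k p)
    obtain a' b' n' where k: "k = (a', b', n')" by (metis prod_cases3)
    show ?case
      by (auto simp: k ap_single[where c = p] scl_single lookup_single when_def)
  qed (auto simp: ap_add lookup_add)
  then show "Poly_Mapping.lookup (ap mx m) (Suc a, b, n) = Poly_Mapping.lookup m (a, b, n)"
    "Poly_Mapping.lookup (ap mx m) (0, b, n) = 0" by auto
qed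

lemma lookup_ap_rxb:
  "Poly_Mapping.lookup (ap (lin rxb) m) (Suc a, b, c, e, Rot u) = [:u:] * Poly_Mapping.lookup m (a, b, c, e, Rot u)"
  "Poly_Mapping.lookup (ap (lin rxb) m) (a, Suc b, c, e, Ref u) = [:inverse u:] * Poly_Mapping.lookup m (a, b, c, e, Ref u)"
  "Poly_Mapping.lookup (ap (lin rxb) m) (a, 0, c, e, Ref u) = 0"
proof -
  have "Poly_Mapping.lookup (ap (lin rxb) m) (Suc a, b, c, e, Rot u) = [:u:] * Poly_Mapping.lookup m (a, b, c, e, Rot u) \<and>
    Poly_Mapping.lookup (ap (lin rxb) m) (a, Suc b, c, e, Ref u) = [:inverse u:] * Poly_Mapping.lookup m (a, b, c, e, Ref u) \<and>
    Poly_Mapping.lookup (ap (lin rxb) m) (a, 0, c, e, Ref u) = 0"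
  proof (induction m rule: pm_induct_UNIV)
    case (single k p)
    obtain a' b' c' e' g where k: "k = (a', b', c', e', g)" by (metis prod_cases5)
    show ?case
      by (cases g) (auto simp: k ap_single[where c = p] scl_single lookup_single when_def mult.commute)
  qed (auto simp: ap_add lookup_add distrib_left smult_add_right)
  then show "Poly_Mapping.lookup (ap (lin rxb) m) (Suc a, b, c, e, Rot u) = [:u:] * Poly_Mapping.lookup m (a, b, c, e, Rot u)"
    "Poly_Mapping.lookup (ap (lin rxb) m) (a, Suc b, c, e, Ref u) = [:inverse u:] * Poly_Mapping.lookup m (a, b, c, e, Ref u)"
    "Poly_Mapping.lookup (ap (lin rxb) m) (a, 0, c, e, Ref u) = 0" by auto
qed

context cherednik
begin

lemma raises_S: "raises 0 (S f)"
proof -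
  have "ap (S f) m \<in> Dl k" if "m \<in> Dl k" for m k
    unfolding S_def ap_sum_left
    by (rule Dl_sum) (use raisesD[OF raises_mg that] in \<open>simp add: Dl_scl\<close>)
  then show ?thesis by (simp add: raises_def)
qed

lemma raises_hb_As: "raises 0 (hb - As)"
  using raises_S[of "\<lambda>u. a"] raises_scal[of "[:0, 1:]"]
  by (auto simp: raises_def As_def hb_def intro!: Dl_diff)

lemma mX_leading: "ap mX (bas (i, j, c, e, g)) - bas (i, j, Suc c, e, g) \<in> Dl (i + j + c + e)"
  and mY_leading: "ap mY (bas (i, j, c, e, g)) - bas (i, j, c, Suc e, g) \<in> Dl (i + j + c + e)"
  using kop_leading[of "hb - As" Ap "\<lambda>(c, e, g). (Suc c, e, g)" 1 0 i j "(c, e, g)"]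
    kop_leading[of Am "hb - As" "\<lambda>(c, e, g). (c, Suc e, g)" 0 1 i j "(c, e, g)"]
    raises_hb_As raises_S
  by (auto simp: mX_def mY_def ap_kend Ap_def Am_def split_paired_all)

lemma raises_mX: "raises 1 mX" and raises_mY: "raises 1 mY"
proof -
  have *: "v \<in> Dl (Suc r + 1)" if "v - bas b \<in> Dl r" "deg b < Suc r + 1" for v b r
    using Dl_add[of "v - bas b" "Suc r + 1" "bas b"] that Dl_mono[OF that(1), of "Suc r + 1"]
    by (simp add: Dl_bas)
  show "raises 1 mX"
  proof (rule raisesI)
    fix k :: idx
    obtain i j c e g where k: "k = (i, j, c, e, g)" by (metis prod_cases5)
    show "ap mX (bas k) \<in> Dl (Suc (deg k) + 1)"
      using *[OF mX_leading[of i j c e g]] by (simp add: k)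
  qed
  show "raises 1 mY"
  proof (rule raisesI)
    fix k :: idx
    obtain i j c e g where k: "k = (i, j, c, e, g)" by (metis prod_cases5)
    show "ap mY (bas k) \<in> Dl (Suc (deg k) + 1)"
      using *[OF mY_leading[of i j c e g]] by (simp add: k)
  qed
qed

lemma monomial_leading:
  assumes "m - bas (i, j, 0, 0, g) \<in> Dl (i + j)"
  shows "ap (mx ^ i' * my ^ j' * mX ^ c * mY ^ e) m - bas (i + i', j + j', c, e, g) \<in> Dl (i + i' + (j + j') + c + e)"
proof -
  have 1: "ap (mY ^ e) m - bas (i, j, 0, e, g) \<in> Dl (i + j + e)"
    by (rule power_leading[OF raises_mY, where s = "\<lambda>n. (i, j, 0, n, g)"])
       (use assms Dl_mono[OF mY_leading] in auto)
  have 2: "ap (mX ^ c) (ap (mY ^ e) m) - bas (i, j, c, e, g) \<in> Dl (i + j + e + c)"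
    by (rule power_leading[OF raises_mX, where s = "\<lambda>n. (i, j, n, e, g)"])
       (use 1 Dl_mono[OF mX_leading] in auto)
  have 3: "ap (my ^ j') (ap (mX ^ c) (ap (mY ^ e) m)) - bas (i, j + j', c, e, g) \<in> Dl (i + j + e + c + j')"
    by (rule power_leading[OF raises_my, where s = "\<lambda>n. (i, j + n, c, e, g)"]) (use 2 in auto)
  have "ap (mx ^ i') (ap (my ^ j') (ap (mX ^ c) (ap (mY ^ e) m))) - bas (i + i', j + j', c, e, g) \<in>
      Dl (i + j + e + c + j' + i')"
    by (rule power_leading[OF raises_mx, where s = "\<lambda>n. (i + n, j + j', c, e, g)"]) (use 3 in auto)
  then show ?thesis by (simp add: ac_simps)
qed

text \<open>The module carries left multiplications, so the product with x on the right is read off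
  by applying the monomial to \<open>ap mx v0\<close>. Moving g past x gives the scalar and the
  letter in \<open>rxb\<close>; the other letters commute up to lower degree.\<close>

lemma right_mx_leading:
  assumes g: "g \<in> dihW d"
  shows "ap (rho (nf (bas (i, j, c, e, g)))) (ap mx v0) - rxb (i, j, c, e, g) \<in> Dl (Suc (i + j + c + e))"
proof -
  have rho: "rho (nf (bas (i, j, c, e, g))) = mx ^ i * my ^ j * mX ^ c * mY ^ e * mg g"
    using g by (simp add: nf_single rho_single rt_simps)
  show ?thesis
  proof (cases g)
    case (Rot u)
    have "ap (mg g) (ap mx v0) = scl [:u:] (bas (1, 0, 0, 0, g))"
      by (simp add: v0_def Rot ap_mg one_dih_def)
    then have "ap (rho (nf (bas (i, j, c, e, g)))) (ap mx v0) - rxb (i, j, c, e, g) =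
        scl [:u:] (ap (mx ^ i * my ^ j * mX ^ c * mY ^ e) (bas (1, 0, 0, 0, g)) - bas (1 + i, 0 + j, c, e, g))"
      by (simp add: rho ap_scl scl_diff Rot[symmetric]) (simp add: Rot)
    then show ?thesis
      using Dl_scl[OF monomial_leading[of "bas (1, 0, 0, 0, g)" 1 0 g i j c e], of "[:u:]"] by simp
  next
    case (Ref u)
    have "ap (mg g) (ap mx v0) = scl [:inverse u:] (bas (0, 1, 0, 0, g))"
      by (simp add: v0_def Ref ap_mg one_dih_def)
    then have "ap (rho (nf (bas (i, j, c, e, g)))) (ap mx v0) - rxb (i, j, c, e, g) =
        scl [:inverse u:] (ap (mx ^ i * my ^ j * mX ^ c * mY ^ e) (bas (0, 1, 0, 0, g)) - bas (0 + i, 1 + j, c, e, g))"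
      by (simp add: rho ap_scl scl_diff Ref[symmetric]) (simp add: Ref)
    then show ?thesis
      using Dl_scl[OF monomial_leading[of "bas (0, 1, 0, 0, g)" 0 1 g i j c e], of "[:inverse u:]"] by simp
  qed
qed

text \<open>A central element commutes with \<open>x\<close>; in the top degree this says \<open>f\<^sub>g (x - g(x)) = 0\<close> for
  every \<open>g\<close>, so only the component at \<open>g = 1\<close> can have maximal degree.\<close>

lemma central_eq_0:
  assumes f: "central f"
    and tr: "\<And>i j c e. poly (Poly_Mapping.lookup (ap f v0) (i, j, c, e, 1)) 0 = 0"
  shows "kap f = kap 0"
proof -
  have fR: "f \<in> R" using f by (rule centralD)
  define m where "m = ap f v0"
  define cf where "cf n k = poly (Poly_Mapping.lookup n k) 0" for n :: "idx \<Rightarrow>\<^sub>0 complex poly" and k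
  have mMU: "m \<in> MU" unfolding m_def by (rule R_MU[OF fR])
  have f_eq: "f = rho (nf m)"
    by (rule R_v0_inj[OF fR R_nf[OF mMU]]) (simp add: rho_nf[OF mMU] flip: m_def)
  obtain u where u: "f * mx - mx * f = hb * u"
    using centralD(2)[OF f] R_xyXY(1) by blast
  have "ap f (ap mx v0) = ap mx m + scl [:0, 1:] (ap u v0)"
    using arg_cong[OF u, of "\<lambda>f. ap f v0"] by (simp add: m_def hb_def algebra_simps)
  then have comm: "cf (ap f (ap mx v0)) k = cf (ap mx m) k" for k
    by (simp add: cf_def lookup_add)
  define E where "E b = ap (rho (nf (bas b))) (ap mx v0) - rxb b" for b
  have E: "E b \<in> Dl (Suc (deg b))" if "b \<in> Poly_Mapping.keys m" for b
    using that mMU right_mx_leading by (cases b) (auto simp: MU_def E_def)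
  have rho_scl: "rho (nf (scl c n)) = scal c * rho (nf n)" if "n \<in> MU" for c n
    by (simp add: rho_mult tensor_emb_C nf_C[OF that] rho_tensor_emb rt_simps flip: nf_coeff)
  have "ap (rho (nf m)) (ap mx v0) = ap (lin rxb) m + ap (lin E) m"
  proof (rule pm_additive_eqI[where p = m])
    fix k c assume "k \<in> Poly_Mapping.keys m"
    then have k: "bas k \<in> MU" using mMU by (auto simp: MU_def)
    have "ap (rho (nf (Poly_Mapping.single k c))) (ap mx v0) = scl c (ap (rho (nf (bas k))) (ap mx v0))"
      using rho_scl[OF k, of c] by (simp add: scl_single)
    then show "ap (rho (nf (Poly_Mapping.single k c))) (ap mx v0) =
        ap (lin rxb) (Poly_Mapping.single k c) + ap (lin E) (Poly_Mapping.single k c)"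
      by (simp add: ap_single[where c = c] E_def scl_diff)
  qed (simp_all add: nf_add rho_add ap_add)
  then have split: "cf (ap mx m) k = cf (ap (lin rxb) m) k + cf (ap (lin E) m) k" for k
    using comm[of k] by (simp add: f_eq[symmetric] cf_def lookup_add)
  have "cf m k = 0" for k
  proof (rule ccontr)
    assume k: "cf m k \<noteq> 0"
    \<comment> \<open>Only coefficients that survive at \<hbar> = 0 count for the maximal degree;
      \<open>m\<close> may contain higher monomials with coefficients divisible by \<hbar>.\<close>
    define D where "D = deg ` {b \<in> Poly_Mapping.keys m. cf m b \<noteq> 0}"
    have fin: "finite D" unfolding D_def by simp
    have kD: "deg k \<in> D" using k by (auto simp: D_def cf_def in_keys_iff intro!: imageI)
    define N where "N = Max D"
    have le: "deg b \<le> N" if "cf m b \<noteq> 0" for b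
    proof -
      have "deg b \<in> D" using that by (auto simp: D_def cf_def in_keys_iff intro!: imageI)
      then show ?thesis using fin by (simp add: N_def)
    qed
    have ND: "N \<in> D" unfolding N_def using fin kD by (intro Max_in) auto
    have top: "cf (ap mx m) b = cf (ap (lin rxb) m) b" if "deg b = Suc N" for b
    proof -
      have "poly (Poly_Mapping.lookup m b') 0 * poly (Poly_Mapping.lookup (E b') b) 0 = 0"
        if "b' \<in> Poly_Mapping.keys m" for b'
      proof (cases "cf m b' = 0")
        case False
        then have "Suc (deg b') \<le> deg b" using le \<open>deg b = Suc N\<close> by simp
        then show ?thesis using Dl_lookup[OF E[OF that]] by simp
      qed (simp add: cf_def)
      then have "cf (ap (lin E) m) b = 0"
        unfolding cf_def ap_lin pm_sum_def lookup_sum poly_sum lookup_scl poly_mult by (rule sum.neutral[OF ballI])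
      then show ?thesis using split[of b] by simp
    qed
    have rot: "cf m (i, j, c, e, Rot u) = 0" if "i + j + c + e = N" for i j c e u
    proof (cases "u = 1")
      case True
      then show ?thesis using tr by (simp add: cf_def m_def one_dih_def)
    next
      case False
      have "cf m (i, j, c, e, Rot u) = u * cf m (i, j, c, e, Rot u)"
        using top[of "(Suc i, j, c, e, Rot u)"] that by (simp add: cf_def lookup_ap_mx lookup_ap_rxb)
      then show ?thesis using False by simp
    qed
    \<comment> \<open>At a reflection, right multiplication by x produces a letter y. Comparing
      coefficients replaces x^i y^j by x^(i+1) y^(j-1) up to a scalar; when no y is left, the
      right-hand side has no such term.\<close>
    have ref: "cf m (i, j, c, e, Ref u) = 0" if "i + j + c + e = N" for i j c e u
      using that
    proof (induction j arbitrary: i)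
      case 0
      then show ?case
        using top[of "(Suc i, 0, c, e, Ref u)"] by (simp add: cf_def lookup_ap_mx lookup_ap_rxb)
    next
      case (Suc j)
      have "cf m (i, Suc j, c, e, Ref u) = inverse u * cf m (Suc i, j, c, e, Ref u)"
        using top[of "(Suc i, Suc j, c, e, Ref u)"] Suc.prems
        by (simp add: cf_def lookup_ap_mx lookup_ap_rxb)
      then show ?case using Suc.IH[of "Suc i"] Suc.prems by simp
    qed
    obtain b where "cf m b \<noteq> 0" "deg b = N" using ND by (auto simp: D_def)
    moreover obtain i j c e g where "b = (i, j, c, e, g)" by (metis prod_cases5)
    ultimately show False using rot ref by (cases g) auto
  qed
  then show ?thesis
    by (subst kap_eq_iff_lookup[OF fR R_zero]) (simp add: cf_def m_def)
qed

lemma central_diff: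
  assumes "central f" "central g"
  shows "central (f - g)"
  unfolding central_def
proof (intro conjI ballI)
  show "f - g \<in> R" using assms by (auto simp: central_def R_diff)
  fix h assume "h \<in> R"
  then obtain u v where uv: "u \<in> R" "f * h - h * f = hb * u" "v \<in> R" "g * h - h * g = hb * v"
    using assms by (auto simp: central_def) metis
  have "(f - g) * h - h * (f - g) = (f * h - h * f) - (g * h - h * g)"
    by (simp add: algebra_simps)
  also have "\<dots> = hb * (u - v)" by (simp only: uv right_diff_distrib)
  finally have "(f - g) * h - h * (f - g) = hb * (u - v)" .
  then show "\<exists>u\<in>R. (f - g) * h - h * (f - g) = hb * u" using uv R_diff by blast
qed

text \<open>Two candidates differ by a central element of truncation zero, which vanishes by
  \<open>central_eq_0\<close>. So exhibiting one central element with the right truncation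
  suffices.\<close>

lemma central_lift_eqI:
  assumes f: "central f" and tr: "Trunc d \<zeta> a (kap f) = p"
  shows "central_lift d \<zeta> a p = kap f"
  unfolding central_lift_def
proof (rule the_equality)
  show "kap f \<in> Z_c d \<zeta> a \<and> Trunc d \<zeta> a (kap f) = p" using f tr by (auto simp: Z_c_eq)
  fix z assume z: "z \<in> Z_c d \<zeta> a \<and> Trunc d \<zeta> a z = p"
  then obtain g where g: "central g" "z = kap g" by (auto simp: Z_c_eq)
  have R: "f \<in> R" "g \<in> R" using f g by (auto simp: central_def)
  have "kap (g - f) = kap 0"
  proof (rule central_eq_0[OF central_diff[OF g(1) f]])
    fix i j c e
    show "poly (Poly_Mapping.lookup (ap (g - f) v0) (i, j, c, e, 1)) 0 = 0"
      using lookup_Trunc[OF R(1)] lookup_Trunc[OF R(2)] z tr g(2)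
      by (simp add: lookup_minus del: of_exps.simps)
  qed
  then show "z = kap f" using R g(2) by (simp add: kap_eq_iff R_diff R_zero)
qed

end

section \<open>The symmetry exchanging consecutive reflections\<close>

text \<open>On the components of rotations, in particular at 1, this operator is diagonal with
  eigenvalue t to the weight. For t t = \<zeta> it moves each reflection to the next.\<close>

definition tau :: "complex \<Rightarrow> idx endo" where
  "tau t = lin (\<lambda>(a, b, c, e, g). scl [:t powi wgt (a, b, c, e, g):]
     (bas (a, b, c, e, case g of Rot u \<Rightarrow> Rot u | Ref u \<Rightarrow> Ref (t * t * u))))"

lemma ap_tau_Rot: "ap (tau t) (bas (a, b, c, e, Rot u)) = scl [:t powi wgt (a, b, c, e, Rot u):] (bas (a, b, c, e, Rot u))"
  and ap_tau_Ref: "ap (tau t) (bas (a, b, c, e, Ref u)) = scl [:t powi wgt (a, b, c, e, Ref u):] (bas (a, b, c, e, Ref (t * t * u)))"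
  by (simp_all add: tau_def)

lemma tau_mx: "t \<noteq> 0 \<Longrightarrow> tau t * mx = scal [:t:] * (mx * tau t)"
  and tau_my: "t \<noteq> 0 \<Longrightarrow> tau t * my = scal [:inverse t:] * (my * tau t)"
  by (rule endo_eqI_bas, simp add: tau_def split_paired_all ap_scl scl_scl power_int_add power_int_diff
        power_int_minus field_simps; fail)+

lemma tau_Ref:
  assumes "t \<noteq> 0" "u \<noteq> 0"
  shows "tau t * mg (Ref u) = mg (Ref (t * t * u)) * tau t"
proof (rule endo_eqI_bas)
  fix k :: idx
  obtain a b c e h where k: "k = (a, b, c, e, h)" by (metis prod_cases5)
  define w where "w = int a + int e - int b - int c"
  have w: "wgt (a, b, c, e, h') = w" "wgt (b, a, e, c, h') = - w" for h' by (auto simp: w_def)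
  have "t powi (- w) * u powi (- w) = (t * (t * u)) powi (- w) * t powi w"
    using assms by (simp add: power_int_mult_distrib power_int_minus field_simps)
  then show "ap (tau t * mg (Ref u)) (bas k) = ap (mg (Ref (t * t * u)) * tau t) (bas k)"
    using assms by (cases h)
      (simp_all add: k ap_mg ap_scl scl_scl ap_tau_Rot ap_tau_Ref w mult.assoc del: wgt.simps power_int_minus)
qed

lemma lookup_tau:
  assumes "t \<noteq> 0"
  shows "Poly_Mapping.lookup (ap (tau t) m) (a, b, c, e, Rot u) =
    [:t powi wgt (a, b, c, e, Rot u):] * Poly_Mapping.lookup m (a, b, c, e, Rot u)"
proof (induction m rule: pm_induct_UNIV)
  case (single k p)
  obtain a' b' c' e' g where k: "k = (a', b', c', e', g)" by (metis prod_cases5)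
  show ?case
    by (cases g) (auto simp: k ap_single[where c = p] ap_tau_Rot ap_tau_Ref scl_single lookup_single when_def mult.commute
        simp del: wgt.simps)
qed (auto simp: ap_add lookup_add distrib_left smult_add_right simp del: wgt.simps)

context cherednik
begin

text \<open>Multiplication by \<zeta> permutes \<open>U\<close>, so the shift of reflections only
  changes the coefficient function.\<close>

lemma tau_S:
  assumes "t \<noteq> 0" "t * t = \<zeta>"
  shows "tau t * S f = S (\<lambda>u. f (inverse \<zeta> * u)) * tau t"
proof -
  have "tau t * S f = (\<Sum>u\<in>U. scal [:f u:] * (mg (Ref (\<zeta> * u)) * tau t))"
    unfolding S_def sum_distrib_left
    by (rule sum.cong) (simp_all add: scal_left_commute[of "tau t"] tau_Ref assms U_nonzero)
  also have "\<dots> = (\<Sum>u\<in>U. scal [:f (inverse \<zeta> * u):] * (mg (Ref u) * tau t))"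
    by (subst sum_U_mult[OF zeta_U, symmetric]) (simp add: U_nonzero[OF zeta_U] flip: mult.assoc)
  also have "\<dots> = S (\<lambda>u. f (inverse \<zeta> * u)) * tau t"
    by (simp add: S_def sum_distrib_right mult.assoc)
  finally show ?thesis .
qed

lemma tau_A:
  assumes "t \<noteq> 0" "t * t = \<zeta>"
  shows "tau t * As = As * tau t" "tau t * Ap = scal [:inverse \<zeta>:] * (Ap * tau t)"
    "tau t * Am = scal [:\<zeta>:] * (Am * tau t)"
proof -
  have S: "S (\<lambda>u. c * f u) = scal [:c:] * S f" for c f
    by (simp add: S_def sum_distrib_left scal_assoc mult.commute)
  show "tau t * As = As * tau t" by (simp add: As_def tau_S[OF assms])
  have "S (\<lambda>u. a * (inverse \<zeta> * u)) = scal [:inverse \<zeta>:] * Ap"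
    unfolding Ap_def S[symmetric] by (rule S_cong) simp
  then show "tau t * Ap = scal [:inverse \<zeta>:] * (Ap * tau t)"
    by (simp add: Ap_def tau_S[OF assms] mult.assoc)
  have "S (\<lambda>u. a * inverse (inverse \<zeta> * u)) = scal [:\<zeta>:] * Am"
    unfolding Am_def S[symmetric] by (rule S_cong) simp
  then show "tau t * Am = scal [:\<zeta>:] * (Am * tau t)"
    by (simp add: Am_def tau_S[OF assms] mult.assoc)
qed

text \<open>Both differences commute with x and y up to the factors t and 1/t and vanish on
  monomials free of x and y, so \<open>endo_eq_0I\<close> applies again.\<close>

lemma tau_mX_mY:
  assumes t: "t \<noteq> 0" "t * t = \<zeta>"
  shows "tau t * mX = scal [:inverse t:] * (mX * tau t)" "tau t * mY = scal [:t:] * (mY * tau t)"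
proof -
  note left = scal_left hb_left scal_commute[symmetric, where f = "tau t"] scal_left_commute[where f = "tau t"]
    hb_commute[symmetric, where f = "tau t"] hb_left_commute[where f = "tau t"]
  note rels = mX_mx mX_my mY_mx mY_my tau_mx[OF t(1)] tau_my[OF t(1)] tau_A[OF t]
  note rels' = rels rels[THEN assoc_ext]
  note z = t(2)[symmetric]
  let ?T = "tau t * mX - scal [:inverse t:] * (mX * tau t)"
  have "?T * mx = scal [:t:] * mx * ?T" and "?T * my = scal [:inverse t:] * my * ?T"
    using t(1) by (simp_all add: rels' algebra_simps left scal_assoc z flip: one_pCons)
  moreover have "ap ?T (bas (0, 0, n)) = 0" for n
  proof -
    obtain c e g where n: "n = (c, e, g)" by (metis prod_cases3)
    show ?thesis using t(1)
      by (cases g) (simp_all add: n ap_tau_Rot ap_tau_Ref ap_scl scl_scl power_int_add power_int_diff power_int_minus field_simps)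
  qed
  ultimately have "?T = 0" by (rule endo_eq_0I)
  then show "tau t * mX = scal [:inverse t:] * (mX * tau t)" by simp
  let ?T = "tau t * mY - scal [:t:] * (mY * tau t)"
  have "?T * mx = scal [:t:] * mx * ?T" and "?T * my = scal [:inverse t:] * my * ?T"
    using t(1) by (simp_all add: rels' algebra_simps left scal_assoc z flip: one_pCons)
  moreover have "ap ?T (bas (0, 0, n)) = 0" for n
  proof -
    obtain c e g where n: "n = (c, e, g)" by (metis prod_cases3)
    show ?thesis using t(1)
      by (cases g) (simp_all add: n ap_tau_Rot ap_tau_Ref ap_scl scl_scl power_int_add power_int_diff power_int_minus field_simps)
  qed
  ultimately have "?T = 0" by (rule endo_eq_0I)
  then show "tau t * mY = scal [:t:] * (mY * tau t)" by simp
qed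

text \<open>If a square root s satisfies s^d = 1, then d is odd, since for even d this would say
  \<zeta>^(d/2) = 1; then -s is the root wanted.\<close>

lemma sqrt_zeta: "\<exists>t. t \<noteq> 0 \<and> t * t = \<zeta> \<and> t ^ d = -1"
proof -
  define s where "s = csqrt \<zeta>"
  have s: "s * s = \<zeta>" unfolding s_def by (metis power2_csqrt power2_eq_square)
  have s0: "s \<noteq> 0" using s U_nonzero[OF zeta_U] by auto
  have "(s ^ d)\<^sup>2 = 1"
    using s zeta_pow_d by (metis power2_eq_square power_mult_distrib)
  then have "s ^ d = 1 \<or> s ^ d = -1" by (simp add: power2_eq_1_iff)
  then show ?thesis
  proof
    assume 1: "s ^ d = 1"
    have "odd d"
    proof
      assume "even d"
      then obtain k where k: "d = 2 * k" by auto
      have "\<zeta> ^ k = s ^ d" by (simp add: k power_mult power2_eq_square s)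
      then show False using 1 prim d_pos k by (auto simp: primitive_root_of_unity_def)
    qed
    then show ?thesis using 1 s s0 by (intro exI[of _ "- s"]) auto
  qed (use s s0 in auto)
qed

text \<open>t^k = 1 implies \<zeta>^k = 1, which in this range leaves only k = d, where t^d =
  -1.\<close>

lemma sqrt_zeta_order:
  assumes "t * t = \<zeta>" "t ^ d = -1" "0 < k" "k < 2 * d"
  shows "t ^ k \<noteq> 1"
proof
  assume k: "t ^ k = 1"
  have "\<zeta> ^ k = 1" using k assms(1) by (metis mult_1 power_mult_distrib)
  then consider "k = d" | "k < d" | "d < k" "\<zeta> ^ (k - d) = 1"
    using zeta_pow_d by (metis linorder_neqE_nat less_imp_le_nat le_add_diff_inverse mult_1 power_add)
  then show False
    using assms prim k \<open>\<zeta> ^ k = 1\<close> by cases (auto simp: primitive_root_of_unity_def)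
qed

end

section \<open>Symmetrized words\<close>

text \<open>\<open>Pw u v n j\<close> is the sum of all words with \<open>n - j\<close> letters \<open>u\<close> and \<open>j\<close> letters \<open>v\<close>.\<close>

fun Pw :: "'a::ring_1 \<Rightarrow> 'a \<Rightarrow> nat \<Rightarrow> nat \<Rightarrow> 'a" where
  "Pw u v 0 0 = 1"
| "Pw u v 0 (Suc j) = 0"
| "Pw u v (Suc n) 0 = u * Pw u v n 0"
| "Pw u v (Suc n) (Suc j) = u * Pw u v n (Suc j) + v * Pw u v n j"

section \<open>Commutators with symmetrized words\<close>

definition comm :: "'a::ring_1 \<Rightarrow> 'a \<Rightarrow> 'a" where
  "comm f g = f * g - g * f"

lemma comm_mult: "comm f (g * h) = comm f g * h + g * comm f h"
  and comm_add: "comm f (g + h) = comm f g + comm f h"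
  and comm_0 [simp]: "comm f 0 = 0" and comm_1 [simp]: "comm f 1 = 0"
  by (simp_all add: comm_def algebra_simps)

lemma comm_minus: "comm f g = - comm g f"
  by (simp add: comm_def)

lemma comm_jacobi: "comm (comm f g) h = comm f (comm g h) - comm g (comm f h)"
  by (simp add: comm_def algebra_simps)

lemma Pw_eq_0: "n < j \<Longrightarrow> Pw u v n j = 0"
  by (induction u v n j rule: Pw.induct) auto

lemma Pw_0: "Pw u v n 0 = u ^ n"
  by (induction n) auto

lemma comm_power: "comm f (g ^ n) = (\<Sum>k<n. g ^ k * comm f g * g ^ (n - Suc k))"
proof (induction n)
  case (Suc n)
  have "comm f (g ^ Suc n) = comm f g * g ^ n + g * (\<Sum>k<n. g ^ k * comm f g * g ^ (n - Suc k))"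
    by (simp add: comm_mult Suc)
  also have "\<dots> = (\<Sum>k<Suc n. g ^ k * comm f g * g ^ (Suc n - Suc k))"
    by (subst sum.lessThan_Suc_shift) (simp add: sum_distrib_left mult.assoc)
  finally show ?case .
qed simp

lemma of_nat_left_commute: "f * (of_nat k * g) = of_nat k * (f * (g :: 'a::ring_1))"
  by (metis mult.assoc mult_of_nat_commute)

lemma of_nat_endo: "(of_nat k :: 'b endo) = scal [:of_nat k:]"
proof (induction k)
  case (Suc k)
  have "scal [:of_nat (Suc k):] = (scal ([:1:] + [:of_nat k:]) :: 'b endo)" by simp
  then show ?case by (simp only: scal_add Suc of_nat_Suc scal_1 flip: one_pCons)
qed simp

text \<open>One letter u is replaced by v in all possible ways; a word with j + 1 letters v arises
  once for each of them.\<close>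

lemma comm_Pw_raise:
  fixes u v T :: "idx endo"
  assumes "comm T u = - (hb * v)" "comm T v = 0"
  shows "comm T (Pw u v n j) = - (hb * (of_nat (Suc j) * Pw u v n (Suc j)))"
proof (induction n arbitrary: j)
  case 0
  show ?case by (cases j) auto
next
  case (Suc n)
  show ?case
    by (cases j)
       (simp_all add: comm_add comm_mult assms Suc algebra_simps of_nat_left_commute[of u] of_nat_left_commute[of v]
         of_nat_left_commute[of hb] hb_left_commute[of u] hb_left_commute[of v])
qed

text \<open>Here one v is replaced by u, and a word with n - j letters u arises once for each of
  them. The difference is taken in the ring, since j may exceed n.\<close>

lemma comm_Pw_lower:
  fixes u v T :: "idx endo"
  assumes "comm T u = 0" "comm T v = hb * u"
  shows "comm T (Pw u v n (Suc j)) = hb * ((of_nat n - of_nat j) * Pw u v n j)" "comm T (Pw u v n 0) = 0"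
proof -
  have "comm T (Pw u v n (Suc j)) = hb * ((of_nat n - of_nat j) * Pw u v n j) \<and> comm T (Pw u v n 0) = 0" for j
  proof (induction n arbitrary: j)
    case 0
    show ?case by (cases j) auto
  next
    case (Suc n)
    have "comm T (Pw u v n 0) = 0"
      "comm T (Pw u v n (Suc j)) = hb * ((of_nat n - of_nat j) * Pw u v n j)" for j
      using Suc[of j] by auto
    note IH = this
    have "comm T (Pw u v (Suc n) (Suc j)) = hb * ((of_nat (Suc n) - of_nat j) * Pw u v (Suc n) j)"
    proof (cases j)
      case 0
      show ?thesis unfolding 0 Pw.simps comm_add comm_mult assms IH
        by (simp add: algebra_simps of_nat_left_commute[of u] of_nat_left_commute[of hb] hb_left_commute[of u])
    next
      case (Suc i)
      show ?thesis unfolding Suc Pw.simps comm_add comm_mult assms IH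
        by (simp add: algebra_simps of_nat_left_commute[of u] of_nat_left_commute[of v]
           of_nat_left_commute[of hb] hb_left_commute[of u] hb_left_commute[of v])
    qed
    then show ?case by (simp add: comm_mult assms IH)
  qed
  then show "comm T (Pw u v n (Suc j)) = hb * ((of_nat n - of_nat j) * Pw u v n j)" "comm T (Pw u v n 0) = 0"
    by auto
qed

lemma comm_Pw_weight:
  fixes u v T :: "idx endo"
  assumes "comm T u = - (hb * u)" "comm T v = hb * v"
  shows "comm T (Pw u v n j) = hb * ((of_nat j + of_nat j - of_nat n) * Pw u v n j)"
proof (induction n arbitrary: j)
  case 0
  show ?case by (cases j) auto
next
  case (Suc n)
  show ?case
    by (cases j)
       (simp_all add: comm_add comm_mult assms Suc algebra_simps of_nat_left_commute[of u] of_nat_left_commute[of v]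
         of_nat_left_commute[of hb] hb_left_commute[of u] hb_left_commute[of v])
qed

lemma Pw_conj:
  fixes \<sigma> :: "idx endo"
  assumes "\<sigma> * u = scal [:s:] * (u * \<sigma>)" "\<sigma> * v = scal [:s:] * (v * \<sigma>)"
  shows "\<sigma> * Pw u v n j = scal [:s ^ n:] * (Pw u v n j * \<sigma>)"
proof (induction n arbitrary: j)
  case 0
  show ?case by (cases j) (auto simp flip: one_pCons)
next
  case (Suc n)
  have "\<sigma> * (w * f) = scal [:s * r:] * (w * f * \<sigma>)"
    if "\<sigma> * w = scal [:s:] * (w * \<sigma>)" "\<sigma> * f = scal [:r:] * (f * \<sigma>)" for w f r
  proof -
    have "\<sigma> * (w * f) = scal [:s:] * (w * (\<sigma> * f))" using that(1) by (simp flip: mult.assoc)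
    also have "\<dots> = scal [:s:] * (scal [:r:] * (w * (f * \<sigma>)))" unfolding that(2) scal_left_commute[of w] ..
    finally show ?thesis by (simp add: scal_assoc mult.assoc mult.commute)
  qed
  note * = this[OF assms(1) Suc] this[OF assms(2) Suc]
  show ?case by (cases j) (simp_all add: * distrib_left distrib_right)
qed

text \<open>In the top degree u and v commute, so all n choose j words have the same leading
  monomial \<open>s (n - j) j\<close>.\<close>

lemma Pw_leading:
  assumes u: "raises 1 u" and v: "raises 1 v"
    and us: "\<And>i j. ap u (bas (s i j)) - bas (s (Suc i) j) \<in> Dl (i + j)"
    and vs: "\<And>i j. ap v (bas (s i j)) - bas (s i (Suc j)) \<in> Dl (i + j)"
    and s0: "s 0 0 = (0, 0, 0, 0, 1)"
  shows "ap (Pw u v n j) v0 - scl [:of_nat (n choose j):] (bas (s (n - j) j)) \<in> Dl n"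
proof (induction n arbitrary: j)
  case 0
  show ?case by (cases j) (auto simp: v0_def s0 simp flip: one_pCons)
next
  case (Suc n)
  have step: "ap z m - scl c (bas k') \<in> Dl (Suc n)"
    if "raises 1 z" "m - scl c (bas k) \<in> Dl n" "c = 0 \<or> ap z (bas k) - bas k' \<in> Dl n" for z m c k k'
  proof -
    have "ap z m - scl c (bas k') = ap z (m - scl c (bas k)) + scl c (ap z (bas k) - bas k')"
      by (simp add: ap_diff ap_scl scl_diff)
    moreover have "ap z (m - scl c (bas k)) \<in> Dl (Suc n)" using raisesD[OF that(1,2)] by simp
    moreover have "scl c (ap z (bas k) - bas k') \<in> Dl (Suc n)"
      using that(3) Dl_scl[of _ "Suc n" c] Dl_mono[of _ n "Suc n"] by auto
    ultimately show ?thesis by (simp add: Dl_add)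
  qed
  show ?case
  proof (cases j)
    case 0
    show ?thesis using step[OF u Suc[of 0], of "s (Suc n) 0"] us[of n 0] by (simp add: 0)
  next
    case (Suc i)
    have 1: "ap u (ap (Pw u v n (Suc i)) v0) - scl [:of_nat (n choose Suc i):] (bas (s (n - i) (Suc i))) \<in> Dl (Suc n)"
    proof (rule step[OF u Suc.IH])
      \<comment> \<open>For Suc i > n the truncated difference n - Suc i gives the wrong index, but
        then the coefficient is zero.\<close>
      show "[:of_nat (n choose Suc i):] = 0 \<or> ap u (bas (s (n - Suc i) (Suc i))) - bas (s (n - i) (Suc i)) \<in> Dl n"
        using us[of "n - Suc i" "Suc i"] by (cases "Suc i \<le> n") (auto simp: binomial_eq_0 Suc_diff_le[symmetric])
    qed
    have 2: "ap v (ap (Pw u v n i) v0) - scl [:of_nat (n choose i):] (bas (s (n - i) (Suc i))) \<in> Dl (Suc n)"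
    proof (rule step[OF v Suc.IH])
      show "[:of_nat (n choose i):] = 0 \<or> ap v (bas (s (n - i) i)) - bas (s (n - i) (Suc i)) \<in> Dl n"
        using vs[of "n - i" i] by (cases "i \<le> n") (auto simp: binomial_eq_0)
    qed
    have "[:of_nat (Suc n choose Suc i):] = [:of_nat (n choose i):] + [:of_nat (n choose Suc i) :: complex:]" by simp
    then show ?thesis
      using Dl_add[OF 1 2] unfolding Suc Pw.simps by (simp only: scl_add_left ap_simps diff_Suc_Suc) (simp add: algebra_simps)
  qed
qed

section \<open>The distinguished central elements\<close>

context cherednik
begin

lemma central_scal:
  assumes "central f"
  shows "central (scal c * f)"
  unfolding central_def
proof (intro conjI ballI)
  show "scal c * f \<in> R" using assms by (simp add: central_def R_mult R_scal)
  fix g assume "g \<in> R"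
  then obtain u where u: "u \<in> R" "f * g - g * f = hb * u" using centralD(2)[OF assms] by blast
  have "scal c * f * g - g * (scal c * f) = scal c * (f * g - g * f)"
    by (simp add: scal_left_commute[of g] mult.assoc right_diff_distrib)
  also have "\<dots> = hb * (scal c * u)" unfolding u(2) by (rule hb_left_commute)
  finally show "\<exists>u\<in>R. scal c * f * g - g * (scal c * f) = hb * u" using u(1) R_mult R_scal by blast
qed

text \<open>Divisibility of commutators passes to sums and, by the Leibniz rule, to products, so
  generators suffice. With W exact commutation is asked for, as the elements in question are
  W-invariant.\<close>

lemma centralI:
  assumes f: "f \<in> R" and op: "\<And>v. \<exists>u\<in>R. comm f (op v) = hb * u"
    and mg: "\<And>g. g \<in> dihW d \<Longrightarrow> comm f (mg g) = 0"
  shows "central f"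
proof -
  have "\<exists>u\<in>R. comm f g = hb * u" if "g \<in> R" for g
    using that
  proof (induction g rule: R_induct)
    case (coeff c)
    have "comm f (scal c) = hb * 0" by (simp add: comm_def scal_commute)
    then show ?case using R_zero by blast
  next
    case (mg g)
    then show ?case using assms(3) R_zero by force
  next
    case (add g h)
    then obtain u v where "u \<in> R" "comm f g = hb * u" "v \<in> R" "comm f h = hb * v" by blast
    then have "u + v \<in> R" "comm f (g + h) = hb * (u + v)" by (simp_all add: comm_add distrib_left R_add)
    then show ?case by blast
  next
    case (mult g h)
    then obtain u v where uv: "u \<in> R" "comm f g = hb * u" "v \<in> R" "comm f h = hb * v" by blast
    then have "u * h + g * v \<in> R" "comm f (g * h) = hb * (u * h + g * v)"
      using mult.hyps by (simp_all add: comm_mult distrib_left R_add R_mult mult.assoc hb_left_commute[of g])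
    then show ?case by blast
  qed (rule op)
  then show ?thesis using f by (auto simp: central_def comm_def)
qed

text \<open>Jacobi identity and absence of \<open>\<hbar>\<close>-torsion.\<close>

lemma central_bracket:
  assumes f: "central f" and g: "central g" and u: "u \<in> R" "comm f g = hb * u"
  shows "central u"
  unfolding central_def
proof (intro conjI ballI)
  show "u \<in> R" by fact
  fix h assume h: "h \<in> R"
  obtain p where p: "p \<in> R" "comm f h = hb * p" using centralD(2)[OF f h] by (auto simp: comm_def)
  obtain r where r: "r \<in> R" "comm g h = hb * r" using centralD(2)[OF g h] by (auto simp: comm_def)
  obtain s where s: "s \<in> R" "comm f r = hb * s" using centralD(2)[OF f r(1)] by (auto simp: comm_def)
  obtain t where t: "t \<in> R" "comm g p = hb * t" using centralD(2)[OF g p(1)] by (auto simp: comm_def)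
  have hbl: "comm k (hb * z) = hb * comm k z" "comm (hb * k) z = hb * comm k z" for k z
    unfolding comm_def by (simp_all add: hb_left_commute[of k] hb_left_commute[of z] right_diff_distrib mult.assoc)
  have "hb * comm u h = comm (comm f g) h" unfolding u(2) hbl ..
  also have "\<dots> = hb * (hb * (s - t))" unfolding comm_jacobi p r hbl s t by (simp add: right_diff_distrib)
  finally have "comm u h = hb * (s - t)" by (rule hb_cancel)
  then show "\<exists>w\<in>R. u * h - h * u = hb * w" using s t R_diff by (auto simp: comm_def)
qed

definition "qq = mx * my"
definition "QQ = mX * mY"
text \<open>Chosen so that [q, Q] is exactly \<hbar> times \<open>ee\<close>; the term -\<hbar>
  comes from ordering the commutator, and modulo \<hbar> the explicit formula for eu
  remains.\<close>

definition "ee = mx * mX + my * mY - hb + As"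

lemmas rels = mX_mx mX_my mY_mx mY_my A_mx_my A_mX_mY mx_my[symmetric] mX_mY[symmetric]
lemmas rels_ext = rels rels[THEN assoc_ext]

lemma comm_qq: "comm qq mx = 0" "comm qq my = 0" "comm qq mX = hb * my" "comm qq mY = hb * mx"
  unfolding qq_def comm_def by (simp_all add: rels_ext algebra_simps hb_left)

lemma comm_QQ: "comm QQ mX = 0" "comm QQ mY = 0" "comm QQ mx = - (hb * mY)" "comm QQ my = - (hb * mX)"
  unfolding QQ_def comm_def by (simp_all add: rels_ext algebra_simps hb_left)

lemma comm_ee: "comm ee mx = - (hb * mx)" "comm ee my = - (hb * my)" "comm ee mX = hb * mX" "comm ee mY = hb * mY"
  unfolding ee_def comm_def by (simp_all add: rels_ext algebra_simps hb_left)

lemma comm_qq_QQ: "comm qq QQ = hb * ee"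
  unfolding qq_def QQ_def ee_def comm_def by (simp add: rels_ext algebra_simps hb_left)

lemma ee_R: "ee \<in> R"
  unfolding ee_def As_def by (intro R_add R_diff R_mult R_xyXY R_hb R_S)

lemma comm_op:
  assumes "\<exists>u\<in>R. comm f mx = hb * u" "\<exists>u\<in>R. comm f my = hb * u" "\<exists>u\<in>R. comm f mX = hb * u" "\<exists>u\<in>R. comm f mY = hb * u"
  shows "\<exists>u\<in>R. comm f (op v) = hb * u"
  using assms gen_cases[of v] by auto

lemma central_qq: "central qq"
proof (rule centralI)
  show "qq \<in> R" unfolding qq_def by (intro R_mult R_xyXY)
  show "\<exists>u\<in>R. comm qq (op v) = hb * u" for v
    by (rule comm_op) (use comm_qq R_zero R_xyXY in \<open>auto intro: bexI[of _ 0]\<close>)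
  show "comm qq (mg g) = 0" if "g \<in> dihW d" for g
  proof (cases g)
    case (Rot u)
    then have u: "u \<noteq> 0" using dihW_par[OF that] by simp
    note r = mg_Rot_mx[OF u] mg_Rot_my[OF u]
    show ?thesis using u unfolding comm_def qq_def Rot
      by (simp add: r r[THEN assoc_ext] mult.assoc scal_left scal_assoc flip: one_pCons)
  next
    case (Ref u)
    then have u: "u \<noteq> 0" using dihW_par[OF that] by simp
    note r = mg_Ref_mx[OF u] mg_Ref_my[OF u] rels
    show ?thesis using u unfolding comm_def qq_def Ref
      by (simp add: r r[THEN assoc_ext] mult.assoc scal_left scal_assoc flip: one_pCons)
  qed
qed

lemma central_QQ: "central QQ"
proof (rule centralI)
  show "QQ \<in> R" unfolding QQ_def by (intro R_mult R_xyXY)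
  show "\<exists>u\<in>R. comm QQ (op v) = hb * u" for v
    by (rule comm_op)
      (use comm_QQ R_zero R_uminus R_xyXY in \<open>auto intro: bexI[of _ 0] bexI[of _ "- mX"] bexI[of _ "- mY"]\<close>)
  show "comm QQ (mg g) = 0" if g: "g \<in> dihW d" for g
  proof (cases g)
    case (Rot u)
    then have u: "u \<noteq> 0" using dihW_par[OF g] by simp
    note r = mg_op[OF g, of "Covec 1"] mg_op[OF g, of "Covec 2"]
    have "mg g * mX = scal [:inverse u:] * (mX * mg g)" "mg g * mY = scal [:u:] * (mY * mg g)"
      using r by (simp_all add: Rot)
    note r = this
    show ?thesis using u unfolding comm_def QQ_def
      by (simp add: r r[THEN assoc_ext] mult.assoc scal_left scal_assoc flip: one_pCons)
  next
    case (Ref u)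
    then have u: "u \<in> U" "u \<noteq> 0" using g dihW_par[OF g] by (auto simp: dihW_iff)
    note r = mg_Ref_mX[OF u(1)] mg_Ref_mY[OF u(1)] rels
    show ?thesis using u unfolding comm_def QQ_def Ref
      by (simp add: r r[THEN assoc_ext] mult.assoc scal_left scal_assoc flip: one_pCons)
  qed
qed

lemma central_ee: "central ee"
  by (rule central_bracket[OF central_qq central_QQ ee_R comm_qq_QQ])

section \<open>The invariant x^d + y^d\<close>

lemma S_mx_power: "S f * mx ^ n = my ^ n * S (\<lambda>u. f u * inverse u ^ n)"
proof (induction n arbitrary: f)
  case (Suc n)
  have "S f * mx ^ Suc n = my * (S (\<lambda>u. f u * inverse u) * mx ^ n)"
    by (simp add: S_mx flip: mult.assoc)
  then show ?case by (simp add: Suc mult.assoc)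
qed simp

lemma S_my_power: "S f * my ^ n = mx ^ n * S (\<lambda>u. f u * u ^ n)"
proof (induction n arbitrary: f)
  case (Suc n)
  have "S f * my ^ Suc n = mx * (S (\<lambda>u. f u * u) * my ^ n)"
    by (simp add: S_my flip: mult.assoc)
  then show ?case by (simp add: Suc mult.assoc)
qed simp

lemma mx_my_power: "my ^ j * mx ^ i = mx ^ i * my ^ j"
  by (metis mx_my power_commuting_commutes)

text \<open>Each sum over \<open>W\<close> in \<open>[X, x\<^sup>d]\<close> is cancelled by one in \<open>[X, y\<^sup>d]\<close>, because \<open>u\<^sup>d = 1\<close>.\<close>

lemma central_powers: "central (mx ^ d + my ^ d)"
proof (rule centralI)
  let ?A = "mx ^ d + my ^ d"
  show "?A \<in> R" by (intro R_add R_power R_xyXY)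
  define D where "D = (\<Sum>k<d. mx ^ k * mx ^ (d - Suc k))"
  have DR: "D \<in> R" unfolding D_def by (intro R_sum R_mult R_power R_xyXY)
  have mg: "comm ?A (mg g) = 0" if "g \<in> dihW d" for g
  proof -
    have "mg g * ?A = ?A * mg g"
    proof (cases g)
      case (Rot u)
      then have u: "u \<noteq> 0" "u ^ d = 1" using dihW_par[OF that] that by (auto simp: dihW_def)
      have "mg (Rot u) * mx ^ n = scal [:u ^ n:] * (mx ^ n * mg (Rot u))"
        "mg (Rot u) * my ^ n = scal [:inverse u ^ n:] * (my ^ n * mg (Rot u))" for n
        using Pw_conj[of "mg (Rot u)" mx u 0 n 0] Pw_conj[of "mg (Rot u)" my "inverse u" 0 n 0] u(1)
        by (simp_all add: Pw_0 mg_Rot_mx mg_Rot_my)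
      then show ?thesis using u by (simp add: Rot distrib_left distrib_right power_inverse flip: one_pCons)
    next
      case (Ref u)
      then have u: "u \<noteq> 0" "u ^ d = 1" using dihW_par[OF that] that by (auto simp: dihW_def)
      have *: "mg (Ref u) * mx ^ n = scal [:inverse u ^ n:] * (my ^ n * mg (Ref u)) \<and>
        mg (Ref u) * my ^ n = scal [:u ^ n:] * (mx ^ n * mg (Ref u))" for n
      proof (induction n)
        case (Suc n)
        have "mg (Ref u) * mx ^ Suc n = scal [:inverse u:] * (my * (mg (Ref u) * mx ^ n))"
          "mg (Ref u) * my ^ Suc n = scal [:u:] * (mx * (mg (Ref u) * my ^ n))"
          by (simp_all add: mg_Ref_mx mg_Ref_my u(1) flip: mult.assoc)
        then show ?case using Suc by (simp add: scal_left scal_assoc mult.assoc mult.commute)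
      qed (simp flip: one_pCons)
      show ?thesis using *[of d] u
        by (simp add: Ref distrib_left distrib_right power_inverse add.commute flip: one_pCons)
    qed
    then show ?thesis by (simp add: comm_def)
  qed
  then show "comm ?A (mg g) = 0" if "g \<in> dihW d" for g using that .
  have 1: "comm mX mx = As - hb" "comm mX my = - Ap"
    by (simp_all add: comm_def mX_mx mX_my)
  have eq: "(\<Sum>k<d. mx ^ k * As * mx ^ (d - Suc k)) = (\<Sum>k<d. my ^ k * Ap * my ^ (d - Suc k))"
  proof -
    \<comment> \<open>Reversing the sum pairs x^k \<open>As\<close> x^(d-1-k) with y^(d-1-k)
      \<open>Ap\<close> y^k. Moving the reflections to the right gives x^k y^(d-1-k) in both, with
      coefficients a u^(-(d-1-k)) and a u^(k+1), equal since u^d = 1.\<close>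
    have "(\<Sum>k<d. my ^ k * Ap * my ^ (d - Suc k)) =
        (\<Sum>k<d. my ^ (d - Suc k) * Ap * my ^ (d - Suc (d - Suc k)))"
      by (rule sum.nat_diff_reindex[symmetric])
    also have "\<dots> = (\<Sum>k<d. mx ^ k * As * mx ^ (d - Suc k))"
    proof (rule sum.cong[OF refl])
      fix k assume "k \<in> {..<d}"
      then have k: "d - Suc (d - Suc k) = k" "k + Suc (d - Suc k) = d" by auto
      have "S (\<lambda>u. a * u * u ^ k) = S (\<lambda>u. a * inverse u ^ (d - Suc k))"
      proof (rule S_cong)
        fix u assume u: "u \<in> U"
        have "u ^ (k + 1) * u ^ (d - Suc k) = 1"
          using u k(2) by (simp add: U_def flip: power_add power_Suc)
        then have "u ^ (k + 1) = inverse u ^ (d - Suc k)"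
          by (simp add: inverse_unique[symmetric] power_inverse mult.commute)
        then show "a * u * u ^ k = a * inverse u ^ (d - Suc k)" by simp
      qed
      then show "my ^ (d - Suc k) * Ap * my ^ (d - Suc (d - Suc k)) = mx ^ k * As * mx ^ (d - Suc k)"
        unfolding k(1) mult.assoc Ap_def As_def S_my_power S_mx_power
        by (simp add: mx_my_power flip: mult.assoc)
    qed
    finally show ?thesis ..
  qed
  have "comm mX ?A = (\<Sum>k<d. mx ^ k * (As - hb) * mx ^ (d - Suc k)) + (\<Sum>k<d. my ^ k * (- Ap) * my ^ (d - Suc k))"
    by (simp only: comm_add comm_power 1)
  also have "\<dots> = (\<Sum>k<d. mx ^ k * As * mx ^ (d - Suc k)) - hb * D - (\<Sum>k<d. my ^ k * Ap * my ^ (d - Suc k))"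
    by (simp add: D_def algebra_simps sum_subtractf sum_negf sum_distrib_left hb_left_commute[of "mx ^ _"]
        sum.distrib)
  also have "\<dots> = - (hb * D)" by (simp add: eq)
  finally have X: "comm ?A mX = hb * D" by (subst comm_minus) simp
  have r1: "Ref 1 \<in> dihW d" by (simp add: dihW_iff U_one)
  let ?r = "mg (Ref 1)"
  have rr: "?r * ?r = 1" by (simp add: mg_one flip: mg_mult one_dih_def)
  have "?r * mX = mY * ?r" using mg_Ref_mX[OF U_one] by (simp flip: one_pCons)
  \<comment> \<open>Conjugation by \<open>Ref 1\<close> exchanges X and Y and fixes x^d + y^d, so
    the commutator with Y follows from the one with X.\<close>
  then have Y: "mY = ?r * mX * ?r" by (simp add: mult.assoc rr)
  have "comm ?A mY = ?r * comm ?A mX * ?r"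
    unfolding Y comm_mult mg[OF r1] by (simp add: mult.assoc)
  also have "\<dots> = hb * (?r * D * ?r)" unfolding X by (simp add: mult.assoc hb_left_commute[of ?r])
  finally have Y: "comm ?A mY = hb * (?r * D * ?r)" .
  have "comm ?A mx = 0" "comm ?A my = 0"
    using mx_my_power[of d 1] mx_my_power[of 1 d]
    by (simp_all add: comm_def algebra_simps power_commutes)
  then show "\<exists>u\<in>R. comm ?A (op v) = hb * u" for v
    by (intro comm_op) (use X Y DR R_zero R_mult R_mg[OF r1] in \<open>auto intro: bexI[of _ 0]\<close>)
qed

text \<open>Dividing by the number of words makes both leading coefficients equal to 1.\<close>

definition A :: "nat \<Rightarrow> idx endo" where
  "A j = scal [:1 / of_nat (d choose j):] * (Pw mx mY d j + Pw my mX d j)"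

lemma Pw_R: "u \<in> R \<Longrightarrow> v \<in> R \<Longrightarrow> Pw u v n j \<in> R"
  by (induction u v n j rule: Pw.induct) (auto intro: R_one R_zero R_add R_mult)

lemma A_R: "A j \<in> R"
  unfolding A_def by (intro R_mult R_scal R_add Pw_R R_xyXY)

lemma comm_scal: "comm f (scal c * g) = scal c * comm f g"
  by (simp add: comm_def scal_left_commute[of f] mult.assoc right_diff_distrib)

text \<open>Reconciles the counting factors j + 1 and d - j of the word sums with the normalizations
  of neighbouring \<open>A\<close>, through (j+1) (d choose j+1) = (d-j) (d choose j).\<close>

lemma choose_step:
  assumes "j < d"
  shows "of_nat (Suc j) / of_nat (d choose j) = (of_nat d - of_nat j) / (of_nat (d choose Suc j) :: complex)"
proof -
  have "Suc j * (d choose Suc j) = (d - j) * (d choose j)"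
    by (simp only: binomial_absorption binomial_absorb_comp)
  then have "of_nat (Suc j) * of_nat (d choose Suc j) = (of_nat d - of_nat j) * (of_nat (d choose j) :: complex)"
    using assms by (metis of_nat_diff of_nat_mult less_imp_le_nat)
  moreover have "of_nat (d choose Suc j) \<noteq> (0::complex)" "of_nat (d choose j) \<noteq> (0::complex)"
    using assms by auto
  ultimately show ?thesis by (subst frac_eq_eq)
qed

lemma scal_minus: "scal (- c) = - scal c"
  by (rule endo_eqI, rule poly_mapping_eqI) simp

lemma scal_diff: "scal (p - q) = scal p - scal q"
  by (metis add_diff_cancel_right' diff_add_cancel scal_add)

lemma comm_QQ_A:
  assumes "j \<le> d"
  shows "comm QQ (A j) = hb * (if j < d then scal [:of_nat j - of_nat d:] * A (Suc j) else 0)"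
proof -
  have "comm QQ (A j) = - (hb * (scal [:of_nat (Suc j) / of_nat (d choose j):] * (Pw mx mY d (Suc j) + Pw my mX d (Suc j))))"
    unfolding A_def comm_scal comm_add comm_Pw_raise[OF comm_QQ(3,2)] comm_Pw_raise[OF comm_QQ(4,1)] of_nat_endo
    by (simp add: scal_left scal_assoc distrib_left right_diff_distrib)
  also have "\<dots> = hb * (if j < d then scal [:of_nat j - of_nat d:] * A (Suc j) else 0)"
  proof (cases "j < d")
    case True
    have "scal [:of_nat j - of_nat d:] * A (Suc j) =
        scal (- [:(of_nat d - of_nat j) / of_nat (d choose Suc j):]) * (Pw mx mY d (Suc j) + Pw my mX d (Suc j))"
      by (simp add: A_def scal_assoc minus_divide_left)
    then show ?thesis
      using True by (simp only: choose_step scal_minus if_True mult_minus_left mult_minus_right)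
  \<comment> \<open>For j = d there is no word of length d with d + 1 letters Y or X; this is the
    convention a_(d+1) = 0.\<close>
  qed (simp add: Pw_eq_0)
  finally show ?thesis .
qed

lemma comm_qq_A:
  "comm qq (A 0) = 0" "j < d \<Longrightarrow> comm qq (A (Suc j)) = hb * (scal [:of_nat (Suc j):] * A j)"
proof -
  show "comm qq (A 0) = 0"
    unfolding A_def comm_scal comm_add
    by (simp add: comm_Pw_lower(2)[OF comm_qq(1,4)] comm_Pw_lower(2)[OF comm_qq(2,3)])
  assume j: "j < d"
  have diff: "of_nat d - of_nat j = (scal [:of_nat d - of_nat j:] :: idx endo)"
    by (simp add: of_nat_endo flip: scal_diff)
  show "comm qq (A (Suc j)) = hb * (scal [:of_nat (Suc j):] * A j)"
    unfolding A_def comm_scal comm_add comm_Pw_lower(1)[OF comm_qq(1,4)] comm_Pw_lower(1)[OF comm_qq(2,3)] diff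
    using choose_step[OF j] by (simp add: scal_left scal_assoc distrib_left[symmetric])
qed

lemma comm_ee_A: "comm ee (A j) = hb * (scal [:2 * of_nat j - of_nat d:] * A j)"
proof -
  have "of_nat j + of_nat j - of_nat d = (scal [:2 * of_nat j - of_nat d:] :: idx endo)"
    by (simp add: of_nat_endo flip: scal_diff scal_add)
  note * = this
  show ?thesis
    unfolding A_def comm_scal comm_add comm_Pw_weight[OF comm_ee(1,4)] comm_Pw_weight[OF comm_ee(2,3)] *
    by (simp add: scal_left scal_assoc distrib_left[symmetric] mult.commute)
qed

text \<open>Bracketing \<open>A j\<close> with Q gives (j - d) \<open>A (Suc j)\<close>, and the
  factor is invertible as long as j < d.\<close>

lemma central_A: "j \<le> d \<Longrightarrow> central (A j)"
proof (induction j)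
  case 0
  show ?case using central_powers by (simp add: A_def Pw_0 flip: one_pCons)
next
  case (Suc j)
  let ?c = "of_nat j - of_nat d :: complex"
  have c: "?c \<noteq> 0" using Suc by simp
  have "central (scal [:?c:] * A (Suc j))"
  proof (rule central_bracket[OF central_QQ])
    show "central (A j)" using Suc by simp
    show "scal [:?c:] * A (Suc j) \<in> R" by (intro R_mult R_scal A_R)
    show "comm QQ (A j) = hb * (scal [:?c:] * A (Suc j))" using comm_QQ_A[of j] Suc by simp
  qed
  from central_scal[OF this, of "[:inverse ?c:]"] show ?case
    using c by (simp add: scal_assoc flip: one_pCons)
qed

end

section \<open>Truncations and the bracket relations\<close>

lemma of_exps_inject: "of_exps x = of_exps y \<longleftrightarrow> x = y"
  by (metis exps_of_exps)

lemma var_power: "var v ^ n = Poly_Mapping.single (Poly_Mapping.single v n) 1"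
proof (induction n)
  case (Suc n)
  then show ?case by (simp add: var_def mult_single flip: single_add)
qed simp

lemma var_monomial:
  "vx ^ i * vY ^ j = Poly_Mapping.single (of_exps (i, 0, 0, j)) 1"
  "vy ^ i * vX ^ j = Poly_Mapping.single (of_exps (0, i, j, 0)) 1"
  "vx ^ i * vX ^ j = Poly_Mapping.single (of_exps (i, 0, j, 0)) 1"
  "vy ^ i * vY ^ j = Poly_Mapping.single (of_exps (0, i, 0, j)) 1"
  by (simp_all add: var_power mult_single)

context cherednik
begin

text \<open>A component of lower degree at \<open>1 \<in> W\<close> would have the wrong eigenvalue under \<open>tau t\<close>,
  as \<open>t\<close> is a primitive \<open>2d\<close>-th root of unity.\<close>

lemma tau_eigen_vanish:
  assumes t: "t \<noteq> 0" "t * t = \<zeta>" "t ^ d = -1" and s: "s = t \<or> s = inverse t"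
    and eigen: "ap (tau t) m = scl [:s ^ d:] m" and deg: "i + j + c + e < d"
  shows "Poly_Mapping.lookup m (i, j, c, e, 1) = 0"
proof -
  define w where "w = wgt (i, j, c, e, 1)"
  have w: "\<bar>w\<bar> < int d" using deg by (simp add: w_def)
  have ord: "t powi k \<noteq> 1" if "0 < k" "k < 2 * int d" for k
    using sqrt_zeta_order[OF t(2,3), of "nat k"] that by (simp add: power_int_def)
  have "t powi w \<noteq> s ^ d"
  proof
    assume eq: "t powi w = s ^ d"
    show False
    proof (cases "s = t")
      case True
      then have "t powi (int d - w) = 1" using eq t(1) by (simp add: power_int_diff)
      then show False using ord[of "int d - w"] w by auto
    next
      case False
      then have "t powi (int d + w) = 1" using eq t(1) s by (simp add: power_int_add power_inverse)
      then show False using ord[of "int d + w"] w by auto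
    qed
  qed
  moreover have "[:t powi w:] * Poly_Mapping.lookup m (i, j, c, e, 1) = [:s ^ d:] * Poly_Mapping.lookup m (i, j, c, e, 1)"
    using lookup_tau[OF t(1), of m i j c e 1] unfolding eigen by (simp add: w_def one_dih_def)
  ultimately show ?thesis by (metis mult_cancel_right pCons_eq_iff)
qed

lemma tau_v0: "ap (tau t) v0 = v0"
  by (simp add: v0_def one_dih_def ap_tau_Rot flip: one_pCons)

text \<open>Below degree d the eigenvalue of \<open>tau t\<close> excludes every monomial at 1; from
  degree d on, the leading term is all there is, since the remainder lies in
  \<open>Dl d\<close>.\<close>

lemma lookup_Pw:
  assumes t: "t \<noteq> 0" "t * t = \<zeta>" "t ^ d = -1" and s: "s = t \<or> s = inverse t"
    and conj: "tau t * u = scal [:s:] * (u * tau t)" "tau t * v = scal [:s:] * (v * tau t)"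
    and lead: "ap (Pw u v d k) v0 - scl [:p:] (bas (i', j', c', e', 1)) \<in> Dl d"
    and deg: "i' + j' + c' + e' = d"
  shows "Poly_Mapping.lookup (ap (Pw u v d k) v0) (i, j, c, e, 1) =
    (if (i, j, c, e) = (i', j', c', e') then [:p:] else 0)"
proof (cases "i + j + c + e < d")
  case True
  have "ap (tau t) (ap (Pw u v d k) v0) = scl [:s ^ d:] (ap (Pw u v d k) v0)"
    using arg_cong[OF Pw_conj[OF conj, of d k], of "\<lambda>f. ap f v0"] by (simp add: tau_v0)
  from tau_eigen_vanish[OF t s this True] show ?thesis using True deg by auto
next
  case False
  then show ?thesis
    using Dl_lookup[OF lead, of "(i, j, c, e, 1)"]
    by (auto simp: lookup_minus lookup_single when_def split: if_splits)
qed

lemma Trunc_A: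
  assumes k: "k \<le> d"
  shows "Trunc d \<zeta> a (kap (A k)) = vx ^ (d - k) * vY ^ k + vy ^ (d - k) * vX ^ k"
proof (rule Trunc_eqI[OF A_R])
  fix i j c e
  obtain t where t: "t \<noteq> 0" "t * t = \<zeta>" "t ^ d = -1" using sqrt_zeta by blast
  let ?b = "of_nat (d choose k) :: complex"
  have l1: "ap (Pw mx mY d k) v0 - scl [:?b:] (bas (d - k, 0, 0, k, 1)) \<in> Dl d"
    by (rule Pw_leading[OF raises_mx raises_mY, where s = "\<lambda>i j. (i, 0, 0, j, 1)"])
      (use mY_leading[of _ 0 0 _ 1] in auto)
  have l2: "ap (Pw my mX d k) v0 - scl [:?b:] (bas (0, d - k, k, 0, 1)) \<in> Dl d"
    by (rule Pw_leading[OF raises_my raises_mX, where s = "\<lambda>i j. (0, i, j, 0, 1)"])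
      (use mX_leading[of 0 _ _ 0 1] in auto)
  have d1: "d - k + 0 + 0 + k = d" and d2: "0 + (d - k) + k + 0 = d" using k by auto
  have b: "?b \<noteq> 0" using k by auto
  show "poly (Poly_Mapping.lookup (ap (A k) v0) (i, j, c, e, 1)) 0 =
      Poly_Mapping.lookup (vx ^ (d - k) * vY ^ k + vy ^ (d - k) * vX ^ k) (of_exps (i, j, c, e))"
    unfolding var_monomial A_def ap_simps ap_scal lookup_scl lookup_add
      lookup_Pw[OF t disjI1[OF refl] tau_mx[OF t(1)] tau_mX_mY(2)[OF t(1,2)] l1 d1]
      lookup_Pw[OF t disjI2[OF refl] tau_my[OF t(1)] tau_mX_mY(1)[OF t(1,2)] l2 d2]
    using k b by (auto simp: lookup_single when_def of_exps_inject simp del: of_exps.simps)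
qed

text \<open>The term -\<hbar> vanishes at \<hbar> = 0 and \<open>As\<close> is supported on
  reflections, so the truncation sees neither.\<close>

lemma Trunc_ee: "Trunc d \<zeta> a (kap ee) = vx * vX + vy * vY"
proof (rule Trunc_eqI[OF ee_R])
  fix i j c e
  have As: "Poly_Mapping.lookup (ap As v0) (i, j, c, e, 1) = 0"
    by (simp add: As_def S_def ap_sum_left lookup_sum v0_def one_dih_def ap_mg lookup_single)
  have "ap ee v0 = bas (1, 0, 1, 0, 1) + bas (0, 1, 0, 1, 1) - scl [:0, 1:] v0 + ap As v0"
    by (simp add: ee_def v0_def hb_def)
  then show "poly (Poly_Mapping.lookup (ap ee v0) (i, j, c, e, 1)) 0 =
      Poly_Mapping.lookup (vx * vX + vy * vY) (of_exps (i, j, c, e))"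
    using var_monomial(3)[of 1 1] var_monomial(4)[of 1 1]
    by (auto simp: As lookup_add lookup_minus lookup_single when_def of_exps_inject simp del: of_exps.simps)
qed

lemma eu_eq: "eu d \<zeta> a = kap ee"
  unfolding eu_def by (rule central_lift_eqI[OF central_ee Trunc_ee])

lemma aa_eq: "j \<le> d \<Longrightarrow> aa d \<zeta> a (int j) = kap (A j)"
  unfolding aa_def by (simp add: central_lift_eqI[OF central_A Trunc_A])

lemma aa_eq_0: "j < 0 \<or> j > int d \<Longrightarrow> aa d \<zeta> a j = kap 0"
  unfolding aa_def by (auto simp: Hc_zero)

section \<open>The bracket relations\<close>

lemma poisson_comm:
  assumes "central f" "central g" "u \<in> R" "comm f g = hb * u"
  shows "poisson d \<zeta> a (kap f) (kap g) = kap u"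
  using poisson_kap[OF assms(1-3)] assms(4) by (simp add: comm_def)

lemma bracket_q_Q: "poisson d \<zeta> a (qc d \<zeta> a) (Qc d \<zeta> a) = eu d \<zeta> a"
  using poisson_comm[OF central_qq central_QQ ee_R comm_qq_QQ]
  by (simp add: qc_eq Qc_eq eu_eq flip: qq_def QQ_def)

lemma bracket_eu_q: "poisson d \<zeta> a (eu d \<zeta> a) (qc d \<zeta> a) = scale_c d \<zeta> a (- 2) (qc d \<zeta> a)"
  and bracket_eu_Q: "poisson d \<zeta> a (eu d \<zeta> a) (Qc d \<zeta> a) = scale_c d \<zeta> a 2 (Qc d \<zeta> a)"
proof -
  have R: "qq \<in> R" "QQ \<in> R" using central_qq central_QQ centralD(1) by auto
  have two: "scal [:2:] * f = f + f" "scal [:-2:] * f = - f - f" for f :: "idx endo"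
  proof -
    have "scal ([:1:] + [:1:]) * f = f + f" "scal (- [:1:] - [:1:]) * f = - f - f"
      by (simp_all only: scal_add scal_diff scal_minus one_pCons[symmetric] scal_1
          distrib_right left_diff_distrib mult_1_left mult_minus_left)
    then show "scal [:2:] * f = f + f" "scal [:-2:] * f = - f - f" by simp_all
  qed
  have "comm ee qq = hb * (scal [:-2:] * qq)" "comm ee QQ = hb * (scal [:2:] * QQ)"
    unfolding two qq_def QQ_def comm_mult comm_ee
    by (simp_all add: algebra_simps hb_left)
  then show "poisson d \<zeta> a (eu d \<zeta> a) (qc d \<zeta> a) = scale_c d \<zeta> a (- 2) (qc d \<zeta> a)"
    "poisson d \<zeta> a (eu d \<zeta> a) (Qc d \<zeta> a) = scale_c d \<zeta> a 2 (Qc d \<zeta> a)"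
    using poisson_comm[OF central_ee central_qq R_mult[OF R_scal R(1)]]
      poisson_comm[OF central_ee central_QQ R_mult[OF R_scal R(2)]] R
    by (simp_all add: qc_eq Qc_eq eu_eq scale_kap flip: qq_def QQ_def)
qed

lemma bracket_q_a:
  assumes "j \<le> d"
  shows "poisson d \<zeta> a (qc d \<zeta> a) (aa d \<zeta> a (int j)) = scale_c d \<zeta> a (of_nat j) (aa d \<zeta> a (int j - 1))"
proof (cases j)
  case 0
  have "poisson d \<zeta> a (kap qq) (kap (A 0)) = kap 0"
    by (rule poisson_comm[OF central_qq central_A R_zero]) (simp_all add: comm_qq_A)
  then show ?thesis
    using aa_eq[of 0] by (simp add: 0 aa_eq_0 qc_eq scale_kap R_zero flip: qq_def)
next
  case (Suc i)
  then have i: "i < d" using assms by simp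
  have "poisson d \<zeta> a (kap qq) (kap (A (Suc i))) = kap (scal [:of_nat (Suc i):] * A i)"
    by (rule poisson_comm[OF central_qq central_A R_mult[OF R_scal A_R]]) (use i comm_qq_A(2) in auto)
  then show ?thesis
    using i aa_eq[of i] aa_eq[of "Suc i"] by (simp add: Suc qc_eq scale_kap A_R flip: qq_def)
qed

lemma bracket_eu_a:
  assumes "j \<le> d"
  shows "poisson d \<zeta> a (eu d \<zeta> a) (aa d \<zeta> a (int j)) = scale_c d \<zeta> a (2 * of_nat j - of_nat d) (aa d \<zeta> a (int j))"
  using poisson_comm[OF central_ee central_A[OF assms] R_mult[OF R_scal A_R] comm_ee_A]
  by (simp add: eu_eq aa_eq[OF assms] scale_kap A_R)

lemma bracket_Q_a:
  assumes "j \<le> d"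
  shows "poisson d \<zeta> a (Qc d \<zeta> a) (aa d \<zeta> a (int j)) = scale_c d \<zeta> a (of_nat j - of_nat d) (aa d \<zeta> a (int j + 1))"
proof (cases "j < d")
  case True
  have "poisson d \<zeta> a (kap QQ) (kap (A j)) = kap (scal [:of_nat j - of_nat d:] * A (Suc j))"
    by (rule poisson_comm[OF central_QQ central_A R_mult[OF R_scal A_R]]) (use True comm_QQ_A[of j] in auto)
  then show ?thesis
    using True aa_eq[of j] aa_eq[of "Suc j"] by (simp add: Qc_eq scale_kap A_R add.commute flip: QQ_def)
next
  case False
  have "poisson d \<zeta> a (kap QQ) (kap (A j)) = kap 0"
    by (rule poisson_comm[OF central_QQ central_A R_zero]) (use False assms comm_QQ_A[of j] in auto)
  then show ?thesis
    using False assms aa_eq[of j] by (simp add: aa_eq_0 Qc_eq scale_kap R_zero flip: QQ_def)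
qed

end

theorem proposition2p6:
  fixes d :: nat and \<zeta> a :: complex
  assumes "d \<ge> 1" and "primitive_root_of_unity d \<zeta>"
  shows "poisson d \<zeta> a (qc d \<zeta> a) (Qc d \<zeta> a) = eu d \<zeta> a
    \<and> poisson d \<zeta> a (eu d \<zeta> a) (qc d \<zeta> a) = scale_c d \<zeta> a (- 2) (qc d \<zeta> a)
    \<and> poisson d \<zeta> a (eu d \<zeta> a) (Qc d \<zeta> a) = scale_c d \<zeta> a 2 (Qc d \<zeta> a)
    \<and> (\<forall>j::int. 0 \<le> j \<and> j \<le> int d \<longrightarrow>
          poisson d \<zeta> a (qc d \<zeta> a) (aa d \<zeta> a j)
            = scale_c d \<zeta> a (of_int j) (aa d \<zeta> a (j - 1))
        \<and> poisson d \<zeta> a (eu d \<zeta> a) (aa d \<zeta> a j)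
            = scale_c d \<zeta> a (of_int (2 * j - int d)) (aa d \<zeta> a j)
        \<and> poisson d \<zeta> a (Qc d \<zeta> a) (aa d \<zeta> a j)
            = scale_c d \<zeta> a (of_int (j - int d)) (aa d \<zeta> a (j + 1)))"
proof -
  interpret cherednik d \<zeta> a by unfold_locales (fact assms)+
  show ?thesis
  proof (intro conjI allI impI)
    fix j :: int assume "0 \<le> j \<and> j \<le> int d"
    then obtain k where k: "j = int k" "k \<le> d" using zero_le_imp_eq_int by auto
    show "poisson d \<zeta> a (qc d \<zeta> a) (aa d \<zeta> a j) = scale_c d \<zeta> a (of_int j) (aa d \<zeta> a (j - 1))"
      using bracket_q_a[OF k(2)] by (simp add: k)
    show "poisson d \<zeta> a (eu d \<zeta> a) (aa d \<zeta> a j) = scale_c d \<zeta> a (of_int (2 * j - int d)) (aa d \<zeta> a j)"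
      using bracket_eu_a[OF k(2)] by (simp add: k)
    show "poisson d \<zeta> a (Qc d \<zeta> a) (aa d \<zeta> a j) = scale_c d \<zeta> a (of_int (j - int d)) (aa d \<zeta> a (j + 1))"
      using bracket_Q_a[OF k(2)] by (simp add: k)
  qed (rule bracket_q_Q bracket_eu_q bracket_eu_Q)+
qed

end
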